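(* Let $a>0$, $b>0$, $0<c<1$ with $ac\le 1$ and $b(1-c)\le 1$, and let $f=f_{a,b,c}$ be the piecewise linear Lorenz map on $[0,1]$ given by $f(x)=ax+1-ac$ for $x\in[0,c)$ and $f(x)=b(x-c)$ for $x\in(c,1]$. Suppose $ac+b(1-c)>1$. Let $\kappa$ be the minimal period of the periodic points of $f$. (i) If $\kappa=1$, then the absolutely continuous invariant probability measure (acim) of $f$ is equivalent to the Lebesgue measure. (ii) If $2\le\kappa<\infty$, let $P_L,P_R$ be the adjacent points of the unique $\kappa$-periodic orbit of $f$ with $c\in[P_L,P_R]$, and let $A:=f^\kappa(c+)$, $B:=f^\kappa(c-)$. Then the acim of $f$ is equivalent to the Lebesgue measure if and only if $$[A,B]\setminus[P_L,P_R]\ne\emptyset\quad\text{or}\quad [A,B]=[P_L,P_R].$$ (iii) In particular, when $\kappa=2$, put $M:=\min\left\{\frac{c-A}{B-c},\frac{B-c}{c-A}\right\}$. Then the acim of $f$ is equivalent to the Lebesgue measure if and only if $$ab>1+M\ \text{ when } M<1,\qquad ab\ge 2\ \text{ when } M=1.$$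
   Context: When $ac+b(1-c)>1$ it is known that $f$ has a unique acim, i.e. a unique $f$-invariant Borel probability measure absolutely continuous with respect to Lebesgue measure. "Equivalent to the Lebesgue measure" means having the same null sets as Lebesgue measure on $[0,1]$. Convention at $c$: the map is not defined at $c$; instead $c$ is regarded as two points $c-<c+$, with $f(c-)=1$ and $f(c+)=0$, so that $f$ is a map on $[0,c-]\cup[c+,1]$. Accordingly $f^n(x+)$ and $f^n(x-)$ denote one-sided limits $\lim_{y\downarrow x}f^n(y)$ and $\lim_{y\uparrow x}f^n(y)$, and an orbit that hits $c$ is continued according to the side from which $c$ is approached; in particular $x$ counts as periodic with period $n$ if $f^n(x+)=x$ or $f^n(x-)=x$. Under the hypothesis $ac+b(1-c)>1$ it is known that $f$ has periodic points and that, if $2\le\kappa<\infty$, there is exactly one periodic orbit $O$ of period $\kappa$. $P_L$ is the largest point of $O$ in $[0,c-]$ and $P_R$ the smallest point of $O$ in $[c+,1]$; it is known that $f^\kappa$ is linear on $[P_L,c)$ and on $(c,P_R]$. When $\kappa=2$, $f$ has no fixed point, $A=f(0)=1-ac<B=f(1)=b(1-c)$ and $c\in[A,B]$. In the definition of $M$, $t/0$ is read as $+\infty$ for $t>0$. *)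

theory Defs
  imports "HOL-Probability.Probability"
begin

text \<open>
  The value at \<open>c\<close> is a dummy: everything below uses the map only through one-sided limits
  of its iterates or almost everywhere. It is chosen in \<open>[0,1]\<close>, so that the map sends
  \<open>[0,1]\<close> into itself.
\<close>

definition lorenz :: "real \<Rightarrow> real \<Rightarrow> real \<Rightarrow> real \<Rightarrow> real" where
  "lorenz a b c x = (if x < c then a * x + 1 - a * c else b * (x - c))"

text \<open>\<open>f\<^sup>n(x-)\<close> and \<open>f\<^sup>n(x+)\<close>.\<close>

definition iter_left :: "real \<Rightarrow> real \<Rightarrow> real \<Rightarrow> nat \<Rightarrow> real \<Rightarrow> real" where
  "iter_left a b c n x = Lim (at_left x) (lorenz a b c ^^ n)"

definition iter_right :: "real \<Rightarrow> real \<Rightarrow> real \<Rightarrow> nat \<Rightarrow> real \<Rightarrow> real" where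
  "iter_right a b c n x = Lim (at_right x) (lorenz a b c ^^ n)"

text \<open>Inside \<open>[0,1]\<close> the point \<open>0\<close> is approached only from the right, \<open>1\<close> only from the left.\<close>

definition has_period :: "real \<Rightarrow> real \<Rightarrow> real \<Rightarrow> nat \<Rightarrow> real \<Rightarrow> bool" where
  "has_period a b c n x \<longleftrightarrow> n > 0 \<and>
     (x \<in> {0<..1} \<and> iter_left a b c n x = x \<or> x \<in> {0..<1} \<and> iter_right a b c n x = x)"

text \<open>The minimal period, equal to \<open>\<infinity>\<close> if there is no periodic point.\<close>

definition min_period :: "real \<Rightarrow> real \<Rightarrow> real \<Rightarrow> enat" where
  "min_period a b c = (INF n \<in> {n. \<exists>x. has_period a b c n x}. enat n)"

text \<open>
  The phase space with \<open>c\<close> split into \<open>c- < c+\<close> is the disjoint union of \<open>[0,c-]\<close> and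
  \<open>[c+,1]\<close>: its points are written \<^term>\<open>Inl y\<close> with \<open>y \<le> c\<close> and \<^term>\<open>Inr y\<close> with
  \<open>y \<ge> c\<close>. Since \<open>f\<close> is increasing on both branches, an orbit started at \<open>x-\<close> approaches
  each of its points from the left, so that it meets \<open>c\<close> as \<open>c-\<close>; similarly for \<open>x+\<close>
  and \<open>c+\<close>.
\<close>

definition periodic_orbit ::
    "real \<Rightarrow> real \<Rightarrow> real \<Rightarrow> nat \<Rightarrow> (real + real) set \<Rightarrow> bool" where
  "periodic_orbit a b c n Q \<longleftrightarrow> n > 0 \<and>
     ((\<exists>x\<in>{0<..1}. iter_left a b c n x = x \<and>
         Q = (\<lambda>i. let y = iter_left a b c i x in if y \<le> c then Inl y else Inr y) ` {..<n}) \<or>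
      (\<exists>x\<in>{0..<1}. iter_right a b c n x = x \<and>
         Q = (\<lambda>i. let y = iter_right a b c i x in if y < c then Inl y else Inr y) ` {..<n}))"

definition orbit_left :: "(real + real) set \<Rightarrow> real" where
  "orbit_left Q = Max {y. Inl y \<in> Q}"

definition orbit_right :: "(real + real) set \<Rightarrow> real" where
  "orbit_right Q = Min {y. Inr y \<in> Q}"

definition unit_lebesgue :: "real measure" where
  "unit_lebesgue = restrict_space lborel {0..1}"

definition acim :: "real \<Rightarrow> real \<Rightarrow> real \<Rightarrow> real measure \<Rightarrow> bool" where
  "acim a b c \<mu> \<longleftrightarrow>
     prob_space \<mu> \<and> sets \<mu> = sets (restrict_space borel {0..1}) \<and>
     lorenz a b c \<in> measurable \<mu> \<mu> \<and> distr \<mu> \<mu> (lorenz a b c) = \<mu> \<and>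
     absolutely_continuous unit_lebesgue \<mu>"

definition equivalent_to_lebesgue :: "real measure \<Rightarrow> bool" where
  "equivalent_to_lebesgue \<mu> \<longleftrightarrow> null_sets \<mu> = null_sets unit_lebesgue"

end

theory Submission imports Defs begin

text \<open>
  Let \<open>S\<close> be the set where the density of the acim is positive; it is forward invariant up to null sets.
  A Moebius change of coordinates turns \<open>a c + b (1 - c) > 1\<close> into uniform expansion. A bound on the sum of
  the reciprocal slopes over the pieces of an iterated interval then shows that \<open>S\<close> contains an interval up
  to a null set, and the images of that interval grow over \<open>c\<close>.

  If \<open>\<kappa> = 1\<close>, one of the end points is fixed and repelling, and a one-sided neighbourhood of it grows over
  everything. Let \<open>\<kappa> \<ge> 2\<close> and let \<open>P\<^sub>L \<le> c \<le> P\<^sub>R\<close> be as in the statement. If \<open>[A, B]\<close> is a proper subset of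
  \<open>[P\<^sub>L, P\<^sub>R]\<close>, then \<open>[A, B)\<close> is invariant under \<open>f\<^sup>\<kappa>\<close>, and next to it there is a wandering interval. Otherwise
  the preimages of the periodic orbit accumulate at \<open>c\<close>: the gap \<open>(u, v)\<close> around \<open>c\<close> in their closure would
  be bounded by periodic points, and comparing the slopes of the two return maps inside the gap with
  those outside leads to a contradiction. Hence \<open>S\<close> contains a neighbourhood of a point of the periodic orbit, and by
  expansion all of \<open>[P\<^sub>L, P\<^sub>R]\<close>. The images of \<open>[P\<^sub>L, P\<^sub>R]\<close> fill \<open>[0, 1]\<close>, since a gap left over by them would produce
  a periodic point of period less than \<open>\<kappa>\<close>.
\<close>

section \<open>One-sided iterates and expansion\<close>

text \<open>Two difficulties shape the proof. The first is the convention at \<open>c\<close>. It is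
  carried by two total maps, \<open>fR\<close> and \<open>fL\<close>: the left end of an interval
  moves under \<open>fR\<close>, the right end under \<open>fL\<close>, so an end that meets
  \<open>c\<close> is continued on the correct side by itself. The reflection x -> 1 - x exchanges
  the two maps, \<open>a\<close> with \<open>b\<close> and \<open>c\<close> with
  \<open>1 - c\<close>; through it the periodic orbit can always be taken with limits from the left.
  The second is that one slope may be less than 1 and that intervals are cut at \<open>c\<close>. A
  cut doubles the number of pieces, so expansion alone is not enough: an iterate with slopes at
  least 3 is used, for which a short interval is cut at most once, and two pieces of reciprocal
  slope at most 1/3 leave the factor 2/3 < 1. Measure theory and dynamics meet only in a predicate
  \<open>F\<close> on intervals that obeys a few closure rules. The rules are symmetric under
  reflection, so the arguments about growth can be reflected without touching the measure.\<close>

text \<open>The left-continuous version of the map: its iterates are the limits from the left, those of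
  \<^const>\<open>lorenz\<close> the limits from the right.\<close>

definition lorenzl :: "real \<Rightarrow> real \<Rightarrow> real \<Rightarrow> real \<Rightarrow> real" where
  "lorenzl a b c x = (if x \<le> c then a * x + 1 - a * c else b * (x - c))"

text \<open>Reflection turns \<open>x < c\<close> into the strict inequality on the other side, so
  it exchanges not only the branches but also the two values at \<open>c\<close>. Many symmetric
  halves of later arguments are transported by it.\<close>

lemma lorenz_reflect: "lorenz b a (1 - c) (1 - x) = 1 - lorenzl a b c x"
  by (auto simp: lorenz_def lorenzl_def algebra_simps)

lemma lorenzl_reflect: "lorenzl b a (1 - c) (1 - x) = 1 - lorenz a b c x"
  by (auto simp: lorenz_def lorenzl_def algebra_simps)

lemma lorenz_funpow_reflect:
  "(lorenz b a (1 - c) ^^ n) (1 - x) = 1 - (lorenzl a b c ^^ n) x"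
  by (induction n) (simp_all add: lorenz_reflect)

lemma lorenzl_funpow_reflect:
  "(lorenzl b a (1 - c) ^^ n) (1 - x) = 1 - (lorenz a b c ^^ n) x"
  by (induction n) (simp_all add: lorenzl_reflect)

locale lorenz_map =
  fixes a b c :: real
  assumes a_pos: "a > 0" and b_pos: "b > 0" and c_pos: "0 < c" and c_less: "c < 1"
    and ac_le: "a * c \<le> 1" and bc_le: "b * (1 - c) \<le> 1"
    and overlap: "a * c + b * (1 - c) > 1"
begin

abbreviation fR :: "real \<Rightarrow> real" where "fR \<equiv> lorenz a b c"
abbreviation fL :: "real \<Rightarrow> real" where "fL \<equiv> lorenzl a b c"

lemma reflected: "lorenz_map b a (1 - c)"
  using a_pos b_pos c_pos c_less ac_le bc_le overlap by unfold_locales (auto simp: algebra_simps)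

lemma fR_c [simp]: "fR c = 0" and fL_c [simp]: "fL c = 1"
  by (simp_all add: lorenz_def lorenzl_def)

lemma fL_eq_fR: "x \<noteq> c \<Longrightarrow> fL x = fR x"
  by (auto simp: lorenz_def lorenzl_def)

lemma left_branch_bounds: "0 \<le> x \<Longrightarrow> x < c \<Longrightarrow> 0 \<le> a * x + 1 - a * c \<and> a * x + 1 - a * c < 1"
  using a_pos ac_le mult_strict_left_mono[of x c a] mult_nonneg_nonneg[of a x] by linarith

lemma right_branch_bounds: "c \<le> x \<Longrightarrow> x < 1 \<Longrightarrow> 0 \<le> b * (x - c) \<and> b * (x - c) < 1"
proof -
  assume x: "c \<le> x" "x < 1"
  then have "b * (x - c) < b * (1 - c)" using b_pos by (intro mult_strict_left_mono) auto
  moreover have "0 \<le> b * (x - c)" using x b_pos by simp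
  ultimately show ?thesis using bc_le by linarith
qed

lemma fR_range: "0 \<le> x \<Longrightarrow> x < 1 \<Longrightarrow> 0 \<le> fR x \<and> fR x < 1"
  using left_branch_bounds right_branch_bounds by (auto simp: lorenz_def not_less)

lemma fL_range: "0 < x \<Longrightarrow> x \<le> 1 \<Longrightarrow> 0 < fL x \<and> fL x \<le> 1"
proof -
  assume x: "0 < x" "x \<le> 1"
  interpret m: lorenz_map b a "1 - c" by (rule reflected)
  show ?thesis using m.fR_range[of "1 - x"] x unfolding lorenz_reflect by linarith
qed

lemma fR_range_closed: "0 \<le> x \<Longrightarrow> x \<le> 1 \<Longrightarrow> 0 \<le> fR x \<and> fR x \<le> 1"
  using fR_range[of x] fL_range[of x] fL_eq_fR[of x] c_less by (cases "x = 1") auto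

lemma funpow_fR_range: "0 \<le> x \<Longrightarrow> x < 1 \<Longrightarrow> 0 \<le> (fR ^^ n) x \<and> (fR ^^ n) x < 1"
  by (induction n) (auto simp: fR_range)

lemma funpow_fL_range: "0 < x \<Longrightarrow> x \<le> 1 \<Longrightarrow> 0 < (fL ^^ n) x \<and> (fL ^^ n) x \<le> 1"
  by (induction n) (auto simp: fL_range)

lemma funpow_fR_range_closed: "0 \<le> x \<Longrightarrow> x \<le> 1 \<Longrightarrow> 0 \<le> (fR ^^ n) x \<and> (fR ^^ n) x \<le> 1"
  by (induction n) (auto simp: fR_range_closed)

lemma funpow_fL_eq_fR: "(\<And>i. i < n \<Longrightarrow> (fL ^^ i) x \<noteq> c) \<Longrightarrow> (fL ^^ n) x = (fR ^^ n) x"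
  by (induction n) (metis funpow_0, metis comp_apply fL_eq_fR funpow.simps(2) less_Suc_eq)

lemma funpow_fL_eq_fR': "(\<And>i. i < n \<Longrightarrow> (fR ^^ i) x \<noteq> c) \<Longrightarrow> (fL ^^ n) x = (fR ^^ n) x"
  by (induction n) (metis funpow_0, metis comp_apply fL_eq_fR funpow.simps(2) less_Suc_eq)

text \<open>The left end of an interval moves under \<open>fR\<close> and its right end under \<open>fL\<close>: no image of \<open>(x, y)\<close>
  before the \<open>n\<close>-th contains \<open>c\<close>.\<close>

definition uncut :: "nat \<Rightarrow> real \<Rightarrow> real \<Rightarrow> bool" where
  "uncut n x y \<longleftrightarrow> (\<forall>i<n. (fL ^^ i) y \<le> c \<or> c \<le> (fR ^^ i) x)"

text \<open>At \<open>c\<close> the slope of the right branch is taken, because slopes are evaluated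
  at left ends of intervals, which move under \<open>fR\<close>.\<close>

definition sl :: "real \<Rightarrow> real" where
  "sl x = (if x < c then a else b)"

definition slope :: "nat \<Rightarrow> real \<Rightarrow> real" where
  "slope n x = (\<Prod>i<n. sl ((fR ^^ i) x))"

lemma sl_pos [simp]: "sl x > 0"
  using a_pos b_pos by (simp add: sl_def)

lemma slope_pos [simp]: "slope n x > 0"
  unfolding slope_def by (rule prod_pos) simp

lemma slope_0 [simp]: "slope 0 x = 1" and slope_Suc: "slope (Suc n) x = slope n x * sl ((fR ^^ n) x)"
  by (simp_all add: slope_def)

lemma slope_Suc_shift: "slope (Suc n) x = sl x * slope n (fR x)"
  unfolding slope_def by (subst prod.lessThan_Suc_shift) (simp add: funpow_swap1)

lemma uncut_0 [simp]: "uncut 0 x y"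
  by (simp add: uncut_def)

lemma uncut_Suc: "uncut (Suc n) x y \<longleftrightarrow> uncut n x y \<and> ((fL ^^ n) y \<le> c \<or> c \<le> (fR ^^ n) x)"
  by (auto simp: uncut_def less_Suc_eq)

lemma uncut_Suc_shift: "uncut (Suc n) x y \<longleftrightarrow> (y \<le> c \<or> c \<le> x) \<and> uncut n (fR x) (fL y)"
  by (auto simp: uncut_def All_less_Suc2 funpow_swap1)

lemma uncut_le: "uncut n x y \<Longrightarrow> m \<le> n \<Longrightarrow> uncut m x y"
  by (auto simp: uncut_def)

text \<open>When \<open>uncut n x y\<close> holds, \<open>aff n x\<close> is the affine map with which \<open>f\<^sup>n\<close> agrees on \<open>(x, y)\<close>.\<close>

definition aff :: "nat \<Rightarrow> real \<Rightarrow> real \<Rightarrow> real" where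
  "aff n x z = (fR ^^ n) x + slope n x * (z - x)"

lemma aff_self [simp]: "aff n x x = (fR ^^ n) x"
  by (simp add: aff_def)

lemma aff_mono: "z \<le> z' \<Longrightarrow> aff n x z \<le> aff n x z'"
  by (simp add: aff_def mult_left_mono less_imp_le)

lemma aff_strict_mono: "z < z' \<Longrightarrow> aff n x z < aff n x z'"
  by (simp add: aff_def)

lemma aff_Suc:
  assumes "y \<le> c \<or> c \<le> x" "x < y" "x \<le> z" "z \<le> y"
  shows "z < y \<Longrightarrow> fR z = fR x + sl x * (z - x)" "x < z \<Longrightarrow> fL z = fR x + sl x * (z - x)"
  using assms by (auto simp: lorenz_def lorenzl_def sl_def algebra_simps)

text \<open>Interior points follow both iterates, each end only the one that looks into the
  interval; the two implications record this. As long as no image contains \<open>c\<close> in its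
  interior, each step applies one and the same branch to the whole image.\<close>

lemma uncut_aff:
  assumes "uncut n x y" "x < y" "x \<le> z" "z \<le> y"
  shows "(z < y \<longrightarrow> (fR ^^ n) z = aff n x z) \<and> (x < z \<longrightarrow> (fL ^^ n) z = aff n x z)"
  using assms
proof (induction n arbitrary: z)
  case (Suc n)
  have uncut_n: "uncut n x y" "(fL ^^ n) y \<le> c \<or> c \<le> (fR ^^ n) x"
    using Suc.prems by (auto simp: uncut_Suc)
  define p where "p = aff n x x"
  define q where "q = aff n x y"
  define w where "w = aff n x z"
  have 1: "(z < y \<longrightarrow> (fR ^^ n) z = w) \<and> (x < z \<longrightarrow> (fL ^^ n) z = w)"
    using Suc.IH[OF uncut_n(1)] Suc.prems by (auto simp: w_def)
  have y: "(fL ^^ n) y = q" using Suc.IH[OF uncut_n(1), of y] Suc.prems by (simp add: q_def)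
  have x: "(fR ^^ n) x = p" by (simp add: p_def)
  have pq: "p < q" "p \<le> w" "w \<le> q" "z < y \<Longrightarrow> w < q" "x < z \<Longrightarrow> p < w"
    using Suc.prems aff_mono aff_strict_mono by (auto simp: p_def q_def w_def simp del: aff_self)
  have c: "q \<le> c \<or> c \<le> p" using uncut_n(2) x y by simp
  have "fR p + sl p * (w - p) = aff (Suc n) x z"
    unfolding p_def w_def by (simp add: aff_def slope_Suc)
  then show ?case
    using aff_Suc[OF c pq(1-3)] 1 pq(4,5) by auto
qed (simp add: aff_def)

lemma uncut_right_end: "uncut n x y \<Longrightarrow> x < y \<Longrightarrow> (fL ^^ n) y = aff n x y"
  using uncut_aff by auto

lemma uncut_less: "uncut n x y \<Longrightarrow> x < y \<Longrightarrow> (fR ^^ n) x < (fL ^^ n) y"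
  by (simp add: uncut_right_end aff_def)

lemma uncut_length: "uncut n x y \<Longrightarrow> x < y \<Longrightarrow> (fL ^^ n) y - (fR ^^ n) x = slope n x * (y - x)"
  by (simp add: uncut_right_end aff_def)

lemma uncut_sub:
  assumes "uncut n x y" "x \<le> x'" "x' < y'" "y' \<le> y"
  shows "uncut n x' y'"
  unfolding uncut_def
proof (intro allI impI)
  fix i assume "i < n"
  then have uncut_i: "uncut i x y" "(fL ^^ i) y \<le> c \<or> c \<le> (fR ^^ i) x"
    using assms(1) by (auto simp: uncut_def)
  have "(fL ^^ i) y' = aff i x y'" "(fR ^^ i) x' = aff i x x'" "(fL ^^ i) y = aff i x y"
    using uncut_aff[OF uncut_i(1), of y'] uncut_aff[OF uncut_i(1), of x'] uncut_aff[OF uncut_i(1), of y] assms by simp_all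
  then show "(fL ^^ i) y' \<le> c \<or> c \<le> (fR ^^ i) x'"
    using uncut_i(2) aff_mono[OF assms(2), of i x] aff_mono[OF assms(4), of i x] by auto
qed

lemma uncut_interior_ne:
  assumes "uncut n x y" "x < z" "z < y" "i < n"
  shows "(fR ^^ i) z \<noteq> c"
proof -
  have uncut_i: "uncut i x y" "(fL ^^ i) y \<le> c \<or> c \<le> (fR ^^ i) x"
    using assms by (auto simp: uncut_def)
  have "(fR ^^ i) z = aff i x z" "(fL ^^ i) y = aff i x y"
    using uncut_aff[OF uncut_i(1)] assms by auto
  then show ?thesis
    using uncut_i(2) aff_strict_mono[OF assms(2), of i x] aff_strict_mono[OF assms(3), of i x] by auto
qed

lemma uncut_image_point:
  assumes "uncut n x y" "x < y" "(fR ^^ n) x < w" "w < (fL ^^ n) y"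
  obtains z where "x < z" "z < y" "(fR ^^ n) z = w"
proof -
  define z where "z = x + (w - (fR ^^ n) x) / slope n x"
  have w: "aff n x z = w" using less_imp_neq[OF slope_pos[of n x]] by (simp add: aff_def z_def)
  have "x < z" using assms(3) by (simp add: z_def)
  moreover have "z < y"
    using aff_mono[of y z n x] w assms(4) uncut_right_end[OF assms(1,2)] by linarith
  ultimately show thesis using uncut_aff[OF assms(1,2), of z] w by (intro that) auto
qed

text \<open>The metric with density \<open>1 / (\<alpha> + \<beta> * x)\<close> is expanded at
  \<open>x\<close> when the weight at the image is less than the slope times the weight at
  \<open>x\<close>. The terms in \<open>x\<close> cancel, so each branch contributes one linear
  inequality; the first two conditions make the weight positive at 0 and at 1. Rewritten as a
  comparison of products, \<open>overlap\<close> makes the two inequalities compatible.\<close>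

lemma lyapunov_weight:
  obtains \<alpha> \<beta> where "\<alpha> > 0" "\<alpha> + \<beta> > 0"
    "\<alpha> * (1 - a) + \<beta> * (1 - a * c) < 0" "\<alpha> * (1 - b) < \<beta> * b * c"
proof -
  consider "b > 1" | "b \<le> 1" "a > 1"
  proof (cases "b > 1")
    case False
    then have "b * (1 - c) \<le> 1 * (1 - c)" using c_less by (intro mult_right_mono) auto
    then have "a * c > 1 * c" using overlap by simp
    then show ?thesis using False that c_pos mult_less_cancel_right[of 1 c a] by auto
  qed auto
  then show thesis
  proof cases
    case 1
    \<comment> \<open>\<open>pR\<close> is the fixed point of the extended right branch; it lies at
      or beyond 1 because \<open>b * (1 - c) \<le> 1\<close>. With \<beta> = -1 the weight is
      \<open>p - x\<close>, and its zero \<open>p\<close> is put slightly to the right of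
      \<open>pR\<close>.\<close>
    define pR where "pR = b * c / (b - 1)"
    have pR: "pR * (b - 1) = b * c" using 1 by (simp add: pR_def)
    have "pR \<ge> 1" using 1 bc_le by (simp add: pR_def field_simps)
    have "\<exists>p>pR. p * (1 - a) < 1 - a * c"
    proof (cases "a < 1")
      case True
      have "b * c * (1 - a) < (1 - a * c) * (b - 1)" using overlap by (simp add: algebra_simps)
      then have "pR < (1 - a * c) / (1 - a)" using 1 True by (simp add: pR_def field_simps)
      then obtain p where "pR < p" "p < (1 - a * c) / (1 - a)" using dense by blast
      then show ?thesis using True by (auto simp: field_simps)
    next
      case False
      then have "a = 1 \<or> a > 1" by auto
      then show ?thesis
      proof
        assume "a = 1" then show ?thesis using c_less by (intro exI[of _ "pR + 1"]) auto
      next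
        assume "a > 1"
        then have "(pR + 1) * (1 - a) < 0" using \<open>pR \<ge> 1\<close> by (intro mult_pos_neg) auto
        then show ?thesis using ac_le by (intro exI[of _ "pR + 1"]) auto
      qed
    qed
    then obtain p where p: "p > pR" "p * (1 - a) < 1 - a * c" by auto
    have "p * (b - 1) > pR * (b - 1)" using p 1 by (intro mult_strict_right_mono) auto
    then have "p * (1 - b) < - b * c" using pR by (simp add: algebra_simps)
    then show thesis using p \<open>pR \<ge> 1\<close> by (intro that[of p "-1"]) auto
  next
    case 2
    have lt: "(1 - a * c) * (1 - b) < b * c * (a - 1)" using overlap by (simp add: algebra_simps)
    \<comment> \<open>With \<beta> = 1 the zero of the weight is -\<alpha>. It has to lie to the
      left of the fixed point \<open>- (1 - a * c) / (a - 1)\<close> of the extended left branch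
      and, if \<open>b < 1\<close>, to the right of the fixed point \<open>- b * c / (1 - b)\<close>
      of the extended right branch.\<close>
    have "\<exists>\<alpha>>0. \<alpha> * (a - 1) > 1 - a * c \<and> \<alpha> * (1 - b) < b * c"
    proof (cases "b < 1")
      case True
      then have "(1 - a * c) / (a - 1) < b * c / (1 - b)" using 2 lt by (simp add: field_simps)
      then obtain p where p: "(1 - a * c) / (a - 1) < p" "p < b * c / (1 - b)" using dense by blast
      moreover have "(1 - a * c) / (a - 1) \<ge> 0" using ac_le 2 by simp
      ultimately have "p > 0" by linarith
      with p show ?thesis using True 2 by (intro exI[of _ p]) (auto simp: field_simps)
    next
      case False
      then have "b = 1" using 2 by simp
      define \<alpha> where "\<alpha> = (1 - a * c) / (a - 1) + 1"
      have "\<alpha> * (a - 1) = 1 - a * c + (a - 1)" using 2 by (simp add: \<alpha>_def distrib_right)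
      moreover have "\<alpha> > 0" using ac_le 2 by (simp add: \<alpha>_def add_nonneg_pos)
      ultimately show ?thesis using 2 b_pos c_pos \<open>b = 1\<close> by (intro exI[of _ \<alpha>]) auto
    qed
    then obtain \<alpha> where "\<alpha> > 0" "\<alpha> * (a - 1) > 1 - a * c" "\<alpha> * (1 - b) < b * c"
      by auto
    then show thesis by (intro that[of \<alpha> 1]) (auto simp: algebra_simps)
  qed
qed

text \<open>The weight \<open>1 / (\<alpha> + \<beta> x)\<close> is the density of a metric which both branches expand, although
  one of the slopes may be less than 1.\<close>

lemma expansion_weight:
  obtains \<theta> m \<alpha> \<beta> M where "\<theta> > 1" "0 < m" "\<And>x. 0 \<le> x \<Longrightarrow> x \<le> 1 \<Longrightarrow> m \<le> \<alpha> + \<beta> * x"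
    "\<And>x. 0 \<le> x \<Longrightarrow> x \<le> 1 \<Longrightarrow> \<alpha> + \<beta> * x \<le> M"
    "\<And>x. 0 \<le> a * x + 1 - a * c \<Longrightarrow> a * x + 1 - a * c \<le> 1 \<Longrightarrow>
      \<theta> * (\<alpha> + \<beta> * (a * x + 1 - a * c)) \<le> a * (\<alpha> + \<beta> * x)"
    "\<And>x. 0 \<le> b * (x - c) \<Longrightarrow> b * (x - c) \<le> 1 \<Longrightarrow>
      \<theta> * (\<alpha> + \<beta> * (b * (x - c))) \<le> b * (\<alpha> + \<beta> * x)"
proof -
  obtain \<alpha> \<beta> where w: "\<alpha> > 0" "\<alpha> + \<beta> > 0"
    "\<alpha> * (1 - a) + \<beta> * (1 - a * c) < 0" "\<alpha> * (1 - b) < \<beta> * b * c"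
      by (rule lyapunov_weight)
  define m where "m = min \<alpha> (\<alpha> + \<beta>)"
  define M where "M = max \<alpha> (\<alpha> + \<beta>)"
  \<comment> \<open>The gain per step is a constant on each branch, and \<open>d\<close> is the
    smaller of the two. As the weight is at most \<open>M\<close>, the additive gain
    \<open>d\<close> amounts to a factor of at least \<open>1 + d / M\<close>.\<close>
  define d where "d = min (- (\<alpha> * (1 - a) + \<beta> * (1 - a * c))) (\<beta> * b * c - \<alpha> * (1 - b))"
  have pos: "m > 0" "M > 0" "d > 0" using w by (auto simp: m_def M_def d_def)
  have mM: "m \<le> \<alpha> + \<beta> * x \<and> \<alpha> + \<beta> * x \<le> M" if "0 \<le> x" "x \<le> 1"
    for x
  proof (cases "\<beta> \<ge> 0")
    case True
    then have "0 \<le> \<beta> * x" "\<beta> * x \<le> \<beta>" using that mult_left_le[of x \<beta>] by auto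
    then show ?thesis by (auto simp: m_def M_def)
  next
    case False
    then have "\<beta> * x \<le> 0" "\<beta> \<le> \<beta> * x" using that mult_left_le[of x "-\<beta>"]
      by (auto simp: mult_nonpos_nonneg)
    then show ?thesis by (auto simp: m_def M_def)
  qed
  have scale: "(1 + d / M) * y \<le> y + d" if "y \<le> M" for y
    using mult_right_mono[of y M "d / M"] that pos by (simp add: algebra_simps)
  show thesis
  proof (rule that[of "1 + d / M" m \<alpha> \<beta> M])
    show "1 < 1 + d / M" using pos by simp
    fix x
    {
      assume "0 \<le> a * x + 1 - a * c" "a * x + 1 - a * c \<le> 1"
      then have "(1 + d / M) * (\<alpha> + \<beta> * (a * x + 1 - a * c)) \<le> \<alpha> + \<beta> * (a * x + 1 - a * c) + d"
        using mM by (intro scale) auto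
      also have "\<dots> \<le> \<alpha> + \<beta> * (a * x + 1 - a * c) - (\<alpha> * (1 - a) + \<beta> * (1 - a * c))"
        by (simp add: d_def)
      finally show "(1 + d / M) * (\<alpha> + \<beta> * (a * x + 1 - a * c)) \<le> a * (\<alpha> + \<beta> * x)"
        by (simp add: algebra_simps)
    next
      assume "0 \<le> b * (x - c)" "b * (x - c) \<le> 1"
      then have "(1 + d / M) * (\<alpha> + \<beta> * (b * (x - c))) \<le> \<alpha> + \<beta> * (b * (x - c)) + d"
        using mM by (intro scale) auto
      also have "\<dots> \<le> \<alpha> + \<beta> * (b * (x - c)) + (\<beta> * b * c - \<alpha> * (1 - b))"
        by (simp add: d_def)
      finally show "(1 + d / M) * (\<alpha> + \<beta> * (b * (x - c))) \<le> b * (\<alpha> + \<beta> * x)"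
        by (simp add: algebra_simps)
    }
  qed (use mM pos in auto)
qed

lemma aff_range:
  assumes "uncut n x y" "0 \<le> x" "x < y" "y \<le> 1" "x \<le> z" "z \<le> y"
  shows "0 \<le> aff n x z" "aff n x z \<le> 1"
proof -
  have "0 \<le> aff n x x" using funpow_fR_range[of x n] assms by simp
  then show "0 \<le> aff n x z" using aff_mono[OF assms(5), of n x] by linarith
  have "aff n x y \<le> 1" using funpow_fL_range[of y n] uncut_right_end[OF assms(1,3)] assms by simp
  then show "aff n x z \<le> 1" using aff_mono[OF assms(6), of n x] by linarith
qed

lemma aff_step:
  assumes "uncut (Suc n) x y" "x < y"
  shows "sl ((fR ^^ n) x) = a \<and> aff (Suc n) x z = a * aff n x z + 1 - a * c \<or>
    sl ((fR ^^ n) x) = b \<and> aff (Suc n) x z = b * (aff n x z - c)"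
proof -
  have "(fL ^^ n) y \<le> c \<or> c \<le> (fR ^^ n) x" and "uncut n x y" using assms by (auto simp: uncut_Suc)
  then have "(fR ^^ n) x < c \<or> c \<le> (fR ^^ n) x" using uncut_less[of n x y] assms by auto
  then show ?thesis
    by (auto simp: aff_def slope_Suc sl_def lorenz_def algebra_simps)
qed

text \<open>The weighted inequality telescopes along the orbit. Replacing the weights at both ends
  by their bounds costs the factor \<open>m / M\<close>. At a fixed point of the iterate the two
  weights are equal and cancel, so no constant is lost there; this is what makes every periodic
  point repelling already at its first return.\<close>

lemma slope_growth:
  "\<exists>K>0. \<exists>\<theta>>1. \<forall>n x y. uncut n x y \<longrightarrow> 0 \<le> x \<longrightarrow> x < y \<longrightarrow> y \<le> 1 \<longrightarrow>
    K * \<theta> ^ n \<le> slope n x \<and> (\<forall>z\<in>{x..y}. aff n x z = z \<longrightarrow> \<theta> ^ n \<le> slope n x)"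
proof -
  obtain \<theta> m \<alpha> \<beta> M where \<theta>: "\<theta> > 1" and m: "0 < m"
    and lo: "\<And>x. 0 \<le> x \<Longrightarrow> x \<le> 1 \<Longrightarrow> m \<le> \<alpha> + \<beta> * x"
    and hi: "\<And>x. 0 \<le> x \<Longrightarrow> x \<le> 1 \<Longrightarrow> \<alpha> + \<beta> * x \<le> M"
    and stepL: "\<And>x. 0 \<le> a * x + 1 - a * c \<Longrightarrow> a * x + 1 - a * c \<le> 1 \<Longrightarrow>
      \<theta> * (\<alpha> + \<beta> * (a * x + 1 - a * c)) \<le> a * (\<alpha> + \<beta> * x)"
    and stepR: "\<And>x. 0 \<le> b * (x - c) \<Longrightarrow> b * (x - c) \<le> 1 \<Longrightarrow>
      \<theta> * (\<alpha> + \<beta> * (b * (x - c))) \<le> b * (\<alpha> + \<beta> * x)"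
    using expansion_weight by blast
  have main: "\<theta> ^ n * (\<alpha> + \<beta> * aff n x z) \<le> slope n x * (\<alpha> + \<beta> * z)"
    if "uncut n x y" "0 \<le> x" "x < y" "y \<le> 1" "x \<le> z" "z \<le> y" for n x y z
    using that(1)
  proof (induction n)
    case 0 then show ?case by (simp add: aff_def)
  next
    case (Suc n)
    then have IH: "\<theta> ^ n * (\<alpha> + \<beta> * aff n x z) \<le> slope n x * (\<alpha> + \<beta> * z)" by (simp add: uncut_Suc)
    have "\<theta> * (\<alpha> + \<beta> * aff (Suc n) x z) \<le> sl ((fR ^^ n) x) * (\<alpha> + \<beta> * aff n x z)"
      using aff_step[OF Suc.prems that(3), of z] aff_range[OF Suc.prems that(2-)] stepL stepR by metis
    then have "\<theta> ^ n * (\<theta> * (\<alpha> + \<beta> * aff (Suc n) x z)) \<le>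
        \<theta> ^ n * (sl ((fR ^^ n) x) * (\<alpha> + \<beta> * aff n x z))"
      using \<theta> by (intro mult_left_mono) auto
    also have "\<dots> = sl ((fR ^^ n) x) * (\<theta> ^ n * (\<alpha> + \<beta> * aff n x z))" by simp
    also have "\<dots> \<le> sl ((fR ^^ n) x) * (slope n x * (\<alpha> + \<beta> * z))"
      by (intro mult_left_mono IH less_imp_le sl_pos)
    finally show ?case by (simp add: slope_Suc mult_ac)
  qed
  have "M > 0" using lo[of 0] hi[of 0] m by simp
  have "m / M * \<theta> ^ n \<le> slope n x \<and> (\<forall>z\<in>{x..y}. aff n x z = z \<longrightarrow> \<theta> ^ n \<le> slope n x)"
    if A: "uncut n x y" "0 \<le> x" "x < y" "y \<le> 1" for n x y
  proof
    have "\<theta> ^ n * m \<le> \<theta> ^ n * (\<alpha> + \<beta> * aff n x x)"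
      using \<theta> lo[OF aff_range[OF A, of x]] A by (intro mult_left_mono) auto
    also have "\<dots> \<le> slope n x * (\<alpha> + \<beta> * x)" using main[OF A, of x] A by simp
    also have "\<dots> \<le> slope n x * M" using hi[of x] A
      by (intro mult_left_mono) (auto simp: less_imp_le)
    finally show "m / M * \<theta> ^ n \<le> slope n x" using \<open>M > 0\<close> by (simp add: field_simps)
    show "\<forall>z\<in>{x..y}. aff n x z = z \<longrightarrow> \<theta> ^ n \<le> slope n x"
    proof (intro ballI impI)
      fix z assume z: "z \<in> {x..y}" "aff n x z = z"
      then have "0 < \<alpha> + \<beta> * z" using lo[of z] m A by auto
      moreover have "\<theta> ^ n * (\<alpha> + \<beta> * z) \<le> slope n x * (\<alpha> + \<beta> * z)"
        using main[OF A, of z] z by simp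
      ultimately show "\<theta> ^ n \<le> slope n x" by simp
    qed
  qed
  then show ?thesis using \<theta> m \<open>M > 0\<close>
    by (intro exI[of _ "m / M"] exI[of _ \<theta>] conjI) auto
qed

lemma slope_at_fixed_point:
  assumes "uncut n x y" "0 \<le> x" "x < y" "y \<le> 1" "x \<le> z" "z \<le> y" "aff n x z = z" "n > 0"
  shows "slope n x > 1"
proof -
  obtain \<theta> where "\<theta> > 1" "\<theta> ^ n \<le> slope n x"
    using slope_growth assms(1-7) by (meson atLeastAtMost_iff)
  then show ?thesis using one_less_power[of \<theta> n] assms(8) by linarith
qed

lemma large_slopes:
  "\<exists>n. \<forall>x y. uncut n x y \<longrightarrow> 0 \<le> x \<longrightarrow> x < y \<longrightarrow> y \<le> 1 \<longrightarrow> C \<le> slope n x"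
proof -
  obtain K \<theta> where K: "K > 0" "\<theta> > 1"
    "\<And>n x y. uncut n x y \<Longrightarrow> 0 \<le> x \<Longrightarrow> x < y \<Longrightarrow> y \<le> 1 \<Longrightarrow> K * \<theta> ^ n \<le> slope n x"
    using slope_growth by meson
  obtain n where "C / K < \<theta> ^ n" using real_arch_pow[OF K(2)] by blast
  then have "C < K * \<theta> ^ n" using K(1) by (simp add: field_simps)
  then show ?thesis using K(3)[of n] by (meson less_imp_le order_trans)
qed

text \<open>The length of an uncut image is the slope times the initial length and never exceeds 1,
  while the slopes become arbitrarily large. So there is a first cut, and \<open>n\<close> is the
  time just before it.\<close>

lemma grows_over_c:
  assumes "0 \<le> x" "x < y" "y \<le> 1"
  obtains n where "uncut n x y" "(fR ^^ n) x < c" "c < (fL ^^ n) y"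
proof -
  have "\<exists>n. \<not> uncut n x y"
  proof (rule ccontr)
    assume "\<nexists>n. \<not> uncut n x y"
    moreover obtain n where n: "\<forall>x' y'. uncut n x' y' \<longrightarrow> 0 \<le> x' \<longrightarrow> x' < y' \<longrightarrow> y' \<le> 1 \<longrightarrow> 2 / (y - x) \<le> slope n x'"
      using large_slopes ..
    ultimately have uncut: "uncut n x y" by simp
    then have "2 / (y - x) \<le> slope n x" using n assms by blast
    then have "2 \<le> slope n x * (y - x)" using assms by (simp add: field_simps)
    then show False
      using uncut_length[OF uncut] funpow_fR_range[of x n] funpow_fL_range[of y n] assms by auto
  qed
  then obtain n where n: "\<not> uncut n x y" "\<And>m. m < n \<Longrightarrow> uncut m x y"
    using exists_least_iff[of "\<lambda>n. \<not> uncut n x y"] by blast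
  then obtain k where k: "n = Suc k" by (cases n) auto
  then have "uncut k x y" "\<not> ((fL ^^ k) y \<le> c \<or> c \<le> (fR ^^ k) x)" using n
    by (auto simp: uncut_Suc)
  then show thesis by (intro that[of k]) auto
qed

section \<open>One-sided limits of the iterates\<close>

lemma tendsto_funpow_right: "filterlim (fR ^^ n) (at_right ((fR ^^ n) x)) (at_right x)"
proof (induction n)
  case (Suc n)
  \<comment> \<open>Convergence along the one-sided filter, and not only to the limit point, is what
    can be composed: both branches increase strictly, so the side of approach is kept.\<close>
  have "filterlim fR (at_right (fR y)) (at_right y)" for y
  proof (cases "y < c")
    case True
    have "eventually (\<lambda>z. fR z = a * z + 1 - a * c) (at_right y)"
      using True by (auto simp: eventually_at_right lorenz_def intro!: exI[of _ c])
    moreover have "filterlim (\<lambda>z. a * z + 1 - a * c) (at_right (a * y + 1 - a * c)) (at_right y)"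
      unfolding filterlim_at
      by (auto intro!: tendsto_eq_intros eventually_at_rightI[of y "y + 1"] simp: a_pos less_imp_neq[OF a_pos, symmetric])
    ultimately show ?thesis using True by (simp add: lorenz_def[of _ _ _ y] filterlim_cong[OF refl refl])
  next
    case False
    have "eventually (\<lambda>z. fR z = b * (z - c)) (at_right y)"
      using False eventually_at_right_less[of y] by (auto simp: lorenz_def elim: eventually_mono)
    moreover have "filterlim (\<lambda>z. b * (z - c)) (at_right (b * (y - c))) (at_right y)"
      unfolding filterlim_at
      by (auto intro!: tendsto_eq_intros eventually_at_rightI[of y "y + 1"] simp: b_pos less_imp_neq[OF b_pos, symmetric])
    ultimately show ?thesis using False by (simp add: lorenz_def[of _ _ _ y] filterlim_cong[OF refl refl])
  qed
  from filterlim_compose[OF this Suc.IH] show ?case by (simp add: o_def)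
qed (simp add: filterlim_ident id_def)

lemma tendsto_funpow_left: "filterlim (fR ^^ n) (at_left ((fL ^^ n) x)) (at_left x)"
proof (induction n)
  case (Suc n)
  have "filterlim fR (at_left (fL y)) (at_left y)" for y
  proof (cases "y \<le> c")
    case True
    have "eventually (\<lambda>z. fR z = a * z + 1 - a * c) (at_left y)"
      using True by (intro eventually_at_leftI[of "y - 1"]) (auto simp: lorenz_def)
    moreover have "filterlim (\<lambda>z. a * z + 1 - a * c) (at_left (a * y + 1 - a * c)) (at_left y)"
      unfolding filterlim_at
      by (auto intro!: tendsto_eq_intros eventually_at_leftI[of "y - 1" y] simp: a_pos less_imp_neq[OF a_pos, symmetric])
    ultimately show ?thesis using True by (simp add: lorenzl_def[of _ _ _ y] filterlim_cong[OF refl refl])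
  next
    case False
    have "eventually (\<lambda>z. fR z = b * (z - c)) (at_left y)"
      using False by (intro eventually_at_leftI[of c]) (auto simp: lorenz_def)
    moreover have "filterlim (\<lambda>z. b * (z - c)) (at_left (b * (y - c))) (at_left y)"
      unfolding filterlim_at
      by (auto intro!: tendsto_eq_intros eventually_at_leftI[of "y - 1" y] simp: b_pos less_imp_neq[OF b_pos, symmetric])
    ultimately show ?thesis using False by (simp add: lorenzl_def[of _ _ _ y] filterlim_cong[OF refl refl])
  qed
  from filterlim_compose[OF this Suc.IH] show ?case by (simp add: o_def)
qed (simp add: filterlim_ident id_def)

lemma iter_right_eq: "iter_right a b c n x = (fR ^^ n) x"
  using tendsto_funpow_right[of n x] unfolding iter_right_def filterlim_at
  by (intro tendsto_Lim) auto

lemma iter_left_eq: "iter_left a b c n x = (fL ^^ n) x"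
  using tendsto_funpow_left[of n x] unfolding iter_left_def filterlim_at
  by (intro tendsto_Lim) auto


section \<open>Periodic points\<close>

lemma has_period_iff:
  "has_period a b c n x \<longleftrightarrow> n > 0 \<and>
    (0 < x \<and> x \<le> 1 \<and> (fL ^^ n) x = x \<or> 0 \<le> x \<and> x < 1 \<and> (fR ^^ n) x = x)"
  by (auto simp: has_period_def iter_left_eq iter_right_eq)

text \<open>Intermediate value theorem for the affine map on the closed interval. If the zero found
  is the right end, it is periodic only for the limit from the left; otherwise it is periodic for
  the limit from the right.\<close>

lemma has_period_crossing:
  assumes "uncut n x y" "0 \<le> x" "x < y" "y \<le> 1" "n > 0" "(fR ^^ n) x \<le> x" "y \<le> (fL ^^ n) y"
  shows "\<exists>z. has_period a b c n z"
proof -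
  have "aff n x x - x \<le> 0" "0 \<le> aff n x y - y" using assms uncut_right_end by auto
  moreover have "continuous_on {x..y} (\<lambda>z. aff n x z - z)"
    by (auto simp: aff_def intro!: continuous_intros)
  ultimately obtain z where z: "x \<le> z" "z \<le> y" "aff n x z - z = 0"
    using IVT'[of "\<lambda>z. aff n x z - z" x 0 y] assms(3) by auto
  then have "has_period a b c n z"
    using uncut_aff[OF assms(1,3) z(1,2)] assms unfolding has_period_iff by (cases "z < y") auto
  then show ?thesis ..
qed

lemma left_branch_above_diagonal:
  assumes "a * c < 1" "0 \<le> x" "x \<le> c" shows "x < a * x + 1 - a * c"
proof -
  \<comment> \<open>\<open>f(x) - x\<close> is affine on the branch, so it interpolates between its
    end values \<open>1 - a * c\<close> at 0 and \<open>1 - c\<close> at \<open>c-\<close>; the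
    identity is this interpolation, multiplied by \<open>c\<close>.\<close>
  have "(1 - a * c) * (c - x) + (1 - c) * x = c * (a * x + 1 - a * c - x)"
    by (simp add: algebra_simps)
  moreover have "0 < (1 - a * c) * (c - x) + (1 - c) * x"
    using assms c_less c_pos by (cases "x = c") (auto intro: add_pos_nonneg)
  ultimately show ?thesis using c_pos by (simp add: zero_less_mult_iff)
qed

lemma right_branch_below_diagonal:
  assumes "b * (1 - c) < 1" "c \<le> x" "x \<le> 1" shows "b * (x - c) < x"
proof -
  have "(1 - b * (1 - c)) * (x - c) + c * (1 - x) = (1 - c) * (x - b * (x - c))"
    by (simp add: algebra_simps)
  moreover have "0 < (1 - b * (1 - c)) * (x - c) + c * (1 - x)"
    using assms c_pos c_less by (cases "x = 1") (auto intro: add_nonneg_pos)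
  ultimately show ?thesis using c_less by (simp add: zero_less_mult_iff)
qed

lemma has_period_1_cases:
  assumes "has_period a b c 1 x"
  shows "a * c = 1 \<or> b * (1 - c) = 1"
proof (rule ccontr)
  assume "\<not> ?thesis"
  then have "a * c < 1" "b * (1 - c) < 1" using ac_le bc_le by auto
  then show False
    using assms left_branch_above_diagonal[of x] right_branch_below_diagonal[of x]
    unfolding has_period_iff lorenz_def lorenzl_def by (auto split: if_splits)
qed

lemma no_fixed_point_branches:
  assumes "\<not> (\<exists>x. has_period a b c 1 x)"
  shows "\<And>x. 0 \<le> x \<Longrightarrow> x \<le> c \<Longrightarrow> x < a * x + 1 - a * c"
    "\<And>x. c \<le> x \<Longrightarrow> x \<le> 1 \<Longrightarrow> b * (x - c) < x"
proof -
  have "a * c \<noteq> 1"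
  proof
    assume "a * c = 1"
    then have "has_period a b c 1 0" using c_pos by (simp add: has_period_iff lorenz_def)
    then show False using assms by blast
  qed
  then show "x < a * x + 1 - a * c" if "0 \<le> x" "x \<le> c" for x
    using left_branch_above_diagonal that ac_le by simp
  have "b * (1 - c) \<noteq> 1"
  proof
    assume "b * (1 - c) = 1"
    then have "has_period a b c 1 1" using c_less by (simp add: has_period_iff lorenzl_def)
    then show False using assms by blast
  qed
  then show "b * (x - c) < x" if "c \<le> x" "x \<le> 1" for x
    using right_branch_below_diagonal that bc_le by simp
qed

text \<open>The intervals \<open>[p i, t i]\<close> are boxes, each mapped over the next one.
  \<open>[l, r]\<close> is a part of the first box that follows the boxes and is carried affinely
  onto the last one. The final line says that an end is kept exactly when it is itself an orbit
  through the corresponding ends of the boxes; this fixes one side of \<open>[l, r]\<close> when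
  that side is periodic.\<close>

definition pulls_back :: "nat \<Rightarrow> (nat \<Rightarrow> real) \<Rightarrow> (nat \<Rightarrow> real) \<Rightarrow> real \<Rightarrow> real \<Rightarrow> bool" where
  "pulls_back n p t l r \<longleftrightarrow> p 0 \<le> l \<and> l \<le> r \<and> r \<le> t 0 \<and> (fR ^^ n) l = p n \<and> (fR ^^ n) r = t n \<and>
    (\<forall>z\<in>{l..r}. (\<forall>i<n. (fR ^^ i) z \<in> {p i..t i}) \<and>
      (fR ^^ n) z = p n + slope n l * (z - l) \<and> slope n z = slope n l) \<and>
    ((\<forall>i<n. fR (t i) = t (Suc i)) \<longrightarrow> r = t 0) \<and> ((\<forall>i<n. fR (p i) = p (Suc i)) \<longrightarrow> l = p 0)"

lemma ex_pulls_back: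
  assumes "\<And>i. i < n \<Longrightarrow> p i \<le> t i \<and> (t i < c \<or> c < p i) \<and> fR (p i) \<le> p (Suc i) \<and> t (Suc i) \<le> fR (t i)"
    and "p n \<le> t n"
  shows "\<exists>l r. pulls_back n p t l r"
  using assms
proof (induction n arbitrary: p t)
  case 0
  then show ?case by (intro exI[of _ "p 0"] exI[of _ "t 0"]) (auto simp: pulls_back_def)
next
  case (Suc n)
  have "\<exists>l r. pulls_back n (\<lambda>i. p (Suc i)) (\<lambda>i. t (Suc i)) l r"
    using Suc.prems by (intro Suc.IH) auto
  then obtain l r where IH: "pulls_back n (\<lambda>i. p (Suc i)) (\<lambda>i. t (Suc i)) l r" by blast
  have lr: "p 1 \<le> l" "l \<le> r" "r \<le> t 1" "(fR ^^ n) l = p (Suc n)" "(fR ^^ n) r = t (Suc n)"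
    using IH by (auto simp: pulls_back_def)
  have z: "\<forall>i<n. (fR ^^ i) z \<in> {p (Suc i)..t (Suc i)}"
      "(fR ^^ n) z = p (Suc n) + slope n l * (z - l)" "slope n z = slope n l" if "z \<in> {l..r}" for z
    using IH that unfolding pulls_back_def by blast+
  have exact: "(\<forall>i<n. fR (t (Suc i)) = t (Suc (Suc i))) \<longrightarrow> r = t (Suc 0)"
    "(\<forall>i<n. fR (p (Suc i)) = p (Suc (Suc i))) \<longrightarrow> l = p (Suc 0)"
    using IH unfolding pulls_back_def by blast+
  have 0: "p 0 \<le> t 0" "t 0 < c \<or> c < p 0" "fR (p 0) \<le> p 1" "t 1 \<le> fR (t 0)"
    using Suc.prems(1)[of 0] by auto
  define s where "s = sl (p 0)"
  have s: "s > 0" by (simp add: s_def)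
  have sl: "sl z = s" and f: "fR z = fR (p 0) + s * (z - p 0)" if "p 0 \<le> z" "z \<le> t 0" for z
    using that 0(1,2) by (auto simp: s_def sl_def lorenz_def algebra_simps)
  \<comment> \<open>\<open>g\<close> is the inverse of the branch on the first box; it carries the
    interval found for the remaining boxes back by one step.\<close>
  define g where "g w = p 0 + (w - fR (p 0)) / s" for w
  have g: "p 0 \<le> g w \<and> g w \<le> t 0 \<and> fR (g w) = w" if "l \<le> w" "w \<le> r" for w
  proof -
    have "fR (p 0) \<le> w" "w \<le> fR (t 0)" using that lr 0 by auto
    then have "p 0 \<le> g w" "g w \<le> t 0"
      using s f[of "t 0"] 0 by (auto simp: g_def field_simps)
    then show ?thesis using f[of "g w"] s by (auto simp: g_def)
  qed
  have gf: "g (fR z) = z" if "p 0 \<le> z" "z \<le> t 0" for z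
    using f[OF that] s by (simp add: g_def)
  have gl: "p 0 \<le> g l" "g l \<le> t 0" "fR (g l) = l" and gr: "p 0 \<le> g r" "g r \<le> t 0" "fR (g r) = r"
    using g lr(2) by auto
  have "g l \<le> g r" using lr(2) s by (simp add: g_def divide_right_mono)
  have "(\<forall>i<Suc n. (fR ^^ i) z \<in> {p i..t i}) \<and>
      (fR ^^ Suc n) z = p (Suc n) + slope (Suc n) (g l) * (z - g l) \<and> slope (Suc n) z = slope (Suc n) (g l)"
    if zz: "z \<in> {g l..g r}" for z
  proof (intro conjI allI impI)
    have zb: "p 0 \<le> z" "z \<le> t 0" using zz gl gr by auto
    have fz_eq: "fR z - l = s * (z - g l)" using f[OF zb] f[OF gl(1,2)] gl(3) by (simp add: algebra_simps)
    moreover have "r - fR z = s * (g r - z)" using f[OF zb] f[OF gr(1,2)] gr(3) by (simp add: algebra_simps)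
    moreover have "0 \<le> s * (z - g l)" "0 \<le> s * (g r - z)" using zz s by auto
    ultimately have fz: "fR z \<in> {l..r}" by simp
    show "slope (Suc n) z = slope (Suc n) (g l)"
      using z[OF fz] sl[OF zb] sl[OF gl(1,2)] gl(3) by (simp add: slope_Suc_shift)
    show "(fR ^^ Suc n) z = p (Suc n) + slope (Suc n) (g l) * (z - g l)"
      unfolding funpow_Suc_right o_apply z(2)[OF fz] fz_eq slope_Suc_shift sl[OF gl(1,2)] gl(3) by simp
    show "(fR ^^ i) z \<in> {p i..t i}" if "i < Suc n" for i
    proof (cases i)
      case 0 then show ?thesis using zb by simp
    next
      case (Suc j)
      then show ?thesis using z(1)[OF fz] that unfolding Suc funpow_Suc_right o_apply by simp
    qed
  qed
  moreover have "(fR ^^ Suc n) (g l) = p (Suc n)" "(fR ^^ Suc n) (g r) = t (Suc n)"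
    unfolding funpow_Suc_right o_apply gl(3) gr(3) by (fact lr)+
  moreover have "g r = t 0" if "\<forall>i<Suc n. fR (t i) = t (Suc i)"
  proof -
    have "r = fR (t 0)" using that exact(1) by simp
    then show ?thesis using gf[of "t 0"] 0(1) by simp
  qed
  moreover have "g l = p 0" if "\<forall>i<Suc n. fR (p i) = p (Suc i)"
  proof -
    have "l = fR (p 0)" using that exact(2) by simp
    then show ?thesis using gf[of "p 0"] 0(1) by simp
  qed
  ultimately have "pulls_back (Suc n) p t (g l) (g r)"
    using gl(1) gr(2) \<open>g l \<le> g r\<close> unfolding pulls_back_def by blast
  then show ?case by blast
qed

lemma funpow_periodic:
  fixes f :: "real \<Rightarrow> real"
  assumes "(f ^^ n) x = x" shows "(f ^^ n) ((f ^^ i) x) = (f ^^ i) x"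
  using assms by (metis comp_apply funpow_add add.commute)

lemma funpow_le_eq:
  fixes f :: "real \<Rightarrow> real"
  assumes "m \<le> n" shows "(f ^^ n) x = (f ^^ (n - m)) ((f ^^ m) x)"
  using assms by (metis comp_apply funpow_add le_add_diff_inverse2)

lemma slope_periodic:
  assumes "(fR ^^ n) x = x" shows "slope n ((fR ^^ i) x) = slope n x"
proof (induction i)
  case (Suc i)
  have "sl ((fR ^^ i) x) * slope n ((fR ^^ Suc i) x) = slope (Suc n) ((fR ^^ i) x)"
    by (simp add: slope_Suc_shift)
  also have "\<dots> = slope n ((fR ^^ i) x) * sl ((fR ^^ i) x)"
    by (simp add: slope_Suc funpow_periodic[OF assms])
  finally show ?case using Suc sl_pos[of "(fR ^^ i) x"] by (simp del: sl_pos)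
qed simp


section \<open>Gaps bounded by periodic points\<close>

definition accumulates_left :: "real set \<Rightarrow> real \<Rightarrow> bool" where
  "accumulates_left H y \<longleftrightarrow> (\<forall>\<delta>>0. \<exists>x\<in>H. y - \<delta> < x \<and> x \<le> y)"

lemma accumulates_left_outside:
  assumes "accumulates_left H y" "H \<inter> {u<..<v} = {}"
  shows "\<not> (u < y \<and> y < v)"
proof
  assume y: "u < y \<and> y < v"
  then obtain x where "x \<in> H" "y - (y - u) < x" "x \<le> y"
    using assms(1) unfolding accumulates_left_def by (metis diff_gt_0_iff_gt)
  then show False using y assms(2) by auto
qed

lemma accumulates_left_step:
  assumes "accumulates_left H y" "y \<noteq> c" "\<And>x. x \<in> H \<Longrightarrow> fR x \<in> H"
  shows "accumulates_left H (fR y)"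
  unfolding accumulates_left_def
proof (intro allI impI)
  fix \<delta> :: real assume "\<delta> > 0"
  \<comment> \<open>Right of \<open>c\<close> the approximating point must not fall back beyond
    \<open>c\<close>, hence the minimum; left of \<open>c\<close> this cannot happen.\<close>
  define \<epsilon> where "\<epsilon> = (if c < y then min (\<delta> / b) (y - c) else \<delta> / a)"
  have "\<epsilon> > 0" using \<open>\<delta> > 0\<close> a_pos b_pos by (auto simp: \<epsilon>_def)
  then obtain x where x: "x \<in> H" "y - \<epsilon> < x" "x \<le> y"
    using assms(1) unfolding accumulates_left_def by blast
  have "fR y - \<delta> < fR x \<and> fR x \<le> fR y"
  proof (cases "c < y")
    case True
    then have "c < x" "y - x < \<delta> / b" using x by (auto simp: \<epsilon>_def)
    then show ?thesis using True x b_pos by (auto simp: lorenz_def field_simps)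
  next
    case False
    then have "x < c" "y < c" "y - x < \<delta> / a" using x assms(2) by (auto simp: \<epsilon>_def)
    then show ?thesis using x a_pos by (auto simp: lorenz_def field_simps)
  qed
  then show "\<exists>x\<in>H. fR y - \<delta> < x \<and> x \<le> fR y" using assms(3) x(1) by blast
qed

text \<open>\<open>(u, c)\<close> avoids \<open>H\<close>, and \<open>H\<close> is closed under
  preimages, so the images of \<open>(u, c)\<close> before a cut avoid \<open>H\<close> too. When
  such an image contains \<open>c\<close> it cannot extend beyond \<open>u\<close> or
  \<open>v\<close>, where points of \<open>H\<close> accumulate; so its left end is at least
  \<open>u\<close>. The orbit of \<open>u\<close> is accumulated by \<open>H\<close> and hence never
  enters the gap, so this left end is \<open>u\<close> itself.\<close>

lemma hits_gap_end_left:
  assumes H: "\<And>x. x \<in> H \<Longrightarrow> fR x \<in> H"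
    and H': "\<And>x. 0 \<le> x \<Longrightarrow> x \<le> 1 \<Longrightarrow> x \<noteq> c \<Longrightarrow> fR x \<in> H \<Longrightarrow> x \<in> H"
    and gap: "H \<inter> {u<..<v} = {}" and uv: "0 \<le> u" "u < c" "c < v" "v \<le> 1"
    and u: "accumulates_left H u" and v: "\<And>\<delta>. \<delta> > 0 \<Longrightarrow> \<exists>x\<in>H. v \<le> x \<and> x < v + \<delta>"
  shows "\<exists>n>0. uncut n u c \<and> (fR ^^ n) u = u \<and> c < (fL ^^ n) c \<and> (fL ^^ n) c \<le> v"
    and "\<And>i. accumulates_left H ((fR ^^ i) u) \<and> \<not> (u < (fR ^^ i) u \<and> (fR ^^ i) u < v)"
proof -
  show acc: "accumulates_left H ((fR ^^ i) u) \<and> \<not> (u < (fR ^^ i) u \<and> (fR ^^ i) u < v)" for i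
  proof (induction i)
    case 0 then show ?case using u by simp
  next
    case (Suc i)
    then have "(fR ^^ i) u \<noteq> c" using uv by auto
    then have "accumulates_left H ((fR ^^ Suc i) u)"
      using Suc accumulates_left_step H by auto
    then show ?case using accumulates_left_outside[OF _ gap] by blast
  qed
  obtain n where n: "uncut n u c" "(fR ^^ n) u < c" "c < (fL ^^ n) c"
    using grows_over_c[of u c] uv c_less by auto
  have "n > 0" using n by (cases n) auto
  have noH: "w \<notin> H" if w: "(fR ^^ n) u < w" "w < (fL ^^ n) c" for w
  proof
    assume "w \<in> H"
    obtain z where z: "u < z" "z < c" "(fR ^^ n) z = w" using uncut_image_point[OF n(1) uv(2) w] .
    then have "(fR ^^ n) z \<in> H" using \<open>w \<in> H\<close> by simp
    moreover have "(fR ^^ i) z \<noteq> c" if "i < n" for i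
      using uncut_interior_ne[OF n(1) z(1,2) that] .
    \<comment> \<open>Closure under preimages is applied backwards along the orbit of
      \<open>z\<close>, which avoids \<open>c\<close> because \<open>(u, c)\<close> is uncut for
      \<open>n\<close> steps.\<close>
    ultimately have "(fR ^^ (n - i)) z \<in> H" if "i \<le> n" for i
      using that
    proof (induction i)
      case (Suc i)
      then have "(fR ^^ Suc (n - Suc i)) z \<in> H" by (simp add: Suc_diff_Suc del: funpow.simps)
      moreover have "0 \<le> (fR ^^ (n - Suc i)) z" "(fR ^^ (n - Suc i)) z < 1"
        using funpow_fR_range[of z] z uv c_less by auto
      moreover have "(fR ^^ (n - Suc i)) z \<noteq> c" using Suc.prems by auto
      ultimately show ?case using H'[of "(fR ^^ (n - Suc i)) z"] by simp
    qed simp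
    from this[of n] have "z \<in> H" by simp
    then show False using gap z uv by auto
  qed
  have "(fL ^^ n) c \<le> v"
  proof (rule ccontr)
    assume "\<not> (fL ^^ n) c \<le> v"
    then obtain x where "x \<in> H" "v \<le> x" "x < v + ((fL ^^ n) c - v)" using v[of "(fL ^^ n) c - v"]
      by auto
    then show False using noH[of x] n(2) uv(3) by simp
  qed
  moreover have "u \<le> (fR ^^ n) u"
  proof (rule ccontr)
    assume "\<not> u \<le> (fR ^^ n) u"
    then have "0 < u - (fR ^^ n) u" by simp
    then obtain x where "x \<in> H" "u - (u - (fR ^^ n) u) < x" "x \<le> u"
      using u unfolding accumulates_left_def by blast
    then show False using noH[of x] n(3) uv(2) by simp
  qed
  moreover have "(fR ^^ n) u \<le> u" using acc[of n] n uv by auto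
  ultimately show "\<exists>n>0. uncut n u c \<and> (fR ^^ n) u = u \<and> c < (fL ^^ n) c \<and> (fL ^^ n) c \<le> v"
    using n \<open>n > 0\<close> by (intro exI[of _ n]) simp
qed

lemma uncut_reflect: "lorenz_map.uncut b a (1 - c) n (1 - y) (1 - x) = uncut n x y"
proof -
  interpret m: lorenz_map b a "1 - c" by (rule reflected)
  show ?thesis unfolding uncut_def m.uncut_def lorenz_funpow_reflect lorenzl_funpow_reflect by auto
qed

text \<open>The mirror image. Reflecting turns \<open>fR\<close> into \<open>fL\<close>; the
  assumption that \<open>H\<close> avoids \<open>c\<close> makes the two agree on
  \<open>H\<close>.\<close>

lemma hits_gap_end_right:
  assumes H: "\<And>x. x \<in> H \<Longrightarrow> x \<noteq> c \<and> fR x \<in> H"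
    and H': "\<And>x. 0 \<le> x \<Longrightarrow> x \<le> 1 \<Longrightarrow> x \<noteq> c \<Longrightarrow> fR x \<in> H \<Longrightarrow> x \<in> H"
    and gap: "H \<inter> {u<..<v} = {}" and uv: "0 \<le> u" "u < c" "c < v" "v \<le> 1"
    and u: "\<And>\<delta>. \<delta> > 0 \<Longrightarrow> \<exists>x\<in>H. u - \<delta> < x \<and> x \<le> u" and v: "\<And>\<delta>. \<delta> > 0 \<Longrightarrow> \<exists>x\<in>H. v \<le> x \<and> x < v + \<delta>"
  shows "\<exists>n>0. uncut n c v \<and> (fL ^^ n) v = v \<and> (fR ^^ n) c < c \<and> u \<le> (fR ^^ n) c"
    and "\<And>i. \<not> (u < (fL ^^ i) v \<and> (fL ^^ i) v < v)"
proof -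
  interpret m: lorenz_map b a "1 - c" by (rule reflected)
  let ?H = "(\<lambda>x. 1 - x) ` H"
  have a1: "m.fR x \<in> ?H" if "x \<in> ?H" for x
    using that H fL_eq_fR by (force simp: lorenz_reflect)
  have a2: "x \<in> ?H" if x: "0 \<le> x" "x \<le> 1" "x \<noteq> 1 - c" "m.fR x \<in> ?H" for x
  proof -
    have "m.fR x = 1 - fL (1 - x)" using lorenz_reflect[of b a c "1 - x"] by simp
    then have "fR (1 - x) \<in> H" using x fL_eq_fR[of "1 - x"] by force
    then have "1 - x \<in> H" using H'[of "1 - x"] x by auto
    then show ?thesis by force
  qed
  have a3: "?H \<inter> {1 - v<..<1 - u} = {}"
    using gap by (auto simp: disjoint_iff)
  have a4: "m.accumulates_left ?H (1 - v)"
    unfolding m.accumulates_left_def using v by force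
  have a5: "\<exists>x\<in>?H. 1 - u \<le> x \<and> x < 1 - u + \<delta>" if "\<delta> > 0" for \<delta>
    using u[OF that] by force
  have uv': "0 \<le> 1 - v" "1 - v < 1 - c" "1 - c < 1 - u" "1 - u \<le> 1" using uv by auto
  obtain n where n: "n > 0" "m.uncut n (1 - v) (1 - c)" "(m.fR ^^ n) (1 - v) = 1 - v"
    "1 - c < (m.fL ^^ n) (1 - c)" "(m.fL ^^ n) (1 - c) \<le> 1 - u"
    using m.hits_gap_end_left(1)[OF a1 a2 a3 uv' a4 a5] by blast
  show "\<exists>n>0. uncut n c v \<and> (fL ^^ n) v = v \<and> (fR ^^ n) c < c \<and> u \<le> (fR ^^ n) c"
    using n by (intro exI[of _ n]) (auto simp: uncut_reflect lorenz_funpow_reflect lorenzl_funpow_reflect)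
  show "\<not> (u < (fL ^^ i) v \<and> (fL ^^ i) v < v)" for i
    using m.hits_gap_end_left(2)[OF a1 a2 a3 uv' a4 a5, of i]
    by (auto simp: lorenz_funpow_reflect)
qed

text \<open>Suppose the two orbits are disjoint. Between an adjacent pair \<open>\<sigma> < \<tau>\<close>, with \<open>\<sigma>\<close> in the orbit
  of \<open>v\<close> and \<open>\<tau>\<close> in the orbit of \<open>u\<close>, there are intervals ending at \<open>\<tau>\<close> and starting at \<open>\<sigma>\<close> which the
  two return maps stretch over all of \<open>[\<sigma>, \<tau>]\<close>. As the same return maps send \<open>(u, c)\<close> and
  \<open>(c, v)\<close> into \<open>(u, v)\<close>, the reciprocals of their slopes add up to at least 1, so the two
  intervals meet.\<close>

lemma same_orbit:
  assumes n: "n > 0" "uncut n u c" "(fR ^^ n) u = u" "(fL ^^ n) c \<le> v"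
    and m: "m > 0" "uncut m c v" "(fR ^^ m) v = v" "u \<le> (fR ^^ m) c"
    and uv: "0 \<le> u" "u < c" "c < v" "v \<le> 1"
    and gap: "\<And>i. \<not> (u < (fR ^^ i) u \<and> (fR ^^ i) u < v)" "\<And>i. \<not> (u < (fR ^^ i) v \<and> (fR ^^ i) v < v)"
    and no_fixed: "\<not> (\<exists>x. has_period a b c 1 x)"
  shows "\<exists>i j. (fR ^^ i) u = (fR ^^ j) v"
proof (rule ccontr)
  assume disj: "\<nexists>i j. (fR ^^ i) u = (fR ^^ j) v"
  define T where "T = (\<lambda>i. (fR ^^ i) u) ` {..<n}"
  define S where "S = (\<lambda>i. (fR ^^ i) v) ` {..<m}"
  define W where "W = T \<union> S"
  have in_orbit: "(f ^^ i) x \<in> (\<lambda>i. (f ^^ i) x) ` {..<k}" if "(f ^^ k) x = x" "k > 0"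
    for f :: "real \<Rightarrow> real" and k i x
    using funpow_mod_eq[OF that(1), of i] that(2) by (intro image_eqI[of _ _ "i mod k"]) auto
  have T: "(fR ^^ i) u \<in> T" for i unfolding T_def by (rule in_orbit) (use n in auto)
  have S: "(fR ^^ i) v \<in> S" for i unfolding S_def by (rule in_orbit) (use m in auto)
  have TS: "T \<inter> S = {}" using disj by (force simp: T_def S_def)
  have fin: "finite T" "finite S" "finite W" by (auto simp: T_def S_def W_def)
  have uT: "u \<in> T" and vS: "v \<in> S" using T[of 0] S[of 0] by auto
  have TI: "fR z \<in> T" "(fR ^^ n) z = z" "slope n z = slope n u" if zz: "z \<in> T" for z
  proof -
    obtain i where i: "z = (fR ^^ i) u" using zz unfolding T_def by blast
    show "fR z \<in> T" using T[of "Suc i"] i by simp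
    show "(fR ^^ n) z = z" "slope n z = slope n u"
      unfolding i by (rule funpow_periodic slope_periodic, fact n(3))+
  qed
  have SI: "fR z \<in> S" "(fR ^^ m) z = z" "slope m z = slope m v" if zz: "z \<in> S" for z
  proof -
    obtain i where i: "z = (fR ^^ i) v" using zz unfolding S_def by blast
    show "fR z \<in> S" using S[of "Suc i"] i by simp
    show "(fR ^^ m) z = z" "slope m z = slope m v"
      unfolding i by (rule funpow_periodic slope_periodic, fact m(3))+
  qed
  have TF: "(fR ^^ i) z \<in> T" if "z \<in> T" for z i by (induction i) (auto simp: that TI)
  have SF: "(fR ^^ i) z \<in> S" if "z \<in> S" for z i by (induction i) (auto simp: that SI)
  have WF: "(fR ^^ i) z \<in> W" if "z \<in> W" for z i using that TF SF by (auto simp: W_def)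
  have Wgap: "z \<le> u \<or> v \<le> z" if zz: "z \<in> W" for z
  proof -
    obtain i where "z = (fR ^^ i) u \<or> z = (fR ^^ i) v"
      using zz unfolding W_def T_def S_def by blast
    then show ?thesis using gap[of i] by auto
  qed
  have Wc: "z \<noteq> c" if "z \<in> W" for z using Wgap[OF that] uv by auto
  have W01: "0 \<le> z \<and> z \<le> 1" if zz: "z \<in> W" for z
  proof -
    obtain i where "z = (fR ^^ i) u \<or> z = (fR ^^ i) v"
      using zz unfolding W_def T_def S_def by blast
    then show ?thesis using funpow_fR_range_closed[of u i] funpow_fR_range_closed[of v i] uv by auto
  qed
  have pre_image: "\<exists>z'\<in>W. fR z' = z" if "z \<in> W" for z
  proof -
    have "(fR ^^ Suc (n * m - 1)) z = z"
    proof -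
      have "Suc (n * m - 1) = n * m" using n(1) m(1) by simp
      moreover have "(fR ^^ (n * k)) z = z" if "z \<in> T" for k
        using that TI(2) by (induction k) (auto simp: funpow_add)
      moreover have "(fR ^^ (m * k)) z = z" if "z \<in> S" for k
        using that SI(2) by (induction k) (auto simp: funpow_add)
      ultimately show ?thesis using that by (metis UnE W_def mult.commute)
    qed
    then show ?thesis using WF[OF that] by auto
  qed
  note nofix = no_fixed_point_branches[OF no_fixed]
  \<comment> \<open>Every point of \<open>W\<close> is the image of a point of \<open>W\<close>. The
    minimum cannot come from the left branch, which moves points up, so it is the image of the first
    point to the right of the gap, \<open>v\<close>; likewise the maximum is the image of
    \<open>u\<close>. As the orbits are disjoint, every point of \<open>T\<close> has a left
    neighbour in \<open>W\<close> and every point of \<open>S\<close> a right one.\<close>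
  have min_v: "fR v \<le> z" if "z \<in> W" for z
  proof -
    have "W \<noteq> {}" using uT by (auto simp: W_def)
    then obtain z' where z': "z' \<in> W" "fR z' = Min W" using pre_image Min_in fin by metis
    have "\<not> z' < c"
    proof
      assume "z' < c"
      then have "z' < fR z'" using nofix(1)[of z'] W01[OF z'(1)] by (simp add: lorenz_def)
      then show False using z' fin by (simp add: leD)
    qed
    then have "v \<le> z'" using Wgap[OF z'(1)] uv by auto
    then have "fR v \<le> fR z'" using uv b_pos by (simp add: lorenz_def)
    then show ?thesis using z'(2) Min_le[OF fin(3) that] by simp
  qed
  have max_u: "z \<le> fR u" if "z \<in> W" for z
  proof -
    have "W \<noteq> {}" using uT by (auto simp: W_def)
    then obtain z' where z': "z' \<in> W" "fR z' = Max W" using pre_image Max_in fin by metis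
    have "\<not> z' > c"
    proof
      assume "z' > c"
      then have "fR z' < z'" using nofix(2)[of z'] W01[OF z'(1)] by (simp add: lorenz_def)
      then show False using z' fin by (simp add: leD)
    qed
    then have "z' \<le> u" "z' < c" using Wgap[OF z'(1)] Wc[OF z'(1)] uv by auto
    then have "fR z' \<le> fR u" using uv a_pos by (simp add: lorenz_def)
    then show ?thesis using z'(2) Max_ge[OF fin(3) that] by simp
  qed
  define pre where "pre t = Max {z \<in> W. z < t}" for t
  define nxt where "nxt s = Min {z \<in> W. s < z}" for s
  have pre: "pre t \<in> W" "pre t < t" "\<And>z. z \<in> W \<Longrightarrow> z < t \<Longrightarrow> z \<le> pre t" if "t \<in> T" for t
  proof -
    have "fR v \<in> W" "fR v \<noteq> t" "fR v \<le> t" using that S[of 1] TS min_v[of t]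
      by (auto simp: W_def)
    then have "{z \<in> W. z < t} \<noteq> {}" by force
    from Max_in[OF _ this] show "pre t \<in> W" "pre t < t" using fin by (auto simp: pre_def)
    show "z \<le> pre t" if "z \<in> W" "z < t" for z using that fin by (auto simp: pre_def)
  qed
  have nxt: "nxt s \<in> W" "s < nxt s" "\<And>z. z \<in> W \<Longrightarrow> s < z \<Longrightarrow> nxt s \<le> z" if "s \<in> S" for s
  proof -
    have "fR u \<in> W" "fR u \<noteq> s" "s \<le> fR u" using that T[of 1] TS max_u[of s]
      by (auto simp: W_def)
    then have "{z \<in> W. s < z} \<noteq> {}" by force
    from Min_in[OF _ this] show "nxt s \<in> W" "s < nxt s" using fin by (auto simp: nxt_def)
    show "nxt s \<le> z" if "z \<in> W" "s < z" for z using that fin by (auto simp: nxt_def)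
  qed
  \<comment> \<open>The only neighbours in \<open>W\<close> on different sides of \<open>c\<close>
    are \<open>u\<close> and \<open>v\<close>, and there the right one belongs to \<open>S\<close>,
    not to \<open>T\<close>.\<close>
  have pre_c: "t < c \<or> c < pre t" if "t \<in> T" for t
  proof (rule ccontr)
    assume "\<not> (t < c \<or> c < pre t)"
    then have "c < t" "pre t < c" using Wc[of t] Wc[OF pre(1)[OF that]] that by (auto simp: W_def)
    then have "v \<le> t" using Wgap[of t] that uv by (auto simp: W_def)
    moreover have "\<not> v < t" using pre(3)[OF that, of v] \<open>pre t < c\<close> vS uv
      by (auto simp: W_def)
    ultimately have "t = v" by simp
    then show False using that vS TS by auto
  qed
  have nxt_c: "nxt s < c \<or> c < s" if "s \<in> S" for s
  proof (rule ccontr)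
    assume "\<not> (nxt s < c \<or> c < s)"
    then have "c < nxt s" "s < c" using Wc[of s] Wc[OF nxt(1)[OF that]] that by (auto simp: W_def)
    then have "s \<le> u" using Wgap[of s] that uv by (auto simp: W_def)
    moreover have "\<not> s < u" using nxt(3)[OF that, of u] \<open>c < nxt s\<close> uT uv
      by (auto simp: W_def)
    ultimately have "s = u" by simp
    then show False using that uT TS by auto
  qed
  have fR_mono: "fR x < fR y" if "x < y" "y < c \<or> c < x" for x y
    using that a_pos b_pos by (auto simp: lorenz_def)
  \<comment> \<open>The left neighbour of the lowest point of \<open>T\<close> is not in
    \<open>T\<close>, so it is in \<open>S\<close>: this is an adjacent pair of the required
    kind.\<close>
  define \<tau> where "\<tau> = Min T"
  define \<sigma> where "\<sigma> = pre \<tau>"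
  have \<tau>T: "\<tau> \<in> T" using Min_in[OF fin(1)] uT by (auto simp: \<tau>_def)
  have \<sigma>S: "\<sigma> \<in> S"
  proof -
    have "\<sigma> \<in> W" "\<sigma> < \<tau>" using pre(1,2)[OF \<tau>T] by (auto simp: \<sigma>_def)
    then show ?thesis using Min_le[OF fin(1), of \<sigma>] by (auto simp: W_def \<tau>_def)
  qed
  have \<sigma>\<tau>: "\<sigma> < \<tau>" using pre(2)[OF \<tau>T] by (simp add: \<sigma>_def)
  have adj: "z \<le> \<sigma> \<or> \<tau> \<le> z" if "z \<in> W" for z using pre(3)[OF \<tau>T that]
    by (auto simp: \<sigma>_def)
  have nxt\<sigma>: "nxt \<sigma> = \<tau>"
  proof (rule antisym)
    show "nxt \<sigma> \<le> \<tau>" using nxt(3)[OF \<sigma>S, of \<tau>] \<sigma>\<tau> \<tau>T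
      by (simp add: W_def)
    show "\<tau> \<le> nxt \<sigma>" using nxt(1,2)[OF \<sigma>S] adj[of "nxt \<sigma>"] by auto
  qed
  define t where "t i = (fR ^^ i) \<tau>" for i
  define s where "s i = (fR ^^ i) \<sigma>" for i
  have tT: "t i \<in> T" and sS: "s i \<in> S" for i
    using TF[OF \<tau>T] SF[OF \<sigma>S] by (auto simp: t_def s_def)
  have t0: "t 0 = \<tau>" "t n = \<tau>" "s 0 = \<sigma>" "s m = \<sigma>"
    using TI(2)[OF \<tau>T] SI(2)[OF \<sigma>S] by (auto simp: t_def s_def)
  have tSuc: "fR (t i) = t (Suc i)" and sSuc: "fR (s i) = s (Suc i)" for i by (auto simp: t_def s_def)
  \<comment> \<open>The boxes run from the left neighbour of \<open>t i\<close> to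
    \<open>t i\<close>. The image of a left neighbour is again in \<open>W\<close> and below
    \<open>t (Suc i)\<close>, so it is at most the left neighbour of \<open>t (Suc i)\<close>: each
    box is mapped over the next. After \<open>n\<close> steps the chain is back at
    \<open>[\<sigma>, \<tau>]\<close>.\<close>
  have "\<exists>l r. pulls_back n (\<lambda>i. pre (t i)) t l r"
  proof (rule ex_pulls_back)
    fix i
    have "fR (pre (t i)) \<le> pre (t (Suc i))"
      using pre(3)[OF tT[of "Suc i"], of "fR (pre (t i))"] WF[OF pre(1)[OF tT[of i]], of 1]
        fR_mono[OF pre(2)[OF tT[of i]] pre_c[OF tT[of i]]] tSuc by simp
    then show "pre (t i) \<le> t i \<and> (t i < c \<or> c < pre (t i)) \<and> fR (pre (t i)) \<le> pre (t (Suc i)) \<and>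
        t (Suc i) \<le> fR (t i)"
      using pre(2)[OF tT[of i]] pre_c[OF tT[of i]] tSuc by simp
  qed (use pre(2)[OF tT] in \<open>simp add: less_imp_le\<close>)
  then obtain l r where pb: "pulls_back n (\<lambda>i. pre (t i)) t l r" by blast
  then have "r = t 0" using tSuc unfolding pulls_back_def by blast
  then have r: "r = \<tau>" using t0 by simp
  have pbz: "(\<forall>i<n. (fR ^^ i) z \<in> {pre (t i)..t i}) \<and> (fR ^^ n) z = pre (t n) + slope n l * (z - l) \<and>
      slope n z = slope n l" if "z \<in> {l..r}" for z
    using pb that unfolding pulls_back_def by blast
  have "pre (t 0) \<le> l" "l \<le> r" "(fR ^^ n) l = pre (t n)"
    using pb unfolding pulls_back_def by blast+
  then have l: "\<sigma> \<le> l" "l \<le> \<tau>" "(fR ^^ n) l = \<sigma>"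
    using t0 r by (simp_all add: \<sigma>_def)
  have "slope n l = slope n u" using pbz[of \<tau>] r l(2) TI(3)[OF \<tau>T] by simp
  then have L: "\<And>i. i < n \<Longrightarrow> (fR ^^ i) z \<in> {pre (t i)..t i}" "(fR ^^ n) z = \<sigma> + slope n u * (z - l)"
    if "z \<in> {l..\<tau>}" for z
    using pbz[of z] that r t0(2) \<sigma>_def by simp_all
  have "\<exists>l r. pulls_back m s (\<lambda>i. nxt (s i)) l r"
  proof (rule ex_pulls_back)
    fix i
    have "nxt (s (Suc i)) \<le> fR (nxt (s i))"
      using nxt(3)[OF sS[of "Suc i"], of "fR (nxt (s i))"] WF[OF nxt(1)[OF sS[of i]], of 1]
        fR_mono[OF nxt(2)[OF sS[of i]] nxt_c[OF sS[of i]]] sSuc by simp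
    then show "s i \<le> nxt (s i) \<and> (nxt (s i) < c \<or> c < s i) \<and> fR (s i) \<le> s (Suc i) \<and>
        nxt (s (Suc i)) \<le> fR (nxt (s i))"
      using nxt(2)[OF sS[of i]] nxt_c[OF sS[of i]] sSuc by simp
  qed (use nxt(2)[OF sS] in \<open>simp add: less_imp_le\<close>)
  then obtain l' q where pb': "pulls_back m s (\<lambda>i. nxt (s i)) l' q" by blast
  then have "l' = s 0" using sSuc unfolding pulls_back_def by blast
  then have l': "l' = \<sigma>" using t0 by simp
  have pbz': "(\<forall>i<m. (fR ^^ i) z \<in> {s i..nxt (s i)}) \<and> (fR ^^ m) z = s m + slope m l' * (z - l') \<and>
      slope m z = slope m l'" if "z \<in> {l'..q}" for z
    using pb' that unfolding pulls_back_def by blast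
  have "l' \<le> q" "q \<le> nxt (s 0)" "(fR ^^ m) q = nxt (s m)"
    using pb' unfolding pulls_back_def by blast+
  then have q: "\<sigma> \<le> q" "q \<le> \<tau>" "(fR ^^ m) q = \<tau>"
    using t0 l' nxt\<sigma> by simp_all
  have R: "\<And>i. i < m \<Longrightarrow> (fR ^^ i) z \<in> {s i..nxt (s i)}" "(fR ^^ m) z = \<sigma> + slope m v * (z - \<sigma>)"
    if "z \<in> {\<sigma>..q}" for z
    using pbz'[of z] that l' t0(4) SI(3)[OF \<sigma>S] by simp_all
  \<comment> \<open>The slope on \<open>(c, v)\<close> is read off at \<open>c+\<close>, that on
    \<open>[\<sigma>, q]\<close> along the orbit of \<open>v\<close>. They agree because
    \<open>(c, v)\<close> is never cut and the orbit of \<open>v\<close> avoids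
    \<open>c\<close>.\<close>
  have slope_v: "slope m c = slope m v"
  proof -
    have "sl ((fR ^^ i) c) = sl ((fR ^^ i) v)" if i: "i < m" for i
    proof -
      have "(fL ^^ i) v = (fR ^^ i) v"
        by (rule funpow_fL_eq_fR') (use WF[of v] Wc vS in \<open>auto simp: W_def\<close>)
      moreover have "(fR ^^ i) c < (fL ^^ i) v" using uncut_less[OF uncut_le[OF m(2)], of i] uv i by simp
      moreover have "(fL ^^ i) v \<le> c \<or> c \<le> (fR ^^ i) c" using m(2) i by (auto simp: uncut_def)
      ultimately show ?thesis using Wc[OF WF[of v]] vS by (auto simp: sl_def W_def)
    qed
    then show ?thesis by (simp add: slope_def)
  qed
  have lenL: "slope n u * (c - u) \<le> v - u" using uncut_length[OF n(2) uv(2)] n by simp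
  have lenR: "slope m v * (v - c) \<le> v - u"
  proof -
    have "(fL ^^ m) v = v"
      using m(3) funpow_fL_eq_fR'[of m v] WF[of v] Wc vS by (auto simp: W_def)
    then show ?thesis using uncut_length[OF m(2) uv(3)] m(4) slope_v by simp
  qed
  \<comment> \<open>The proportions of \<open>[\<sigma>, \<tau>]\<close> taken up by
    \<open>[l, \<tau>]\<close> and \<open>[\<sigma>, q]\<close> are the reciprocal slopes. They are
    at least \<open>(c - u) / (v - u)\<close> and \<open>(v - c) / (v - u)\<close>, which add up to
    1.\<close>
  have lq: "l \<le> q"
  proof -
    have 1: "\<tau> - \<sigma> = slope n u * (\<tau> - l)" using L(2)[of \<tau>] TI(2)[OF \<tau>T] l(2)
      by simp
    have 2: "\<tau> - \<sigma> = slope m v * (q - \<sigma>)" using R(2)[of q] q by simp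
    have "(\<tau> - \<sigma>) * (c - u) = slope n u * (c - u) * (\<tau> - l)" unfolding 1 by simp
    also have "\<dots> \<le> (v - u) * (\<tau> - l)" using lenL l by (intro mult_right_mono) auto
    finally have 3: "(\<tau> - \<sigma>) * (c - u) \<le> (v - u) * (\<tau> - l)" .
    have "(\<tau> - \<sigma>) * (v - c) = slope m v * (v - c) * (q - \<sigma>)" unfolding 2 by simp
    also have "\<dots> \<le> (v - u) * (q - \<sigma>)" using lenR q by (intro mult_right_mono) auto
    finally have "(v - u) * (\<tau> - \<sigma>) \<le> (v - u) * (\<tau> - l + (q - \<sigma>))"
      using 3 by (simp add: algebra_simps)
    then show ?thesis using uv by simp
  qed
  show False
  proof (cases "l = q")
    case True
    \<comment> \<open>The common end reaches \<sigma> in \<open>S\<close> after \<open>n\<close>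
      steps and \<tau> in \<open>T\<close> after \<open>m\<close> steps. Whichever comes first,
      invariance of that orbit contradicts disjointness.\<close>
    then have "(fR ^^ n) q = \<sigma>" using l by simp
    show False
    proof (cases "n \<le> m")
      case True
      then have "(fR ^^ m) q = (fR ^^ (m - n)) \<sigma>"
        using \<open>(fR ^^ n) q = \<sigma>\<close> funpow_le_eq by metis
      then show False using SF[OF \<sigma>S] q(3) \<tau>T TS by auto
    next
      case False
      then have "(fR ^^ n) q = (fR ^^ (n - m)) \<tau>" using q(3) funpow_le_eq by (metis nat_le_linear)
      then show False using TF[OF \<tau>T] \<open>(fR ^^ n) q = \<sigma>\<close> \<sigma>S TS by auto
    qed
  next
    case False
    \<comment> \<open>An interior point of the overlap follows both chains of boxes.\<close>
    define e where "e = (l + q) / 2"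
    have e: "l < e" "e < q" "e \<in> {l..\<tau>}" "e \<in> {\<sigma>..q}" using lq False l q
      by (auto simp: e_def)
    have en: "\<sigma> < (fR ^^ n) e" "(fR ^^ n) e < \<tau>"
    proof -
      show "\<sigma> < (fR ^^ n) e" using L(2)[OF e(3)] e(1) by simp
      have "\<tau> = \<sigma> + slope n u * (\<tau> - l)" using L(2)[of \<tau>] TI(2)[OF \<tau>T] l(2) by simp
      moreover have "slope n u * (e - l) < slope n u * (\<tau> - l)" using e q by simp
      ultimately show "(fR ^^ n) e < \<tau>" using L(2)[OF e(3)] by linarith
    qed
    have em: "\<sigma> < (fR ^^ m) e" "(fR ^^ m) e < \<tau>"
    proof -
      have "\<sigma> < e" using e(1) l(1) by simp
      then show "\<sigma> < (fR ^^ m) e" using R(2)[OF e(4)] by simp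
      have "\<tau> = \<sigma> + slope m v * (q - \<sigma>)" using R(2)[of q] q by simp
      moreover have "slope m v * (e - \<sigma>) < slope m v * (q - \<sigma>)" using e q by simp
      ultimately show "(fR ^^ m) e < \<tau>" using R(2)[OF e(4)] by linarith
    qed
    have notW: "(fR ^^ i) e \<notin> W" if "i \<le> n" for i
    proof
      assume "(fR ^^ i) e \<in> W"
      then have "(fR ^^ n) e \<in> W" using WF funpow_le_eq[OF that] by metis
      then show False using adj en by force
    qed
    have inL: "pre (t i) < (fR ^^ i) e \<and> (fR ^^ i) e < t i" if "i \<le> n" for i
    proof (cases "i < n")
      case True
      then have "(fR ^^ i) e \<noteq> pre (t i)" "(fR ^^ i) e \<noteq> t i"
        using notW[OF that] pre(1)[OF tT[of i]] tT[of i] by (auto simp: W_def)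
      then show ?thesis using L(1)[OF e(3) True] by auto
    next
      case False
      then show ?thesis using en that t0 by (simp add: \<sigma>_def)
    qed
    have inR: "s i < (fR ^^ i) e \<and> (fR ^^ i) e < nxt (s i)" if "i \<le> m" "i \<le> n" for i
    proof (cases "i < m")
      case True
      then have "(fR ^^ i) e \<noteq> nxt (s i)" "(fR ^^ i) e \<noteq> s i"
        using notW[OF that(2)] nxt(1)[OF sS[of i]] sS[of i] by (auto simp: W_def)
      then show ?thesis using R(1)[OF e(4) True] by auto
    next
      case False
      then show ?thesis using em that t0 nxt\<sigma> by simp
    qed
    \<comment> \<open>Boxes bounded by neighbours in \<open>W\<close> coincide as soon as they share
      an interior point. So the two chains agree up to the shorter return time, and
      \<open>[\<sigma>, \<tau>]\<close> then returns onto itself uncut, which is impossible for a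
      slope greater than 1.\<close>
    have same: "pre (t i) = s i" if "i \<le> m" "i \<le> n" for i
    proof (rule antisym)
      show "pre (t i) \<le> s i"
        using nxt(3)[OF sS[of i], of "pre (t i)"] pre(1)[OF tT[of i]] inL[OF that(2)] inR[OF that] by force
      show "s i \<le> pre (t i)"
        using pre(3)[OF tT[of i], of "s i"] sS[of i] inL[OF that(2)] inR[OF that] by (force simp: W_def)
    qed
    define k where "k = min n m"
    have k: "k \<le> m" "k \<le> n" "k > 0" using n m by (auto simp: k_def)
    have "t k = \<tau> \<and> s k = \<sigma>"
    proof (cases "n \<le> m")
      case True
      then show ?thesis using same[OF k(1,2)] t0 by (simp add: k_def min_def \<sigma>_def)
    next
      case False
      then have "k = m" by (simp add: k_def)
      have "\<tau> \<le> t m" using inL[of m] em adj[of "t m"] tT[of m] False by (auto simp: W_def)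
      moreover have "\<not> \<tau> < t m"
        using inL[of m] em pre(3)[OF tT[of m], of \<tau>] \<tau>T False by (auto simp: W_def)
      ultimately have "t m = \<tau>" by simp
      then show ?thesis using t0 \<open>k = m\<close> by simp
    qed
    have side: "t i < c \<or> c < s i" if "i < k" for i
      using pre_c[OF tT[of i]] same[of i] that k by simp
    have fLt: "(fL ^^ i) \<tau> = t i" for i
      unfolding t_def by (rule funpow_fL_eq_fR') (use TF[OF \<tau>T] Wc in \<open>auto simp: W_def\<close>)
    have uncut: "uncut k \<sigma> \<tau>" unfolding uncut_def
      using side fLt by (force simp: s_def)
    have \<sigma>01: "0 \<le> \<sigma>" "\<tau> \<le> 1" using W01 \<sigma>S \<tau>T by (auto simp: W_def)
    have fixed: "(fR ^^ k) \<sigma> = \<sigma>" "(fL ^^ k) \<tau> = \<tau>"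
      using \<open>t k = \<tau> \<and> s k = \<sigma>\<close> fLt by (auto simp: s_def)
    have "slope k \<sigma> > 1"
      using slope_at_fixed_point[OF uncut \<sigma>01(1) \<sigma>\<tau> \<sigma>01(2), of \<sigma>] fixed \<sigma>\<tau> k by simp
    moreover have "\<tau> - \<sigma> = slope k \<sigma> * (\<tau> - \<sigma>)"
      using uncut_length[OF uncut \<sigma>\<tau>] fixed by simp
    ultimately show False using \<sigma>\<tau> by simp
  qed
qed

end

section \<open>A periodic orbit of minimal period\<close>

text \<open>The orbit is followed from the left; an orbit followed from the right becomes one of
  this kind by reflection. If it meets \<open>c\<close>, it does so as \<open>c-\<close>, which is
  why the inequalities below read PL \<le> c < PR.\<close>

locale lorenz_orbit = lorenz_map +
  fixes \<kappa> :: nat and x0 :: real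
  assumes \<kappa>: "2 \<le> \<kappa>" and x0: "0 < x0" "x0 \<le> 1" and x0_periodic: "(fL ^^ \<kappa>) x0 = x0"
    and no_short_period: "0 < n \<Longrightarrow> n < \<kappa> \<Longrightarrow> \<not> has_period a b c n x"
begin

section \<open>The orbit, its neighbours of c and the return maps\<close>

definition orb :: "real set" where "orb = (\<lambda>i. (fL ^^ i) x0) ` {..<\<kappa>}"
definition PL :: real where "PL = Max {y \<in> orb. y \<le> c}"
definition PR :: real where "PR = Min {y \<in> orb. c < y}"
definition A :: real where "A = (fR ^^ \<kappa>) c"
definition B :: real where "B = (fL ^^ \<kappa>) c"

lemma finite_orb: "finite orb" and card_orb: "card orb \<le> \<kappa>"
  unfolding orb_def using card_image_le[of "{..<\<kappa>}"] by auto

lemma funpow_x0_in_orb: "(fL ^^ i) x0 \<in> orb"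
proof -
  have "(fL ^^ i) x0 = (fL ^^ (i mod \<kappa>)) x0" by (rule funpow_mod_eq[OF x0_periodic, symmetric])
  then show ?thesis using \<kappa> unfolding orb_def by (intro image_eqI[of _ _ "i mod \<kappa>"]) auto
qed

lemma orb_cases: "p \<in> orb \<Longrightarrow> \<exists>i<\<kappa>. p = (fL ^^ i) x0"
  by (auto simp: orb_def)

lemma orb_funpow: "p \<in> orb \<Longrightarrow> (fL ^^ i) p \<in> orb"
  using orb_cases[of p] funpow_x0_in_orb by (metis comp_apply funpow_add)

lemma orb_fL: "p \<in> orb \<Longrightarrow> fL p \<in> orb"
  using orb_funpow[of p 1] by simp

lemma orb_periodic: "p \<in> orb \<Longrightarrow> (fL ^^ \<kappa>) p = p"
  using orb_cases[of p] funpow_periodic[OF x0_periodic] by auto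

lemma orb_range: "p \<in> orb \<Longrightarrow> 0 < p \<and> p \<le> 1"
  using orb_cases[of p] funpow_fL_range[OF x0] by auto

lemma orb_transitive: "p \<in> orb \<Longrightarrow> q \<in> orb \<Longrightarrow> \<exists>k. (fL ^^ k) p = q"
proof -
  assume "p \<in> orb" "q \<in> orb"
  then obtain i j where ij: "i < \<kappa>" "p = (fL ^^ i) x0" "q = (fL ^^ j) x0" using orb_cases by metis
  have "(fL ^^ (\<kappa> - i)) p = x0" unfolding ij
    using x0_periodic funpow_le_eq[of i \<kappa> fL x0] ij(1) by simp
  then have "(fL ^^ (j + (\<kappa> - i))) p = q" by (simp add: funpow_add ij)
  then show ?thesis by blast
qed

lemma no_fixed: "\<not> (\<exists>x. has_period a b c 1 x)"
  using no_short_period[of 1] \<kappa> by auto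

text \<open>Without fixed points the left branch moves every point up and the right branch moves
  every point down, so a finite invariant set cannot stay on one side.\<close>

lemma orb_sides: "{y \<in> orb. y \<le> c} \<noteq> {}" "{y \<in> orb. c < y} \<noteq> {}"
proof -
  have ne: "orb \<noteq> {}" using funpow_x0_in_orb by blast
  show "{y \<in> orb. y \<le> c} \<noteq> {}"
  proof
    assume *: "{y \<in> orb. y \<le> c} = {}"
    have q: "Min orb \<in> orb" using ne finite_orb by simp
    then have "c < Min orb" using * by force
    then have "fL (Min orb) < Min orb"
      using no_fixed_point_branches(2)[OF no_fixed, of "Min orb"] orb_range[OF q] by (simp add: lorenzl_def)
    then show False using Min_le[OF finite_orb orb_fL[OF q]] by simp
  qed
  show "{y \<in> orb. c < y} \<noteq> {}"
  proof
    assume *: "{y \<in> orb. c < y} = {}"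
    have q: "Max orb \<in> orb" using ne finite_orb by simp
    then have "Max orb \<le> c" using * by force
    then have "Max orb < fL (Max orb)"
      using no_fixed_point_branches(1)[OF no_fixed, of "Max orb"] orb_range[OF q] by (simp add: lorenzl_def)
    then show False using Max_ge[OF finite_orb orb_fL[OF q]] by simp
  qed
qed

lemma PL: "PL \<in> orb" "PL \<le> c" "\<And>y. y \<in> orb \<Longrightarrow> y \<le> c \<Longrightarrow> y \<le> PL"
proof -
  have "PL \<in> {y \<in> orb. y \<le> c}" unfolding PL_def using orb_sides(1) finite_orb
    by (intro Max_in) auto
  then show "PL \<in> orb" "PL \<le> c" by auto
  show "y \<le> PL" if "y \<in> orb" "y \<le> c" for y unfolding PL_def using that finite_orb
    by (intro Max_ge) auto
qed

lemma PR: "PR \<in> orb" "c < PR" "\<And>y. y \<in> orb \<Longrightarrow> c < y \<Longrightarrow> PR \<le> y"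
proof -
  have "PR \<in> {y \<in> orb. c < y}" unfolding PR_def using orb_sides(2) finite_orb by (intro Min_in) auto
  then show "PR \<in> orb" "c < PR" by auto
  show "PR \<le> y" if "y \<in> orb" "c < y" for y unfolding PR_def using that finite_orb
    by (intro Min_le) auto
qed

lemma orb_outside: "y \<in> orb \<Longrightarrow> y \<le> PL \<or> PR \<le> y"
  using PL(3) PR(3) by (meson not_le)

lemma PL_pos: "0 < PL" and PR_le: "PR \<le> 1"
  using orb_range PL(1) PR(1) by auto

lemma c_notin_orb: "PL < c \<Longrightarrow> p \<in> orb \<Longrightarrow> p \<noteq> c"
  using PL(3)[of c] by auto

lemma orb_fR_eq: "PL < c \<Longrightarrow> p \<in> orb \<Longrightarrow> (fR ^^ i) p = (fL ^^ i) p"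
  using funpow_fL_eq_fR[of i p] c_notin_orb orb_funpow by auto

text \<open>If an image at a time \<open>i < \<kappa>\<close> contained \<open>c\<close>, its left
  end, a point of the orbit below \<open>c\<close>, would be at most \<open>PL\<close>, while its
  right end lies beyond \<open>c\<close>. The crossing of the diagonal would be a periodic point of
  period \<open>i\<close>.\<close>

lemma uncut_PL: assumes "PL < c" shows "uncut \<kappa> PL c"
proof -
  have "uncut i PL c" if "i \<le> \<kappa>" for i
    using that
  proof (induction i)
    case (Suc i)
    show ?case
    proof (cases "i = 0")
      case True then show ?thesis by (simp add: uncut_def)
    next
      case False
      have uncut: "uncut i PL c" using Suc by simp
      have "(fL ^^ i) c \<le> c \<or> c \<le> (fR ^^ i) PL"
      proof (rule ccontr)
        assume *: "\<not> ((fL ^^ i) c \<le> c \<or> c \<le> (fR ^^ i) PL)"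
        then have "(fR ^^ i) PL \<le> PL"
          using orb_outside[OF orb_funpow[OF PL(1), of i]] PR(2) orb_fR_eq[OF assms PL(1), of i] by auto
        then have "\<exists>z. has_period a b c i z"
          using * False PL_pos c_less by (intro has_period_crossing[OF uncut _ assms]) auto
        then show False using no_short_period[of i] False Suc.prems by auto
      qed
      then show ?thesis using uncut by (simp add: uncut_Suc)
    qed
  qed simp
  then show ?thesis by simp
qed

lemma uncut_PR: "uncut \<kappa> c PR"
proof -
  have "uncut i c PR" if "i \<le> \<kappa>" for i
    using that
  proof (induction i)
    case (Suc i)
    show ?case
    proof (cases "i = 0")
      case True then show ?thesis by (simp add: uncut_def)
    next
      case False
      have uncut: "uncut i c PR" using Suc by simp
      have "(fL ^^ i) PR \<le> c \<or> c \<le> (fR ^^ i) c"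
      proof (rule ccontr)
        assume *: "\<not> ((fL ^^ i) PR \<le> c \<or> c \<le> (fR ^^ i) c)"
        then have "PR \<le> (fL ^^ i) PR" using PR(3)[OF orb_funpow[OF PR(1), of i]] by simp
        then have "\<exists>z. has_period a b c i z"
          using * False PR_le c_pos by (intro has_period_crossing[OF uncut _ PR(2)]) auto
        then show False using no_short_period[of i] False Suc.prems by auto
      qed
      then show ?thesis using uncut by (simp add: uncut_Suc)
    qed
  qed simp
  then show ?thesis by simp
qed

lemma return_right:
  obtains \<Lambda> where "\<Lambda> > 1" "\<And>x. aff \<kappa> c x = PR - \<Lambda> * (PR - x)" "A = PR - \<Lambda> * (PR - c)"
    "\<And>x. c \<le> x \<Longrightarrow> x < PR \<Longrightarrow> (fR ^^ \<kappa>) x = PR - \<Lambda> * (PR - x)"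
proof -
  have fixed: "aff \<kappa> c PR = PR" using uncut_right_end[OF uncut_PR PR(2)] orb_periodic[OF PR(1)] by simp
  have 1: "slope \<kappa> c > 1"
    using slope_at_fixed_point[OF uncut_PR _ PR(2) PR_le, of PR] fixed PR(2) c_pos \<kappa> by simp
  have eq: "aff \<kappa> c x = PR - slope \<kappa> c * (PR - x)" for x
    using fixed by (simp add: aff_def algebra_simps)
  have "A = PR - slope \<kappa> c * (PR - c)" using eq[of c] by (simp add: A_def)
  moreover have "(fR ^^ \<kappa>) x = PR - slope \<kappa> c * (PR - x)" if "c \<le> x" "x < PR" for x
    using uncut_aff[OF uncut_PR PR(2) that(1)] eq[of x] that(2) by simp
  ultimately show thesis by (intro that[OF 1 eq])
qed

lemma return_left:
  assumes "PL < c"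
  obtains \<Lambda> where "\<Lambda> > 1" "\<And>x. aff \<kappa> PL x = PL + \<Lambda> * (x - PL)" "B = PL + \<Lambda> * (c - PL)"
    "\<And>x. PL \<le> x \<Longrightarrow> x < c \<Longrightarrow> (fR ^^ \<kappa>) x = PL + \<Lambda> * (x - PL)"
proof -
  note uncutL = uncut_PL[OF assms]
  have fixed: "(fR ^^ \<kappa>) PL = PL" using orb_fR_eq[OF assms PL(1)] orb_periodic[OF PL(1)] by simp
  have 1: "slope \<kappa> PL > 1"
    using slope_at_fixed_point[OF uncutL _ assms, of PL] fixed assms PL_pos c_less \<kappa> by simp
  have eq: "aff \<kappa> PL x = PL + slope \<kappa> PL * (x - PL)" for x
    using fixed by (simp add: aff_def)
  have "B = PL + slope \<kappa> PL * (c - PL)" using uncut_right_end[OF uncutL assms] eq[of c]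
    by (simp add: B_def)
  moreover have "(fR ^^ \<kappa>) x = PL + slope \<kappa> PL * (x - PL)" if "PL \<le> x" "x < c" for x
    using uncut_aff[OF uncutL assms that(1)] eq[of x] that(2) by simp
  ultimately show thesis by (intro that[OF 1 eq])
qed

lemma A_less: "A < c"
proof -
  obtain \<Lambda> where \<Lambda>: "\<Lambda> > 1" "A = PR - \<Lambda> * (PR - c)" by (rule return_right)
  have "1 * (PR - c) < \<Lambda> * (PR - c)" using \<Lambda>(1) PR(2) by (intro mult_strict_right_mono) auto
  then show ?thesis using \<Lambda>(2) by simp
qed

lemma B_greater: assumes "PL < c" shows "c < B"
proof -
  obtain \<Lambda> where \<Lambda>: "\<Lambda> > 1" "B = PL + \<Lambda> * (c - PL)"
    by (rule return_left[OF assms])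
  have "1 * (c - PL) < \<Lambda> * (c - PL)" using \<Lambda>(1) assms by (intro mult_strict_right_mono) auto
  then show ?thesis using \<Lambda>(2) by simp
qed

lemma B_eq: "PL = c \<Longrightarrow> B = c"
  using orb_periodic[OF PL(1)] by (simp add: B_def)

text \<open>Since \<open>c\<close> is avoided up to the time of the hit, \<open>fL\<close> and
  \<open>fR\<close> agree along the way, and the set does not depend on the value at
  \<open>c\<close>.\<close>

definition hit :: "real set" where
  "hit = {x \<in> {0..1}. \<exists>n. (fR ^^ n) x \<in> orb \<and> (\<forall>i\<le>n. (fR ^^ i) x \<noteq> c)}"

lemma hit_fR: assumes "PL < c" "x \<in> hit" shows "x \<noteq> c" "fR x \<in> hit"
proof -
  obtain n where n: "x \<in> {0..1}" "(fR ^^ n) x \<in> orb" "\<forall>i\<le>n. (fR ^^ i) x \<noteq> c"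
    using assms(2) unfolding hit_def by blast
  show "x \<noteq> c" using n(3) by (metis funpow_0 le0)
  have "\<exists>m. (fR ^^ m) (fR x) \<in> orb \<and> (\<forall>i\<le>m. (fR ^^ i) (fR x) \<noteq> c)"
  proof (cases n)
    case 0
    then have "fR x \<in> orb" using n(2) orb_fL[of x] fL_eq_fR[OF \<open>x \<noteq> c\<close>] by simp
    then show ?thesis using c_notin_orb[OF assms(1)] by (intro exI[of _ 0]) simp
  next
    case (Suc m)
    have "(fR ^^ i) (fR x) \<noteq> c" if "i \<le> m" for i
      using n(3) that Suc funpow_Suc_right[of i fR] by (metis Suc_le_mono comp_apply)
    moreover have "(fR ^^ m) (fR x) \<in> orb" using n(2) Suc funpow_Suc_right[of m fR] by (metis comp_apply)
    ultimately show ?thesis by blast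
  qed
  moreover have "fR x \<in> {0..1}" using fR_range_closed n(1) by simp
  ultimately show "fR x \<in> hit" unfolding hit_def by blast
qed

lemma hit_funpow: "PL < c \<Longrightarrow> x \<in> hit \<Longrightarrow> (fR ^^ i) x \<in> hit"
  by (induction i) (auto simp: hit_fR)

lemma hit_preimage: assumes "0 \<le> x" "x \<le> 1" "x \<noteq> c" "fR x \<in> hit" shows "x \<in> hit"
proof -
  obtain n where n: "(fR ^^ n) (fR x) \<in> orb" "\<forall>i\<le>n. (fR ^^ i) (fR x) \<noteq> c"
    using assms(4) unfolding hit_def by blast
  have "(fR ^^ i) x \<noteq> c" if "i \<le> Suc n" for i
  proof (cases i)
    case 0 then show ?thesis using assms(3) by simp
  next
    case (Suc j)
    then show ?thesis using n(2) that funpow_Suc_right[of j fR] by (metis Suc_le_mono comp_apply)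
  qed
  moreover have "(fR ^^ Suc n) x \<in> orb" using n(1) funpow_Suc_right[of n fR] by (metis comp_apply)
  ultimately show ?thesis using assms unfolding hit_def by (intro CollectI conjI exI[of _ "Suc n"]) auto
qed

lemma orb_subset_hit: "PL < c \<Longrightarrow> p \<in> orb \<Longrightarrow> p \<in> hit"
  using orb_range[of p] c_notin_orb[of p] unfolding hit_def by (intro CollectI conjI exI[of _ 0]) auto

text \<open>The assumption on \<open>A\<close> and \<open>B\<close> enters only at the very end. A
  gap of \<open>hit\<close> around \<open>c\<close> is shown to be exactly \<open>(PL, PR)\<close>
  with both return times equal to \<kappa>; the fact that its two halves return inside the gap then
  says PL \<le> A and B \<le> PR.\<close>

lemma hit_accumulates:
  assumes PLc: "PL < c" and out: "A < PL \<or> PR < B" and "\<epsilon> > 0"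
  shows "\<exists>x\<in>hit. c - \<epsilon> < x \<and> x < c + \<epsilon>"
proof (rule ccontr)
  assume "\<not> ?thesis"
  then have far: "x \<le> c - \<epsilon> \<or> c + \<epsilon> \<le> x" if "x \<in> hit" for x
    using that by force
  define u where "u = Sup {x \<in> hit. x < c}"
  define v where "v = Inf {x \<in> hit. c < x}"
  have PLh: "PL \<in> {x \<in> hit. x < c}" and PRh: "PR \<in> {x \<in> hit. c < x}"
    using orb_subset_hit[OF PLc] PL PR PLc by auto
  have bl: "bdd_above {x \<in> hit. x < c}" "bdd_below {x \<in> hit. c < x}"
    unfolding bdd_above_def bdd_below_def by (auto intro: less_imp_le)
  have u_ge: "x \<le> u" if "x \<in> hit" "x < c" for x
    unfolding u_def using that bl by (intro cSup_upper) auto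
  have v_le: "v \<le> x" if "x \<in> hit" "c < x" for x
    unfolding v_def using that bl by (intro cInf_lower) auto
  have "u \<le> c - \<epsilon>" unfolding u_def
  proof (rule cSup_least)
    fix x assume "x \<in> {x \<in> hit. x < c}"
    then show "x \<le> c - \<epsilon>" using far[of x] \<open>\<epsilon> > 0\<close> by auto
  qed (use PLh in blast)
  then have uc: "u < c" using \<open>\<epsilon> > 0\<close> by simp
  have "c + \<epsilon> \<le> v" unfolding v_def
  proof (rule cInf_greatest)
    fix x assume "x \<in> {x \<in> hit. c < x}"
    then show "c + \<epsilon> \<le> x" using far[of x] \<open>\<epsilon> > 0\<close> by auto
  qed (use PRh in blast)
  then have cv: "c < v" using \<open>\<epsilon> > 0\<close> by simp
  have "PL \<le> u" "v \<le> PR" using u_ge v_le PLh PRh by auto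
  then have uv: "0 \<le> u" "u < c" "c < v" "v \<le> 1" using uc cv PL_pos PR_le by auto
  have gap: "hit \<inter> {u<..<v} = {}"
  proof -
    have False if "x \<in> hit" "u < x" "x < v" for x
    proof -
      have "c \<le> x" "x \<le> c" using u_ge[OF that(1)] v_le[OF that(1)] that(2,3) by (meson not_le)+
      then show False using far[OF that(1)] \<open>\<epsilon> > 0\<close> by simp
    qed
    then show ?thesis by auto
  qed
  have accu: "\<exists>x\<in>hit. u - \<delta> < x \<and> x \<le> u" if "\<delta> > 0" for \<delta>
  proof -
    have "u - \<delta> < Sup {x \<in> hit. x < c}" using that by (simp add: u_def)
    then have "\<exists>x\<in>{x \<in> hit. x < c}. u - \<delta> < x" using PLh by (intro less_cSupD) auto
    then show ?thesis using u_ge by auto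
  qed
  have accv: "\<exists>x\<in>hit. v \<le> x \<and> x < v + \<delta>" if "\<delta> > 0" for \<delta>
  proof -
    have "Inf {x \<in> hit. c < x} < v + \<delta>" using that by (simp add: v_def)
    then have "\<exists>x\<in>{x \<in> hit. c < x}. x < v + \<delta>" using PRh by (intro cInf_lessD) auto
    then show ?thesis using v_le by auto
  qed
  have accu': "accumulates_left hit u" using accu by (simp add: accumulates_left_def)
  have H: "fR x \<in> hit" "x \<noteq> c" if "x \<in> hit" for x using hit_fR[OF PLc that] by auto
  have "\<exists>n>0. uncut n u c \<and> (fR ^^ n) u = u \<and> c < (fL ^^ n) c \<and> (fL ^^ n) c \<le> v"
    by (rule hits_gap_end_left(1)[OF _ _ gap uv accu']; (rule H(1) hit_preimage accv; assumption))
  then obtain n where n: "n > 0" "uncut n u c" "(fR ^^ n) u = u" "(fL ^^ n) c \<le> v" by blast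
  have "accumulates_left hit ((fR ^^ i) u) \<and> \<not> (u < (fR ^^ i) u \<and> (fR ^^ i) u < v)" for i
    by (rule hits_gap_end_left(2)[OF _ _ gap uv accu']; (rule H(1) hit_preimage accv; assumption))
  then have n_gap: "\<not> (u < (fR ^^ i) u \<and> (fR ^^ i) u < v)" for i by blast
  have H2: "x \<noteq> c \<and> fR x \<in> hit" if "x \<in> hit" for x using H[OF that] by blast
  have "\<exists>n>0. uncut n c v \<and> (fL ^^ n) v = v \<and> (fR ^^ n) c < c \<and> u \<le> (fR ^^ n) c"
    by (rule hits_gap_end_right(1)[OF _ _ gap uv]; (rule H2 hit_preimage accu accv; assumption))
  then obtain m where m: "m > 0" "uncut m c v" "(fL ^^ m) v = v" "u \<le> (fR ^^ m) c" by blast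
  have m_gap: "\<not> (u < (fL ^^ i) v \<and> (fL ^^ i) v < v)" for i
    by (rule hits_gap_end_right(2)[OF _ _ gap uv]; (rule H2 hit_preimage accu accv; assumption))
  have vc: "(fL ^^ i) v \<noteq> c" for i using m_gap[of i] uv by auto
  have vR: "(fL ^^ i) v = (fR ^^ i) v" for i
    by (rule funpow_fL_eq_fR) (rule vc)
  have uc: "(fR ^^ i) u \<noteq> c" for i using n_gap[of i] uv by auto
  have uL: "(fL ^^ i) u = (fR ^^ i) u" for i
    by (rule funpow_fL_eq_fR') (rule uc)
  have "\<exists>i j. (fR ^^ i) u = (fR ^^ j) v"
    by (rule same_orbit[OF n m(1,2) _ m(4) uv n_gap _ no_fixed]) (use m m_gap vR in auto)
  then obtain i j where ij: "(fR ^^ i) u = (fR ^^ j) v" by blast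
  have period_mult: "(f ^^ (k * l)) x = x" if "(f ^^ l) x = x" for f :: "real \<Rightarrow> real" and k l x
    using that by (induction k) (auto simp: funpow_add)
  \<comment> \<open>A time from \<open>u\<close> to \<open>v\<close>: \<open>i\<close> steps lead to
    the point \<open>j\<close> steps after \<open>v\<close>, and \<open>m * j - j\<close> more
    complete \<open>j\<close> periods of \<open>v\<close>. As \<open>m > 0\<close>, the subtraction
    does not truncate.\<close>
  define s where "s = m * j - j + i"
  have s: "(fR ^^ s) u = v"
  proof -
    have "(fR ^^ s) u = (fR ^^ (j * m - j)) ((fR ^^ j) v)" by (simp add: s_def funpow_add ij mult.commute)
    also have "\<dots> = (fR ^^ (j * m)) v" using m(1) by (subst funpow_le_eq[of j "j * m"]) auto
    finally show ?thesis using period_mult[of m fR v j] m(3) vR by simp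
  qed
  \<comment> \<open>If \<open>u\<close> were not in \<open>hit\<close>, points of \<open>hit\<close>
    would lie strictly to the left of \<open>u\<close> and arbitrarily near. After \<open>s\<close>
    steps they would be just to the left of \<open>v\<close>, inside the gap, although
    \<open>hit\<close> is invariant.\<close>
  have "u \<in> hit"
  proof (rule ccontr)
    assume "u \<notin> hit"
    have "eventually (\<lambda>x. (fR ^^ s) x \<in> {u<..<v}) (at_left u)"
    proof -
      have "filterlim (fR ^^ s) (at_left v) (at_left u)"
        using tendsto_funpow_left[of s u] uL[of s] s by simp
      moreover have "eventually (\<lambda>y. y \<in> {u<..<v}) (at_left v)"
        using uv by (intro eventually_at_leftI[of u]) auto
      ultimately show ?thesis by (rule eventually_compose_filterlim[rotated])
    qed
    then obtain w where w: "w < u" "\<And>x. w < x \<Longrightarrow> x < u \<Longrightarrow> (fR ^^ s) x \<in> {u<..<v}"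
      unfolding eventually_at_left_field by blast
    obtain x where "x \<in> hit" "u - (u - w) < x" "x \<le> u" using accu[of "u - w"] w(1) by auto
    moreover then have "x \<noteq> u" using \<open>u \<notin> hit\<close> by auto
    ultimately have "(fR ^^ s) x \<in> {u<..<v}" "(fR ^^ s) x \<in> hit" using w hit_funpow[OF PLc] by auto
    then show False using gap by blast
  qed
  then obtain k where k: "(fR ^^ k) u \<in> orb" by (auto simp: hit_def)
  have orbR: "(fR ^^ l) p \<in> orb" if "p \<in> orb" for p l
    using orb_fR_eq[OF PLc that] orb_funpow[OF that] by simp
  have u_orb: "u \<in> orb"
  proof -
    have "(fR ^^ (k * n - k)) ((fR ^^ k) u) = (fR ^^ (k * n)) u"
      using n(1) by (subst funpow_le_eq[of k "k * n"]) auto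
    then show ?thesis using orbR[OF k] period_mult[OF n(3)] by metis
  qed
  have v_orb: "v \<in> orb" using orbR[OF u_orb] s by metis
  have uPL: "u = PL" using PL(3)[OF u_orb] \<open>PL \<le> u\<close> uv by simp
  have vPR: "v = PR" using PR(3)[OF v_orb] \<open>v \<le> PR\<close> uv by simp
  have fixL: "(fR ^^ \<kappa>) PL = PL" and fixR: "(fL ^^ \<kappa>) PR = PR"
    using orb_fR_eq[OF PLc PL(1)] orb_periodic PL PR by auto
  \<comment> \<open>\<open>n\<close> cannot be smaller, as it is a period of \<open>PL\<close>, nor
    larger, as the image of \<open>(PL, c)\<close> already contains \<open>c\<close> at time
    \<kappa>.\<close>
  have "n = \<kappa>"
  proof (rule antisym)
    show "n \<le> \<kappa>"
    proof (rule ccontr)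
      assume "\<not> n \<le> \<kappa>"
      then have "(fL ^^ \<kappa>) c \<le> c \<or> c \<le> (fR ^^ \<kappa>) u" using n(2)
        by (auto simp: uncut_def)
      then show False using B_greater[OF PLc] fixL PLc uPL by (auto simp: B_def)
    qed
    have "has_period a b c n PL"
      unfolding has_period_iff using n uPL uv c_less by auto
    then show "\<kappa> \<le> n" using no_short_period[of n PL] n(1) by (meson not_le)
  qed
  moreover have "m = \<kappa>"
  proof (rule antisym)
    show "m \<le> \<kappa>"
    proof (rule ccontr)
      assume "\<not> m \<le> \<kappa>"
      then have "(fL ^^ \<kappa>) v \<le> c \<or> c \<le> (fR ^^ \<kappa>) c" using m(2)
        by (auto simp: uncut_def)
      then show False using A_less fixR PR(2) vPR by (auto simp: A_def)
    qed
    have "has_period a b c m PR"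
      unfolding has_period_iff using m vPR uv c_pos by auto
    then show "\<kappa> \<le> m" using no_short_period[of m PR] m(1) by (meson not_le)
  qed
  ultimately show False using out n(4) m(4) uPL vPR by (auto simp: A_def B_def)
qed

text \<open>At time \<open>i\<close> the left end is a point of the orbit. If it is at least
  \<open>PR\<close>, the whole image is above \<open>PR\<close>. Otherwise it is strictly below
  \<open>PL\<close>, because \<open>i\<close> is not a period. An image reaching beyond
  \<open>PL\<close> would then contain \<open>PL\<close>, so some \<open>y\<close> in
  \<open>(PL, c)\<close> would be in the orbit at time \<kappa>; but its return lies strictly
  between \<open>PL\<close> and \<open>B \<le> PR\<close>.\<close>

lemma left_half_leaves:
  assumes PLc: "PL < c" and B: "B \<le> PR" and x: "PL < x" "x < c" and i: "0 < i" "i < \<kappa>"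
  shows "(fR ^^ i) x \<le> PL \<or> PR \<le> (fR ^^ i) x"
proof -
  define p where "p = (fR ^^ i) PL"
  have p: "p \<in> orb" using orb_funpow[OF PL(1)] orb_fR_eq[OF PLc PL(1)] by (simp add: p_def)
  have uncut: "uncut i PL c" using uncut_PL[OF PLc] i by (simp add: uncut_def)
  have im: "(fR ^^ i) y = aff i PL y" if "PL < y" "y < c" for y
    using uncut_aff[OF uncut PLc, of y] that by auto
  have lower: "p < (fR ^^ i) x" using im[OF x] aff_strict_mono[OF x(1), of i PL] by (simp add: p_def)
  have upper: "(fR ^^ i) x < (fL ^^ i) c"
    using im[OF x] aff_strict_mono[OF x(2), of i PL] uncut_right_end[OF uncut PLc] by simp
  show ?thesis
  proof (cases "PR \<le> p")
    case True then show ?thesis using lower by simp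
  next
    case False
    then have pPL: "p \<le> PL" using orb_outside[OF p] by simp
    have "p \<noteq> PL"
    proof
      assume "p = PL"
      then have "has_period a b c i PL"
        using i PL_pos PLc c_less unfolding has_period_iff by (simp add: p_def)
      then show False using no_short_period i by blast
    qed
    have "(fL ^^ i) c \<le> PL"
    proof (rule ccontr)
      assume *: "\<not> (fL ^^ i) c \<le> PL"
      have "(fR ^^ i) PL < PL" using pPL \<open>p \<noteq> PL\<close> by (simp add: p_def)
      then obtain y where y: "PL < y" "y < c" "(fR ^^ i) y = PL"
        using uncut_image_point[OF uncut PLc _ *[unfolded not_le]] by blast
      have "(fR ^^ \<kappa>) y = (fR ^^ (\<kappa> - i)) PL" using funpow_le_eq[of i \<kappa> fR y] y(3) i
        by simp
      then have "(fR ^^ \<kappa>) y \<in> orb" using orb_funpow[OF PL(1)] orb_fR_eq[OF PLc PL(1)] by simp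
      moreover obtain \<Lambda> where \<Lambda>: "\<Lambda> > 1" "B = PL + \<Lambda> * (c - PL)" "(fR ^^ \<kappa>) y = PL + \<Lambda> * (y - PL)"
        using return_left[OF PLc] y by (metis less_imp_le)
      moreover have "0 < \<Lambda> * (y - PL)" "\<Lambda> * (y - PL) < \<Lambda> * (c - PL)"
        using \<Lambda>(1) y by auto
      ultimately show False using orb_outside[of "(fR ^^ \<kappa>) y"] B by linarith
    qed
    then show ?thesis using upper by simp
  qed
qed

lemma right_half_leaves:
  assumes A: "PL \<le> A" and x: "c \<le> x" "x < PR" and i: "0 < i" "i < \<kappa>"
  shows "(fR ^^ i) x \<le> PL \<or> PR \<le> (fR ^^ i) x"
proof -
  define p where "p = (fL ^^ i) PR"
  have p: "p \<in> orb" using orb_funpow[OF PR(1)] by (simp add: p_def)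
  have uncut: "uncut i c PR" using uncut_PR i by (simp add: uncut_def)
  have PLc: "PL < c" using A A_less by simp
  have im: "(fR ^^ i) y = aff i c y" if "c \<le> y" "y < PR" for y
    using uncut_aff[OF uncut PR(2), of y] that by auto
  have lower: "(fR ^^ i) c \<le> (fR ^^ i) x" using im[OF x] aff_mono[OF x(1), of i c] by simp
  have upper: "(fR ^^ i) x < p"
    using im[OF x] aff_strict_mono[OF x(2), of i c] uncut_right_end[OF uncut PR(2)] by (simp add: p_def)
  show ?thesis
  proof (cases "p \<le> PL")
    case True then show ?thesis using upper by simp
  next
    case False
    then have pPR: "PR \<le> p" using orb_outside[OF p] by simp
    have "p \<noteq> PR"
    proof
      assume "p = PR"
      then have "has_period a b c i PR"
        using i PR(2) PR_le c_pos unfolding has_period_iff by (simp add: p_def)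
      then show False using no_short_period i by blast
    qed
    have "PR \<le> (fR ^^ i) c"
    proof (rule ccontr)
      assume *: "\<not> PR \<le> (fR ^^ i) c"
      have "PR < (fL ^^ i) PR" using pPR \<open>p \<noteq> PR\<close> by (simp add: p_def)
      then obtain y where y: "c < y" "y < PR" "(fR ^^ i) y = PR"
        using uncut_image_point[OF uncut PR(2) *[unfolded not_le]] by blast
      have "(fR ^^ \<kappa>) y = (fR ^^ (\<kappa> - i)) PR" using funpow_le_eq[of i \<kappa> fR y] y(3) i
        by simp
      then have "(fR ^^ \<kappa>) y \<in> orb" using orb_funpow[OF PR(1)] orb_fR_eq[OF PLc PR(1)] by simp
      moreover obtain \<Lambda> where \<Lambda>: "\<Lambda> > 1" "A = PR - \<Lambda> * (PR - c)" "(fR ^^ \<kappa>) y = PR - \<Lambda> * (PR - y)"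
        using return_right y(1,2) by (metis less_imp_le)
      moreover have "0 < \<Lambda> * (PR - y)" "\<Lambda> * (PR - y) < \<Lambda> * (PR - c)"
        using \<Lambda>(1) y by auto
      ultimately show False using orb_outside[of "(fR ^^ \<kappa>) y"] A by linarith
    qed
    then show ?thesis using lower by simp
  qed
qed

text \<open>At times that are not multiples of \<kappa> the orbits are outside
  \<open>(PL, PR)\<close>, and \<open>f^\<kappa>\<close> maps \<open>[A, B)\<close> into itself. So
  an interval inside \<open>(PL, PR)\<close> but outside \<open>[A, B)\<close> wanders as soon as
  \<open>f^\<kappa>\<close> sends it into \<open>[A, B)\<close>. Since \<open>PL\<close> and
  \<open>PR\<close> repel under \<open>f^\<kappa>\<close>, there is such an interval adjacent to
  whichever of \<open>A\<close>, \<open>B\<close> differs from its bound.\<close>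

lemma wandering_interval:
  assumes A: "PL \<le> A" and B: "B \<le> PR" and ne: "\<not> (A = PL \<and> B = PR)"
  shows "\<exists>l r. 0 \<le> l \<and> l < r \<and> r \<le> 1 \<and> (\<forall>x\<in>{l<..<r}. \<forall>n>0. (fR ^^ n) x \<notin> {l<..<r})"
proof -
  have PLc: "PL < c" using A A_less by simp
  obtain \<Lambda> where \<Lambda>: "\<Lambda> > 1" "B = PL + \<Lambda> * (c - PL)"
    "\<And>x. PL \<le> x \<Longrightarrow> x < c \<Longrightarrow> (fR ^^ \<kappa>) x = PL + \<Lambda> * (x - PL)" using return_left[OF PLc] by metis
  obtain \<Lambda>' where \<Lambda>': "\<Lambda>' > 1" "A = PR - \<Lambda>' * (PR - c)"
    "\<And>x. c \<le> x \<Longrightarrow> x < PR \<Longrightarrow> (fR ^^ \<kappa>) x = PR - \<Lambda>' * (PR - x)" using return_right by metis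
  have left: "x \<le> (fR ^^ \<kappa>) x \<and> (fR ^^ \<kappa>) x < B" if "PL \<le> x" "x < c" for x
  proof -
    define d e where "d = \<Lambda> * (x - PL)" and "e = \<Lambda> * (c - PL)"
    have "1 * (x - PL) \<le> d" unfolding d_def using \<Lambda>(1) that by (intro mult_right_mono) auto
    moreover have "d < e" using \<Lambda>(1) that by (simp add: d_def e_def)
    ultimately show ?thesis
      using \<Lambda>(2) \<Lambda>(3)[OF that] unfolding d_def[symmetric] e_def[symmetric] by simp
  qed
  have right: "A \<le> (fR ^^ \<kappa>) x \<and> (fR ^^ \<kappa>) x \<le> x" if "c \<le> x" "x < PR" for x
  proof -
    define d e where "d = \<Lambda>' * (PR - x)" and "e = \<Lambda>' * (PR - c)"
    have "1 * (PR - x) \<le> d" unfolding d_def using \<Lambda>'(1) that by (intro mult_right_mono) auto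
    moreover have "d \<le> e" using \<Lambda>'(1) that by (simp add: d_def e_def)
    ultimately show ?thesis
      using \<Lambda>'(2) \<Lambda>'(3)[OF that] unfolding d_def[symmetric] e_def[symmetric] by simp
  qed
  have inv: "(fR ^^ \<kappa>) x \<in> {A..<B}" if "x \<in> {A..<B}" for x
    using that left[of x] right[of x] A B A_less B_greater[OF PLc] by (cases "x < c") auto
  have inv': "(fR ^^ (q * \<kappa>)) x \<in> {A..<B}" if "x \<in> {A..<B}" for x q
    using that by (induction q) (auto simp: funpow_add intro: inv simp del: atLeastLessThan_iff)
  have leave: "(fR ^^ i) x \<le> PL \<or> PR \<le> (fR ^^ i) x" if x: "PL \<le> x" "x < PR" "0 < i" "i < \<kappa>" for x i
  proof -
    consider "x = PL" | "PL < x" "x < c" | "c \<le> x" using x by linarith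
    then show ?thesis
    proof cases
      case 1
      then show ?thesis using orb_outside orb_funpow[OF PL(1)] orb_fR_eq[OF PLc PL(1)] by simp
    qed (use left_half_leaves[OF PLc B] right_half_leaves[OF A] x in auto)
  qed
  have main: "(fR ^^ n) x \<notin> D"
    if D: "D \<subseteq> {PL<..<PR}" "D \<inter> {A..<B} = {}" and x: "x \<in> D" "(fR ^^ \<kappa>) x \<in> {A..<B}" and "0 < n" for n x D
  proof -
    define q r where "q = n div \<kappa>" and "r = n mod \<kappa>"
    have r: "r < \<kappa>" "n = q * \<kappa> + r" using \<kappa> by (simp_all add: q_def r_def)
    define y where "y = (fR ^^ (q * \<kappa>)) x"
    have eq: "(fR ^^ n) x = (fR ^^ r) y" unfolding y_def using r(2) funpow_add[of r "q * \<kappa>" fR]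
      by (simp add: add.commute)
    have y: "PL \<le> y \<and> y < PR \<and> (q > 0 \<longrightarrow> y \<in> {A..<B})"
    proof (cases q)
      case 0 then show ?thesis using x D by (auto simp: y_def)
    next
      case (Suc k)
      have "y = (fR ^^ (k * \<kappa>)) ((fR ^^ \<kappa>) x)"
        unfolding y_def Suc using funpow_add[of "k * \<kappa>" \<kappa> fR] by (simp add: add.commute)
      then have "y \<in> {A..<B}" using inv'[OF x(2)] by simp
      then show ?thesis using A B by auto
    qed
    show ?thesis
    proof (cases "r = 0")
      case True
      then have "q > 0" using r(2) \<open>0 < n\<close> by (cases q) auto
      then have "y \<in> {A..<B}" using y by simp
      then show ?thesis using True D(2) eq by auto
    next
      case False
      then have "(fR ^^ n) x \<le> PL \<or> PR \<le> (fR ^^ n) x" using leave[of y r] y r(1) eq by simp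
      then show ?thesis using D(1) by auto
    qed
  qed
  show ?thesis
  proof (cases "PL < A")
    case True
    \<comment> \<open>\<open>l\<close> is the preimage of \<open>A\<close> under the affine return
      map fixing \<open>PL\<close>. It lies between \<open>PL\<close> and \<open>A\<close>, and
      everything between \<open>l\<close> and \<open>A\<close> is moved beyond
      \<open>A\<close>.\<close>
    define l where "l = PL + (A - PL) / \<Lambda>"
    have "(A - PL) / \<Lambda> < A - PL"
      using True \<Lambda>(1) mult_strict_left_mono[of 1 \<Lambda> "A - PL"] by (simp add: pos_divide_less_eq)
    then have l: "PL < l" "l < A" "PL + \<Lambda> * (l - PL) = A"
      using True \<Lambda>(1) by (simp_all add: l_def)
    have "(fR ^^ \<kappa>) x \<in> {A..<B}" if "x \<in> {l<..<A}" for x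
    proof -
      have "\<Lambda> * (l - PL) < \<Lambda> * (x - PL)" using \<Lambda>(1) that by simp
      then show ?thesis using \<Lambda>(3)[of x] left[of x] that l A_less by auto
    qed
    moreover have "{l<..<A} \<subseteq> {PL<..<PR}" "{l<..<A} \<inter> {A..<B} = {}" using l A_less PR(2)
      by auto
    ultimately show ?thesis using main[of "{l<..<A}"] l PL_pos A_less c_less
      by (intro exI[of _ l] exI[of _ A]) auto
  next
    case False
    then have "B < PR" using ne A B by auto
    define r where "r = PR - (PR - B) / \<Lambda>'"
    have "(PR - B) / \<Lambda>' < PR - B"
      using \<open>B < PR\<close> \<Lambda>'(1) mult_strict_left_mono[of 1 \<Lambda>' "PR - B"]
      by (simp add: pos_divide_less_eq)
    then have r: "B < r" "r < PR" "PR - \<Lambda>' * (PR - r) = B"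
      using \<open>B < PR\<close> \<Lambda>'(1) by (simp_all add: r_def)
    have "(fR ^^ \<kappa>) x \<in> {A..<B}" if "x \<in> {B<..<r}" for x
    proof -
      have "\<Lambda>' * (PR - r) < \<Lambda>' * (PR - x)" using \<Lambda>'(1) that by simp
      then show ?thesis using \<Lambda>'(3)[of x] right[of x] that r B_greater[OF PLc] by auto
    qed
    moreover have "{B<..<r} \<subseteq> {PL<..<PR}" "{B<..<r} \<inter> {A..<B} = {}"
      using r B_greater[OF PLc] PLc by auto
    ultimately show ?thesis using main[of "{B<..<r}"] r B_greater[OF PLc] c_pos PR_le
      by (intro exI[of _ B] exI[of _ r]) auto
  qed
qed

end

section \<open>Intervals contained in an invariant set\<close>

text \<open>\<open>F l r\<close> is to be read as: almost every point of \<open>(l, r)\<close> belongs to a fixed forward invariant set.\<close>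

locale lorenz_full = lorenz_map +
  fixes F :: "real \<Rightarrow> real \<Rightarrow> bool"
  assumes F_sub: "F l r \<Longrightarrow> l \<le> l' \<Longrightarrow> r' \<le> r \<Longrightarrow> F l' r'"
    and F_join: "F l m \<Longrightarrow> F m r \<Longrightarrow> F l r"
    and F_lim_right: "(\<And>r'. r' < r \<Longrightarrow> F l r') \<Longrightarrow> F l r"
    and F_lim_left: "(\<And>l'. l < l' \<Longrightarrow> F l' r) \<Longrightarrow> F l r"
    and F_image: "F l r \<Longrightarrow> 0 \<le> l \<Longrightarrow> l < r \<Longrightarrow> r \<le> 1 \<Longrightarrow> r \<le> c \<or> c \<le> l \<Longrightarrow>
      F (lorenz a b c l) (lorenzl a b c r)"
    and F_empty: "r \<le> l \<Longrightarrow> F l r"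
begin

lemma reflected_full: "lorenz_full b a (1 - c) (\<lambda>l r. F (1 - r) (1 - l))"
proof -
  interpret m: lorenz_map b a "1 - c" by (rule reflected)
  have R: "1 - lorenz b a (1 - c) x = lorenzl a b c (1 - x)" for x
    using lorenz_reflect[of b a c "1 - x"] by simp
  have L: "1 - lorenzl b a (1 - c) x = lorenz a b c (1 - x)" for x
    using lorenzl_reflect[of b a c "1 - x"] by simp
  show ?thesis
  proof unfold_locales
    fix l r :: real assume *: "\<And>r'. r' < r \<Longrightarrow> F (1 - r') (1 - l)"
    have "F l' (1 - l)" if "1 - r < l'" for l' using *[of "1 - l'"] that by simp
    then show "F (1 - r) (1 - l)" by (rule F_lim_left)
  next
    fix l r :: real assume *: "\<And>l'. l < l' \<Longrightarrow> F (1 - r) (1 - l')"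
    have "F (1 - r) r'" if "r' < 1 - l" for r' using *[of "1 - r'"] that by simp
    then show "F (1 - r) (1 - l)" by (rule F_lim_right)
  next
    fix l r assume "F (1 - r) (1 - l)" "0 \<le> l" "l < r" "r \<le> 1" "r \<le> 1 - c \<or> 1 - c \<le> l"
    then show "F (1 - m.fL r) (1 - m.fR l)"
      unfolding R L by (intro F_image) auto
  qed (auto intro: F_sub F_join F_empty)
qed

lemma F_uncut: "uncut n l r \<Longrightarrow> F l r \<Longrightarrow> 0 \<le> l \<Longrightarrow> l < r \<Longrightarrow> r \<le> 1 \<Longrightarrow> F ((fR ^^ n) l) ((fL ^^ n) r)"
proof (induction n)
  case (Suc n)
  have uncut: "uncut n l r" "(fL ^^ n) r \<le> c \<or> c \<le> (fR ^^ n) l" using Suc.prems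
    by (auto simp: uncut_Suc)
  show ?case
    using F_image[OF Suc.IH[OF uncut(1) Suc.prems(2-)]] uncut_less[OF uncut(1) Suc.prems(4)] uncut(2) Suc.prems
      funpow_fR_range[of l n] funpow_fL_range[of r n] by auto
qed simp

text \<open>Every step multiplies the length by \<Lambda> while the right end has not passed
  \<open>t\<close>; a single overshoot already covers the rest.\<close>

lemma F_expand_right:
  assumes "F p q" "p < q" "\<Lambda> > 1"
    and step: "\<And>q. p < q \<Longrightarrow> q \<le> t \<Longrightarrow> F p q \<Longrightarrow> F p (p + \<Lambda> * (q - p))"
  shows "F p t"
proof -
  have *: "F p t \<or> F p (p + \<Lambda> ^ n * (q - p))" for n
  proof (induction n)
    case (Suc n)
    have pos: "0 < \<Lambda> ^ n * (q - p)" using assms by simp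
    from Suc show ?case
    proof
      assume F: "F p (p + \<Lambda> ^ n * (q - p))"
      show ?case
      proof (cases "p + \<Lambda> ^ n * (q - p) \<le> t")
        case True
        then show ?thesis using step[OF _ True F] pos by (simp add: mult.assoc)
      next
        case False
        then show ?thesis using F_sub[OF F, of p t] by simp
      qed
    qed simp
  qed (use assms in simp)
  obtain n where "(t - p) / (q - p) < \<Lambda> ^ n" using real_arch_pow[OF assms(3)] by blast
  then have "t \<le> p + \<Lambda> ^ n * (q - p)" using assms(2) by (simp add: field_simps)
  then show ?thesis using *[of n] F_sub[of p _ p t] by auto
qed

lemma F_expand_left:
  assumes "F q p" "q < p" "\<Lambda> > 1"
    and step: "\<And>q. t \<le> q \<Longrightarrow> q < p \<Longrightarrow> F q p \<Longrightarrow> F (p - \<Lambda> * (p - q)) p"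
  shows "F t p"
proof -
  interpret m: lorenz_full b a "1 - c" "\<lambda>l r. F (1 - r) (1 - l)" by (rule reflected_full)
  have "F (1 - (1 - t)) (1 - (1 - p))"
  proof (rule m.F_expand_right[where p = "1 - p" and q = "1 - q" and \<Lambda> = \<Lambda> and t = "1 - t"])
    fix q' assume "1 - p < q'" "q' \<le> 1 - t" "F (1 - q') (1 - (1 - p))"
    then have "F (p - \<Lambda> * (p - (1 - q'))) p" by (intro step) auto
    then show "F (1 - (1 - p + \<Lambda> * (q' - (1 - p)))) (1 - (1 - p))" by (simp add: algebra_simps)
  qed (use assms(1-3) in simp_all)
  then show ?thesis by simp
qed

text \<open>If \<open>a * c = 1\<close>, then 0 is fixed and repelling, since
  \<open>a = 1 / c > 1\<close>. The right half at \<open>c\<close> is mapped next to 0, grows there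
  to \<open>(0, c)\<close>, and one more step covers everything. The other case is the mirror image
  at 1.\<close>

lemma F_unit_of_fixed_end:
  assumes "a * c = 1 \<or> b * (1 - c) = 1" and F: "F d c" "F c e" and d: "0 \<le> d" "d < c" and e: "c < e" "e \<le> 1"
  shows "F 0 1"
  using assms(1)
proof
  assume ac: "a * c = 1"
  have "a > 1" using ac c_pos c_less mult_less_cancel_right[of 1 c a] by auto
  have 0: "F 0 (fL e)" using F_image[OF F(2)] c_pos e by simp
  have "0 < fL e" using fL_range[of e] e c_pos by simp
  have "F 0 c"
  proof (rule F_expand_right[OF 0 \<open>0 < fL e\<close> \<open>a > 1\<close>])
    fix q assume "0 < q" "q \<le> c" "F 0 q"
    then show "F 0 (0 + a * (q - 0))"
      using F_image[of 0 q] c_less c_pos ac by (simp add: lorenz_def lorenzl_def)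
  qed
  from F_image[OF this] show ?thesis using c_pos c_less ac by (simp add: lorenz_def lorenzl_def)
next
  assume bc: "b * (1 - c) = 1"
  have "b > 1" using bc c_pos c_less mult_less_cancel_right[of 1 "1 - c" b] by auto
  have 0: "F (fR d) 1" using F_image[OF F(1)] c_less d by simp
  have "fR d < 1" using fR_range[of d] d c_less by simp
  have "F c 1"
  proof (rule F_expand_left[OF 0 \<open>fR d < 1\<close> \<open>b > 1\<close>])
    fix q assume "c \<le> q" "q < 1" "F q 1"
    then have "F (b * (q - c)) (b * (1 - c))"
      using F_image[of q 1] c_less c_pos by (simp add: lorenz_def lorenzl_def)
    moreover have "b * (q - c) = b * (1 - c) - b * (1 - q)" by (simp add: algebra_simps)
    ultimately show "F (1 - b * (1 - q)) 1" using bc by simp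
  qed
  from F_image[OF this] show ?thesis using c_pos c_less bc by (simp add: lorenz_def lorenzl_def)
qed

lemma F_left_nbhd:
  assumes "F (y - \<delta>) y" "\<delta> > 0" "0 < y" "y \<le> 1"
  shows "\<exists>\<delta>>0. F ((fL ^^ n) y - \<delta>) ((fL ^^ n) y)"
proof (induction n)
  case 0 then show ?case using assms by auto
next
  case (Suc n)
  define w where "w = (fL ^^ n) y"
  have w: "0 < w" "w \<le> 1" using funpow_fL_range[OF assms(3,4)] by (auto simp: w_def)
  obtain \<delta> where \<delta>: "\<delta> > 0" "F (w - \<delta>) w" using Suc by (auto simp: w_def)
  \<comment> \<open>The neighbourhood is shortened so that it lies on one branch and inside the unit
    interval.\<close>
  define l where "l = max (if w \<le> c then 0 else c) (w - \<delta>)"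
  have l: "0 \<le> l" "l < w" "w \<le> c \<or> c \<le> l" using w \<delta>(1) c_pos by (auto simp: l_def)
  have "F l w" using F_sub[OF \<delta>(2), of l w] by (simp add: l_def)
  from F_image[OF this l(1,2) w(2) l(3)] have "F (fL w - (fL w - fR l)) (fL w)" by simp
  moreover have "fR l < fL w" using uncut_less[of 1 l w] l by (simp add: uncut_def)
  ultimately show ?case unfolding w_def[symmetric] funpow.simps o_apply
    by (intro exI[of _ "fL w - fR l"]) simp
qed

lemma F_right_nbhd:
  assumes "F y (y + \<delta>)" "\<delta> > 0" "0 \<le> y" "y < 1"
  shows "\<exists>\<delta>>0. F ((fR ^^ n) y) ((fR ^^ n) y + \<delta>)"
proof -
  interpret m: lorenz_full b a "1 - c" "\<lambda>l r. F (1 - r) (1 - l)" by (rule reflected_full)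
  have "\<exists>\<delta>>0. F (1 - (m.fL ^^ n) (1 - y)) (1 - ((m.fL ^^ n) (1 - y) - \<delta>))"
    using assms by (intro m.F_left_nbhd[of _ \<delta>]) (auto simp: algebra_simps)
  then show ?thesis by (simp add: lorenzl_funpow_reflect algebra_simps)
qed

end

locale lorenz_full_orbit = lorenz_full + lorenz_orbit
begin

lemma F_expand_PR: assumes "F q PR" "q < PR" shows "F c PR"
proof -
  obtain \<Lambda> where \<Lambda>: "\<Lambda> > 1" "\<And>x. c \<le> x \<Longrightarrow> x < PR \<Longrightarrow> (fR ^^ \<kappa>) x = PR - \<Lambda> * (PR - x)"
    using return_right by metis
  show ?thesis
  proof (rule F_expand_left[OF assms \<Lambda>(1)])
    fix q assume q: "c \<le> q" "q < PR" "F q PR"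
    have "F ((fR ^^ \<kappa>) q) ((fL ^^ \<kappa>) PR)"
      using F_uncut[OF uncut_sub[OF uncut_PR q(1,2)] q(3)] q c_pos PR_le by simp
    then show "F (PR - \<Lambda> * (PR - q)) PR" using \<Lambda>(2)[OF q(1,2)] orb_periodic[OF PR(1)] by simp
  qed
qed

lemma F_expand_PL: assumes PLc: "PL < c" and "F PL q" "PL < q" shows "F PL c"
proof -
  obtain \<Lambda> where \<Lambda>: "\<Lambda> > 1" "\<And>x. aff \<kappa> PL x = PL + \<Lambda> * (x - PL)"
    using return_left[OF PLc] by metis
  show ?thesis
  proof (rule F_expand_right[OF assms(2,3) \<Lambda>(1)])
    fix q assume q: "PL < q" "q \<le> c" "F PL q"
    have "F ((fR ^^ \<kappa>) PL) ((fL ^^ \<kappa>) q)"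
      using F_uncut[OF uncut_sub[OF uncut_PL[OF PLc] order_refl q(1,2)] q(3)] q PL_pos c_less by simp
    moreover have "(fL ^^ \<kappa>) q = aff \<kappa> PL q" using uncut_aff[OF uncut_PL[OF PLc] PLc, of q] q
      by simp
    ultimately show "F PL (PL + \<Lambda> * (q - PL))"
      using \<Lambda>(2) orb_fR_eq[OF PLc PL(1)] orb_periodic[OF PL(1)] by simp
  qed
qed

text \<open>A full one-sided neighbourhood of \<open>PL\<close> or \<open>PR\<close> suffices, as it
  expands under the return map up to \<open>c\<close>. It is found in three ways. If
  \<open>PL = c\<close>, the left half at \<open>c\<close> follows the orbit to \<open>PR\<close>.
  If \<open>[A, B] = [PL, PR]\<close>, the two halves at \<open>c\<close> arrive there after
  \<kappa> steps. Otherwise a point of \<open>hit\<close> near \<open>c\<close> takes a two-sided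
  neighbourhood along, which reaches both.\<close>

lemma F_between:
  assumes cond: "A < PL \<or> PR < B \<or> A = PL \<and> B = PR"
    and F: "F d c" "F c e" and d: "0 \<le> d" "d < c" and e: "c < e" "e \<le> 1"
  shows "F PL c" "F c PR"
proof -
  have to_PR: "F c PR" if "F (y - \<delta>) y" "\<delta> > 0" "0 < y" "y \<le> 1" "(fL ^^ n) y = PR"
    for y \<delta> n
    using F_left_nbhd[OF that(1-4), of n] that(5) F_expand_PR by auto
  have to_PL: "F PL c"
    if "PL < c" "F y (y + \<delta>)" "\<delta> > 0" "0 \<le> y" "y < 1" "(fR ^^ n) y = PL" for y \<delta> n
    using F_right_nbhd[OF that(2-5), of n] that(6) F_expand_PL[OF that(1)] by auto
  have "F PL c \<and> F c PR"
  proof (cases "PL = c")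
    case True
    obtain k where "(fL ^^ k) PL = PR" using orb_transitive PL PR by blast
    then have "F c PR" using to_PR[of PL "c - d" k] True F(1) d c_pos c_less by simp
    then show ?thesis using True F_empty by simp
  next
    case False
    then have PLc: "PL < c" using PL(2) by simp
    consider "A < PL \<or> PR < B" | "A = PL" "B = PR" using cond by blast
    then show ?thesis
    proof cases
      case 1
      obtain x where x: "x \<in> hit" "c - min (c - d) (e - c) < x" "x < c + min (c - d) (e - c)"
        using hit_accumulates[OF PLc 1, of "min (c - d) (e - c)"] d e by auto
      have xde: "d < x" "x < e" using x(2,3) by auto
      obtain n where n: "(fR ^^ n) x \<in> orb" "\<And>i. i \<le> n \<Longrightarrow> (fR ^^ i) x \<noteq> c"
        using x(1) unfolding hit_def by blast
      define p where "p = (fR ^^ n) x"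
      have pL: "(fL ^^ n) x = p" using funpow_fL_eq_fR'[of n x] n(2) by (simp add: p_def)
      obtain k where k: "(fL ^^ k) p = PR" using orb_transitive[OF _ PR(1)] n(1) p_def by blast
      obtain l where l: "(fL ^^ l) p = PL" using orb_transitive[OF _ PL(1)] n(1) p_def by blast
      have lR: "(fR ^^ l) p = PL" using orb_fR_eq[OF PLc] n(1) l by (simp add: p_def)
      have Fde: "F d e" using F_join F by blast
      have "F c PR"
        using to_PR[of x "x - d" "k + n"] F_sub[OF Fde, of d x] xde d e k pL by (simp add: funpow_add)
      moreover have "F PL c"
        using to_PL[OF PLc, of x "e - x" "l + n"] F_sub[OF Fde, of x e] xde d e lR
        by (simp add: funpow_add p_def)
      ultimately show ?thesis by blast
    next
      case 2
      then show ?thesis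
        using to_PR[of c "c - d" \<kappa>] to_PL[OF PLc, of c "e - c" \<kappa>] F d e c_pos c_less
        by (simp add: A_def B_def)
    qed
  qed
  then show "F PL c" "F c PR" by auto
qed

text \<open>One of the two conjuncts always holds by \<open>F_empty\<close>. Written symmetrically,
  the relation is an equivalence without any distinction of order.\<close>

definition linked :: "real \<Rightarrow> real \<Rightarrow> bool" where
  "linked x y \<longleftrightarrow> F x y \<and> F y x"

lemma linked_refl: "linked x x" by (simp add: linked_def F_empty)
lemma linked_sym: "linked x y \<Longrightarrow> linked y x" by (simp add: linked_def)
lemma linked_trans: "linked x y \<Longrightarrow> linked y z \<Longrightarrow> linked x z"
  by (auto simp: linked_def intro: F_join)
lemma linkedI: "F x y \<Longrightarrow> x \<le> y \<Longrightarrow> linked x y"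
  by (simp add: linked_def F_empty)

lemma linked_between: "linked x z \<Longrightarrow> x \<le> y \<Longrightarrow> y \<le> z \<Longrightarrow> linked x y"
  unfolding linked_def using F_sub[of x z x y] F_empty by auto

lemma linked_right: "F l x \<Longrightarrow> F l y \<Longrightarrow> l \<le> x \<Longrightarrow> l \<le> y \<Longrightarrow> linked x y"
  unfolding linked_def using F_sub[of l x y x] F_sub[of l y x y] by auto

lemma linked_left: "F x r \<Longrightarrow> F y r \<Longrightarrow> x \<le> r \<Longrightarrow> y \<le> r \<Longrightarrow> linked x y"
  unfolding linked_def using F_sub[of x r x y] F_sub[of y r y x] by auto

definition covered :: "real \<Rightarrow> bool" where
  "covered x \<longleftrightarrow> (\<exists>p\<in>orb. linked p x)"

definition lo :: "real \<Rightarrow> real" where "lo p = Inf {x \<in> {0..1}. linked p x}"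
definition hi :: "real \<Rightarrow> real" where "hi p = Sup {x \<in> {0..1}. linked p x}"

text \<open>The class of \<open>p\<close> is convex by \<open>F_sub\<close> and closed by the two
  limit rules, so inside the unit interval it is exactly the interval from \<open>lo p\<close> to
  \<open>hi p\<close>.\<close>

lemma lo_hi:
  assumes "p \<in> orb"
  shows "0 \<le> lo p" "lo p \<le> p" "p \<le> hi p" "hi p \<le> 1"
    and linked_iff: "\<And>x. 0 \<le> x \<Longrightarrow> x \<le> 1 \<Longrightarrow> linked p x \<longleftrightarrow> lo p \<le> x \<and> x \<le> hi p"
proof -
  let ?S = "{x \<in> {0..1}. linked p x}"
  have pS: "p \<in> ?S" using orb_range[OF assms] linked_refl by auto
  have bdd: "bdd_above ?S" "bdd_below ?S" by (auto simp: bdd_above_def bdd_below_def)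
  show 1: "lo p \<le> p" "p \<le> hi p" unfolding lo_def hi_def using pS bdd
    by (auto intro: cInf_lower cSup_upper)
  show 2: "0 \<le> lo p" "hi p \<le> 1" unfolding lo_def hi_def using pS
    by (auto intro!: cInf_greatest cSup_least)
  have "F p (hi p)"
  proof (rule F_lim_right)
    fix r assume "r < hi p"
    then obtain x where "x \<in> ?S" "r < x" unfolding hi_def using less_cSupD[of ?S r] pS by auto
    then show "F p r" using F_sub[of p x p r] by (auto simp: linked_def)
  qed
  then have hi: "linked p (hi p)" using 1 by (intro linkedI)
  have "F (lo p) p"
  proof (rule F_lim_left)
    fix l assume "lo p < l"
    then obtain x where "x \<in> ?S" "x < l" unfolding lo_def using cInf_lessD[of ?S l] pS by auto
    then show "F l p" using F_sub[of x p l p] by (auto simp: linked_def)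
  qed
  then have lo: "linked (lo p) p" using 1 by (intro linkedI)
  show "linked p x \<longleftrightarrow> lo p \<le> x \<and> x \<le> hi p" if "0 \<le> x" "x \<le> 1" for x
  proof
    assume "linked p x"
    then show "lo p \<le> x \<and> x \<le> hi p" unfolding lo_def hi_def using that bdd
      by (auto intro: cInf_lower cSup_upper)
  next
    assume x: "lo p \<le> x \<and> x \<le> hi p"
    then have "linked (lo p) x" using linked_between[OF linked_trans[OF lo hi]] by blast
    then show "linked p x" using linked_trans[OF linked_sym[OF lo]] by blast
  qed
qed

lemma hi_cong: "linked p q \<Longrightarrow> hi p = hi q"
  unfolding hi_def by (metis linked_sym linked_trans)

text \<open>If \<open>x\<close> and \<open>p\<close> are on the same side of \<open>c\<close>, the
  full interval between them has a full image. If \<open>c\<close> separates them, only the part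
  between \<open>x\<close> and \<open>c\<close> is used: its image extends from \<open>fR x\<close>
  to 1 or from 0 to \<open>fR x\<close>. The images of \<open>(PL, c)\<close> and
  \<open>(c, PR)\<close> are full up to the same ends, so \<open>fR x\<close> is linked to the image
  of \<open>PL\<close> or of \<open>PR\<close>.\<close>

lemma covered_fR:
  assumes FPL: "F PL c" and FPR: "F c PR" and x: "0 \<le> x" "x \<le> 1" "x \<noteq> c" "covered x"
  shows "covered (fR x)"
proof -
  obtain p where p: "p \<in> orb" "F p x" "F x p" using x(4) by (auto simp: covered_def linked_def)
  have p01: "0 < p" "p \<le> 1" using orb_range[OF p(1)] by auto
  have q0: "F 0 (fL PR)" using F_image[OF FPR] PR c_pos PR_le by simp
  have q0': "0 \<le> fL PR" using fL_range[of PR] PR c_pos PR_le by simp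
  have q1: "F (fL PL) 1"
  proof (cases "PL = c")
    case False
    then have "PL < c" using PL(2) by simp
    then show ?thesis using F_image[OF FPL] PL_pos c_less fL_eq_fR[of PL] by simp
  qed (simp add: F_empty)
  have q1': "fL PL \<le> 1" using fL_range[of PL] PL PL_pos c_less by simp
  have fx: "fL x = fR x" "0 \<le> fR x" "fR x \<le> 1" using fL_eq_fR[OF x(3)] fR_range_closed x by auto
  have step: "linked (fR l) (fL r)" if "F l r" "0 \<le> l" "l < r" "r \<le> 1" "r \<le> c \<or> c \<le> l"
    for l r
    using F_image[OF that] uncut_less[of 1 l r] that by (intro linkedI) (auto simp: uncut_def)
  have pc: "fR p = fL p" if "p \<noteq> c" using fL_eq_fR[OF that] by simp
  have "\<exists>q\<in>orb. linked (fR x) q"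
  proof -
    consider "x = p" | "x < p" "p \<le> c \<or> c \<le> x" | "x < c" "c < p" | "p < x" "x < c \<or> c < p" | "p \<le> c" "c < x"
      using x(3) by linarith
    then show ?thesis
    proof cases
      case 1
      then show ?thesis using orb_fL[OF p(1)] fx linked_refl by metis
    next
      case 2
      then show ?thesis using step[of x p] p x p01 orb_fL[OF p(1)] by auto
    next
      case 3
      then have "F x c" using F_sub[OF p(3), of x c] by simp
      then have "F (fR x) 1" using F_image[of x c] 3 x c_less by simp
      then have "linked (fR x) (fL PL)" using linked_left q1 fx q1' by blast
      then show ?thesis using orb_fL[OF PL(1)] by blast
    next
      case 4
      then have "linked (fR p) (fL x)" using step[of p x] p x p01 by auto
      then have "linked (fR x) (fL p)" using pc 4 fx linked_sym by fastforce
      then show ?thesis using orb_fL[OF p(1)] by blast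
    next
      case 5
      then have "F c x" using F_sub[OF p(2), of c x] by simp
      then have "F 0 (fR x)" using F_image[of c x] 5 x c_pos fx by simp
      then have "linked (fR x) (fL PR)" using linked_right q0 fx q0' by blast
      then show ?thesis using orb_fL[OF PR(1)] by blast
    qed
  qed
  then show ?thesis by (auto simp: covered_def intro: linked_sym)
qed

lemma periodic_point_of_selfmap:
  assumes "finite E" "E \<noteq> {}" "g ` E \<subseteq> E"
  shows "\<exists>e\<in>E. \<exists>n>0. n \<le> card E \<and> (g ^^ n) e = e"
proof -
  obtain e0 where e0: "e0 \<in> E" using assms(2) by blast
  have in_E: "(g ^^ i) e0 \<in> E" for i by (induction i) (use e0 assms(3) in auto)
  have "\<not> inj_on (\<lambda>i. (g ^^ i) e0) {..card E}"
  proof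
    assume "inj_on (\<lambda>i. (g ^^ i) e0) {..card E}"
    then have "card {..card E} \<le> card E" using in_E assms(1) by (intro card_inj_on_le) auto
    then show False by simp
  qed
  then obtain i j where "i \<le> card E" "j \<le> card E" "i \<noteq> j" "(g ^^ i) e0 = (g ^^ j) e0"
    by (auto simp: inj_on_def)
  then obtain i j where ij: "j \<le> card E" "i < j" "(g ^^ i) e0 = (g ^^ j) e0"
    by (metis linorder_neqE_nat)
  have "(g ^^ (j - i)) ((g ^^ i) e0) = (g ^^ i) e0"
    using ij by (metis comp_apply funpow_add le_add_diff_inverse2 less_imp_le)
  then show ?thesis using ij in_E by (intro bexI[of _ "(g ^^ i) e0"] exI[of _ "j - i"]) auto
qed

text \<open>Every maximal gap between the full intervals around the points of the periodic orbit lies in the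
  image of another gap. There are fewer than \<open>\<kappa>\<close> gaps, so a cycle of gaps would contain a periodic
  point of period less than \<open>\<kappa>\<close>.\<close>

lemma F_unit:
  assumes FPL: "F PL c" and FPR: "F c PR" and Fd: "F d c" "0 \<le> d" "d < c"
  shows "F 0 1"
proof (rule ccontr)
  assume notF: "\<not> F 0 1"
  define q0 where "q0 = fL PR"
  define q1 where "q1 = fL PL"
  have q0: "q0 \<in> orb" "F 0 q0" using orb_fL[OF PR(1)] F_image[OF FPR] PR c_pos PR_le
    by (auto simp: q0_def)
  have q1: "q1 \<in> orb" "F q1 1"
  proof -
    show "q1 \<in> orb" using orb_fL[OF PL(1)] by (simp add: q1_def)
    show "F q1 1"
    proof (cases "PL = c")
      case False
      then have "PL < c" using PL(2) by simp
      then show ?thesis using F_image[OF FPL] PL_pos c_less fL_eq_fR[of PL] by (simp add: q1_def)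
    qed (simp add: F_empty q1_def)
  qed
  have "linked q0 0" using linked_sym[OF linkedI[OF q0(2)]] orb_range[OF q0(1)] by simp
  then have lo_q0: "lo q0 \<le> 0" using linked_iff[OF q0(1), of 0] by simp
  have "linked q1 1" using linkedI[OF q1(2)] orb_range[OF q1(1)] by simp
  then have hi_q1: "hi q1 = 1" using linked_iff[OF q1(1), of 1] lo_hi(4)[OF q1(1)] by simp
  \<comment> \<open>Gaps are labelled by their left ends. The class of \<open>q0\<close> reaches
    down to 0, so there is no gap in front of it. The class of \<open>q1\<close> reaches up to 1 and
    starts no gap; removing its upper end is what brings the number of gaps below \<kappa>.\<close>
  define E where "E = hi ` orb - {1}"
  have finE: "finite E" using finite_orb by (simp add: E_def)
  have cardE: "card E < \<kappa>"
  proof -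
    have "card E < card (hi ` orb)"
      unfolding E_def using hi_q1 q1(1) finite_orb by (intro psubset_card_mono) (auto simp: image_iff)
    also have "\<dots> \<le> \<kappa>" using card_image_le[OF finite_orb, of hi] card_orb by simp
    finally show ?thesis .
  qed
  have "hi q0 \<noteq> 1"
  proof
    assume "hi q0 = 1"
    then have "linked q0 1" using linked_iff[OF q0(1), of 1] lo_hi[OF q0(1)] orb_range[OF q0(1)] by auto
    then show False using notF F_join[OF q0(2)] by (simp add: linked_def)
  qed
  then have neE: "E \<noteq> {}" using q0(1) by (auto simp: E_def)
  define nx where "nx e = Min {lo q |q. q \<in> orb \<and> e < lo q}" for e
  have E: "0 < e \<and> e < 1 \<and> covered e \<and> e < nx e \<and> nx e \<le> 1 \<and> covered (nx e) \<and> (e < c \<longrightarrow> nx e < c) \<and> e \<noteq> c \<and>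
      (\<forall>y. e < y \<and> y < nx e \<longrightarrow> \<not> covered y) \<and> (\<forall>q\<in>orb. e < lo q \<longrightarrow> nx e \<le> lo q) \<and>
      (\<exists>q\<in>orb. nx e = lo q)"
    if eE: "e \<in> E" for e
  proof -
    obtain p where p: "p \<in> orb" "e = hi p" "e \<noteq> 1" using eE by (auto simp: E_def)
    have e: "0 < e" "e < 1" using lo_hi[OF p(1)] p orb_range[OF p(1)] by auto
    have pe: "linked p e" using linked_iff[OF p(1), of e] e lo_hi[OF p(1)] p(2) by simp
    have hi_e: "hi q = e" if "q \<in> orb" "lo q \<le> e" "e \<le> hi q" for q
    proof -
      have "linked q e" using linked_iff[OF that(1)] e that by simp
      from hi_cong[OF linked_trans[OF pe linked_sym[OF this]]] show ?thesis using p(2) by simp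
    qed
    have fin: "finite {lo q |q. q \<in> orb \<and> e < lo q}" using finite_orb by simp
    have "e < lo q1" using hi_e[OF q1(1)] hi_q1 e by force
    then have "{lo q |q. q \<in> orb \<and> e < lo q} \<noteq> {}" using q1(1) by blast
    then have "nx e \<in> {lo q |q. q \<in> orb \<and> e < lo q}" unfolding nx_def using fin
      by (intro Min_in) auto
    then obtain q where q: "q \<in> orb" "nx e = lo q" "e < nx e" by auto
    have qn: "linked q (nx e)" "nx e \<le> 1"
      using linked_iff[OF q(1), of "nx e"] lo_hi[OF q(1)] q(2) orb_range[OF q(1)] by auto
    have least: "nx e \<le> lo q" if "q \<in> orb" "e < lo q" for q
      unfolding nx_def using that fin by (intro Min_le) auto
    have unc: "\<not> covered y" if y: "e < y" "y < nx e" for y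
    proof
      assume "covered y"
      then obtain q' where q': "q' \<in> orb" "linked q' y" by (auto simp: covered_def)
      then have "lo q' \<le> y" "y \<le> hi q'" using linked_iff[OF q'(1), of y] y e qn by auto
      moreover then have "lo q' \<le> e" using least[OF q'(1)] y by force
      ultimately show False using hi_e[OF q'(1)] y by simp
    qed
    have cPR: "linked PR c" using linked_sym[OF linkedI[OF FPR]] PR(2) by simp
    \<comment> \<open>No gap touches \<open>c\<close>, which has full intervals on both sides,
      \<open>(d, c)\<close> and \<open>(c, PR)\<close>. So every gap lies on one branch.\<close>
    have "e \<noteq> c"
    proof
      assume "e = c"
      then have "linked p PR" using linked_trans[OF pe] linked_sym[OF cPR] by simp
      then have "hi PR = e" using hi_cong p(2) by simp
      then show False using lo_hi(3)[OF PR(1)] PR(2) \<open>e = c\<close> by simp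
    qed
    moreover have "nx e < c" if "e < c"
    proof (rule ccontr)
      assume "\<not> nx e < c"
      moreover have "covered c" using cPR PR(1) by (auto simp: covered_def)
      ultimately have "nx e = c" using unc[of c] that by force
      then have "linked q c" using qn(1) by simp
      then have "linked q d" by (rule linked_trans[OF _ linked_sym[OF linkedI[OF Fd(1)]]]) (use Fd in simp)
      then show False using linked_iff[OF q(1), of d] Fd c_less q(2) \<open>nx e = c\<close> by simp
    qed
    moreover have "covered e" "covered (nx e)" using p(1) pe q(1) qn by (auto simp: covered_def)
    ultimately show ?thesis using e q qn(2) unc least by (intro conjI allI impI ballI) auto
  qed
  have fR_mono: "fR x < fR y" if "x < y" "y < c \<or> c < x" for x y
    using that a_pos b_pos by (auto simp: lorenz_def)
  have "\<exists>e'\<in>E. fR e' \<le> e \<and> nx e \<le> fR (nx e')" if e: "e \<in> E" for e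
  proof -
    note Ee = E[OF e]
    define y where "y = (e + nx e) / 2"
    have y: "e < y" "y < nx e" "0 < y" "y < 1" using Ee by (auto simp: y_def)
    \<comment> \<open>The images of the two branches overlap, so the middle of a gap has a preimage
      other than \<open>c\<close>. By \<open>covered_fR\<close> it is not covered, so it lies in a
      gap. The ends of that gap are sent to covered points on either side of \<open>y\<close>, hence
      not into the gap of \<open>e\<close>.\<close>
    obtain x where x: "0 \<le> x" "x \<le> 1" "x \<noteq> c" "fR x = y"
    proof (cases "1 - a * c < y")
      case True
      have "0 < (1 - y) / a" "(1 - y) / a < c" using y a_pos True by (simp_all add: field_simps)
      moreover have "a * (c - (1 - y) / a) + 1 - a * c = y" using a_pos by (simp add: field_simps)
      ultimately show thesis using c_less by (intro that[of "c - (1 - y) / a"]) (auto simp: lorenz_def)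
    next
      case False
      then have "y < b * (1 - c)" using overlap by simp
      then have "0 < y / b" "y / b < 1 - c" using y b_pos by (simp_all add: field_simps)
      then show thesis using b_pos c_pos by (intro that[of "c + y / b"]) (auto simp: lorenz_def)
    qed
    have "\<not> covered y" using Ee y by blast
    then have ncov: "\<not> covered x" using covered_fR[OF FPL FPR x(1-3)] x(4) by blast
    have split: "x < lo q \<or> hi q < x" if "q \<in> orb" for q
      using linked_iff[OF that x(1,2)] ncov that unfolding covered_def by force
    define e' where "e' = Max {hi q |q. q \<in> orb \<and> hi q < x}"
    have fin: "finite {hi q |q. q \<in> orb \<and> hi q < x}" using finite_orb by simp
    have "hi q0 < x" using split[OF q0(1)] lo_q0 x(1) by simp
    then have "{hi q |q. q \<in> orb \<and> hi q < x} \<noteq> {}" using q0(1) by blast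
    then have "e' \<in> {hi q |q. q \<in> orb \<and> hi q < x}" unfolding e'_def using fin
      by (intro Max_in) auto
    then have e': "e' \<in> hi ` orb" "e' < x" by auto
    then have e'E: "e' \<in> E" using x(2) by (auto simp: E_def)
    have e'_max: "hi q \<le> e'" if "q \<in> orb" "hi q < x" for q
      unfolding e'_def using that fin by (intro Max_ge) auto
    note Ee' = E[OF e'E]
    obtain q where q: "q \<in> orb" "nx e' = lo q" using Ee' by blast
    have "x < nx e'"
    proof (rule ccontr)
      assume "\<not> x < nx e'"
      then have "hi q \<le> e'" using split[OF q(1)] e'_max[OF q(1)] q(2) by auto
      then show False using lo_hi[OF q(1)] q(2) Ee' by simp
    qed
    have side: "nx e' < c \<or> c < e'" using Ee' by linarith
    have nxc: "nx e' \<noteq> c" using side Ee' by auto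
    have lt: "fR e' < y" "y < fR (nx e')"
      using fR_mono[OF e'(2)] fR_mono[OF \<open>x < nx e'\<close>] side \<open>x < nx e'\<close> e'(2) x(4)
      by auto
    have cov: "covered (fR e')" "covered (fR (nx e'))"
      using covered_fR[OF FPL FPR, of e'] covered_fR[OF FPL FPR, of "nx e'"] Ee' nxc by auto
    have "\<not> e < fR e'" "\<not> fR (nx e') < nx e"
      using Ee cov lt y by (meson less_trans)+
    then show ?thesis using e'E by (intro bexI[of _ e']) auto
  qed
  then obtain g where g: "\<And>e. e \<in> E \<Longrightarrow> g e \<in> E \<and> fR (g e) \<le> e \<and> nx e \<le> fR (nx (g e))" by metis
  have "g ` E \<subseteq> E" using g by blast
  then obtain e n where en: "e \<in> E" "n > 0" "n \<le> card E" "(g ^^ n) e = e"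
    using periodic_point_of_selfmap[OF finE neE] by blast
  \<comment> \<open>\<open>g\<close> leads from a gap to one whose image contains it. Read
    backwards, its cycle is a chain of boxes each of which is mapped over the next.\<close>
  define p where "p i = (g ^^ (n - i)) e" for i
  have gE: "(g ^^ i) e \<in> E" for i by (induction i) (use en g in auto)
  have pE: "p i \<in> E" for i unfolding p_def by (rule gE)
  have "\<exists>l r. pulls_back n p (\<lambda>i. nx (p i)) l r"
  proof (rule ex_pulls_back)
    fix i assume "i < n"
    then have "p i = g (p (Suc i))" unfolding p_def by (metis Suc_diff_Suc comp_apply funpow.simps(2))
    then show "p i \<le> nx (p i) \<and> (nx (p i) < c \<or> c < p i) \<and> fR (p i) \<le> p (Suc i) \<and> nx (p (Suc i)) \<le> fR (nx (p i))"
      using E[OF pE[of i]] g[OF pE[of "Suc i"]] by force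
  next
    show "p n \<le> nx (p n)" using E[OF pE[of n]] by simp
  qed
  then obtain l r where pb: "pulls_back n p (\<lambda>i. nx (p i)) l r" by blast
  have p0: "p 0 = e" "p n = e" using en by (auto simp: p_def)
  have lr: "e \<le> l" "l \<le> r" "r \<le> nx e" "(fR ^^ n) l = e" "(fR ^^ n) r = nx e"
    using pb p0 by (auto simp: pulls_back_def)
  have stay: "(fR ^^ i) z \<in> {p i..nx (p i)}" if "z \<in> {l..r}" "i < n" for z i
    using pb that unfolding pulls_back_def by blast
  have "l \<noteq> r" using lr E[OF en(1)] by auto
  then have "l < r" using lr by simp
  have rc: "(fR ^^ i) r \<noteq> c" if "i < n" for i
    using stay[of r i] that lr E[OF pE[of i]] by force
  have rL: "(fL ^^ i) r = (fR ^^ i) r" if "i \<le> n" for i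
    by (rule funpow_fL_eq_fR') (use that rc in auto)
  have "uncut n l r" unfolding uncut_def
  proof (intro allI impI)
    fix i assume "i < n"
    then have "(fR ^^ i) r \<le> nx (p i)" "p i \<le> (fR ^^ i) l" using stay[of r i] stay[of l i] lr by auto
    then show "(fL ^^ i) r \<le> c \<or> c \<le> (fR ^^ i) l"
      using rL[of i] \<open>i < n\<close> E[OF pE[of i]] by auto
  qed
  then have "\<exists>z. has_period a b c n z"
    using lr \<open>l < r\<close> rL[of n] en E[OF en(1)] by (intro has_period_crossing[of n l r]) auto
  then show False using no_short_period[of n] en cardE by auto
qed

end

context lorenz_map
begin

section \<open>Sums of reciprocal slopes\<close>

text \<open>The value at every point of \<open>(l, r)\<close> is the sum, over the pieces into which \<open>(l, r)\<close> is cut under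
  \<open>n\<close> iterations, of the reciprocals of the slopes.\<close>

primrec weight :: "nat \<Rightarrow> real \<Rightarrow> real \<Rightarrow> real" where
  "weight 0 = (\<lambda>l r. 1)"
| "weight (Suc n) = (\<lambda>l r. if r \<le> c then weight n (fR l) (fL r) / a else if c \<le> l then weight n (fR l) (fL r) / b
     else weight n (fR l) 1 / a + weight n 0 (fL r) / b)"

lemma weight_Suc_left: "r \<le> c \<Longrightarrow> weight (Suc n) l r = weight n (fR l) (fL r) / a"
  and weight_Suc_right: "l < r \<Longrightarrow> c \<le> l \<Longrightarrow> weight (Suc n) l r = weight n (fR l) (fL r) / b"
  and weight_Suc_cut: "l < c \<Longrightarrow> c < r \<Longrightarrow> weight (Suc n) l r = weight n (fR l) 1 / a + weight n 0 (fL r) / b"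
  by auto

lemma unit_image:
  assumes "0 \<le> l" "l < r" "r \<le> 1" "r \<le> c \<or> c \<le> l"
  shows "0 \<le> fR l" "fR l < fL r" "fL r \<le> 1" "fL r - fR l = sl l * (r - l)"
  using fR_range[of l] fL_range[of r] uncut_less[of 1 l r] uncut_length[of 1 l r] assms
  by (auto simp: uncut_def slope_def)

text \<open>After \<open>q\<close> steps each piece is its original length times a slope. The bound
  \<open>A + C * length\<close> for it is divided by that slope again: the first term gives
  \<open>A\<close> times the weight, the second the original lengths, which add up to
  \<open>r - l\<close>. So the constant \<open>C\<close> does not grow.\<close>

lemma weight_compose:
  assumes "\<And>l r. 0 \<le> l \<Longrightarrow> l < r \<Longrightarrow> r \<le> 1 \<Longrightarrow> weight n l r \<le> A + C * (r - l)"
    and "0 \<le> l" "l < r" "r \<le> 1"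
  shows "weight (q + n) l r \<le> A * weight q l r + C * (r - l)"
  using assms(2-)
proof (induction q arbitrary: l r)
  case 0
  then show ?case using assms(1) by simp
next
  case (Suc q)
  have part: "weight (q + n) (fR l') (fL r') / sl l' \<le> A * (weight q (fR l') (fL r') / sl l') + C * (r' - l')"
    if lr: "0 \<le> l'" "l' < r'" "r' \<le> 1" "r' \<le> c \<or> c \<le> l'" for l' r'
  proof -
    note im = unit_image[OF lr]
    have "weight (q + n) (fR l') (fL r') \<le> A * weight q (fR l') (fL r') + C * (sl l' * (r' - l'))"
      using Suc.IH[OF im(1-3)] im(4) by simp
    then have "weight (q + n) (fR l') (fL r') / sl l' \<le>
        (A * weight q (fR l') (fL r') + C * (sl l' * (r' - l'))) / sl l'"
      by (intro divide_right_mono) (auto intro: less_imp_le)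
    then show ?thesis using less_imp_neq[OF sl_pos[of l']] by (simp add: add_divide_distrib)
  qed
  consider "r \<le> c" | "c \<le> l" | "l < c" "c < r" by linarith
  then show ?case
  proof cases
    case 1
    then show ?thesis using part[of l r] Suc.prems unfolding add_Suc weight_Suc_left[OF 1]
      by (simp add: sl_def)
  next
    case 2
    then show ?thesis using part[of l r] Suc.prems
      unfolding add_Suc weight_Suc_right[OF Suc.prems(2) 2] by (simp add: sl_def)
  next
    case 3
    then show ?thesis using part[of l c] part[of c r] Suc.prems c_pos c_less
      unfolding add_Suc weight_Suc_cut[OF 3] by (simp add: algebra_simps sl_def)
  qed
qed

text \<open>A further cut at \<open>z\<close> counts at most one piece twice.\<close>

lemma weight_subadditive: "l < z \<Longrightarrow> z < r \<Longrightarrow> weight n l r \<le> weight n l z + weight n z r"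
proof (induction n arbitrary: l z r)
  case (Suc n)
  have mono: "fR x < fL y" if "x < y" "y \<le> c \<or> c \<le> x" for x y
    using uncut_less[of 1 x y] that by (simp add: uncut_def)
  have div: "x / s \<le> y / s + y' / s" if "x \<le> y + y'" "s > 0" for x y y' s :: real
    using divide_right_mono[OF that(1), of s] that(2) by (simp add: add_divide_distrib)
  consider "z = c" | "r \<le> c" | "c \<le> l" | "l < c" "z < c" "c < r" | "l < c" "c < z" "c < r"
    using Suc.prems by linarith
  then show ?case
  proof cases
    case 1
    then show ?thesis using Suc.prems unfolding 1
      by (simp add: weight_Suc_cut weight_Suc_left weight_Suc_right)
  next
    case 2
    then have "weight n (fR l) (fL r) \<le> weight n (fR l) (fR z) + weight n (fR z) (fL r)"
      using mono[of l z] mono[of z r] Suc.prems fL_eq_fR[of z] by (intro Suc.IH) auto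
    from div[OF this a_pos] show ?thesis
      using 2 Suc.prems fL_eq_fR[of z] by (simp add: weight_Suc_left del: weight.simps)
  next
    case 3
    then have "weight n (fR l) (fL r) \<le> weight n (fR l) (fR z) + weight n (fR z) (fL r)"
      using mono[of l z] mono[of z r] Suc.prems fL_eq_fR[of z] by (intro Suc.IH) auto
    from div[OF this b_pos] show ?thesis
      using 3 Suc.prems fL_eq_fR[of z] by (simp add: weight_Suc_right del: weight.simps)
  next
    case 4
    then have "weight n (fR l) 1 \<le> weight n (fR l) (fR z) + weight n (fR z) 1"
      using mono[of l z] mono[of z c] Suc.prems fL_eq_fR[of z] by (intro Suc.IH) auto
    from div[OF this a_pos] show ?thesis
      using 4 Suc.prems fL_eq_fR[of z] by (simp add: weight_Suc_left weight_Suc_cut del: weight.simps)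
  next
    case 5
    then have "weight n 0 (fL r) \<le> weight n 0 (fR z) + weight n (fR z) (fL r)"
      using mono[of c z] mono[of z r] Suc.prems fL_eq_fR[of z] by (intro Suc.IH) auto
    from div[OF this b_pos] show ?thesis
      using 5 Suc.prems fL_eq_fR[of z] by (simp add: weight_Suc_right weight_Suc_cut del: weight.simps)
  qed
qed simp

lemma weight_uncut: "uncut n l r \<Longrightarrow> l < r \<Longrightarrow> weight n l r = 1 / slope n l"
proof (induction n arbitrary: l r)
  case (Suc n)
  have uncut: "r \<le> c \<or> c \<le> l" "uncut n (fR l) (fL r)" using Suc.prems
    by (auto simp: uncut_Suc_shift)
  have "fR l < fL r" using uncut_less[of 1 l r] Suc.prems uncut by (simp add: uncut_def)
  then have "weight n (fR l) (fL r) = 1 / slope n (fR l)" by (rule Suc.IH[OF uncut(2)])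
  then show ?case
    using uncut(1) Suc.prems
    by (auto simp: weight_Suc_left weight_Suc_right slope_Suc_shift sl_def simp del: weight.simps)
qed simp

lemma weight_le_power: "weight n l r \<le> (1 / a + 1 / b) ^ n"
proof (induction n arbitrary: l r)
  case (Suc n)
  have pos: "0 \<le> (1 / a + 1 / b) ^ n" using a_pos b_pos by simp
  have 1: "weight n x y / a \<le> (1 / a + 1 / b) ^ n / a" "weight n x y / b \<le> (1 / a + 1 / b) ^ n / b"
    for x y
    using Suc.IH[of x y] a_pos b_pos by (auto intro: divide_right_mono)
  have 2: "0 \<le> (1 / a + 1 / b) ^ n / a" "0 \<le> (1 / a + 1 / b) ^ n / b" using pos a_pos b_pos by auto
  have "(1 / a + 1 / b) ^ Suc n = (1 / a + 1 / b) ^ n / a + (1 / a + 1 / b) ^ n / b"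
    by (simp add: algebra_simps)
  moreover have "weight (Suc n) l r \<le> (1 / a + 1 / b) ^ n / a + (1 / a + 1 / b) ^ n / b"
    using 1[of "fR l" "fL r"] 1(1)[of "fR l" 1] 1(2)[of 0 "fL r"] 2 by auto
  ultimately show ?case by linarith
qed simp

lemma uncut_left_nbhd: "\<exists>x<y. uncut n x y"
proof (induction n)
  case 0
  show ?case by (intro exI[of _ "y - 1"]) simp
next
  case (Suc n)
  then obtain x where x: "x < y" "uncut n x y" by blast
  show ?case
  proof (cases "(fL ^^ n) y \<le> c")
    case True
    then show ?thesis using x by (auto simp: uncut_Suc)
  next
    case False
    \<comment> \<open>The image must not extend from its right end back beyond \<open>c\<close>;
      dividing that distance by the slope gives the admissible length.\<close>
    define x' where "x' = max x (y - ((fL ^^ n) y - c) / slope n x)"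
    have x': "x \<le> x'" "x' < y" using x False by (auto simp: x'_def)
    have "slope n x * (y - x') \<le> (fL ^^ n) y - c"
    proof -
      have "y - x' \<le> ((fL ^^ n) y - c) / slope n x" by (simp add: x'_def)
      then show ?thesis using slope_pos[of n x] by (simp add: pos_le_divide_eq mult.commute)
    qed
    moreover have "(fR ^^ n) x' = (fL ^^ n) y - slope n x * (y - x')"
      using uncut_aff[OF x(2,1), of x'] x' uncut_right_end[OF x(2,1)] by (simp add: aff_def algebra_simps)
    ultimately have "c \<le> (fR ^^ n) x'" by simp
    then show ?thesis using uncut_sub[OF x(2) x'] x' by (auto simp: uncut_Suc)
  qed
qed

lemma uncut_right_nbhd: "\<exists>y>x. uncut n x y"
proof -
  interpret m: lorenz_map b a "1 - c" by (rule reflected)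
  obtain x' where "x' < 1 - x" "m.uncut n x' (1 - x)" using m.uncut_left_nbhd by blast
  then show ?thesis using uncut_reflect[of n "1 - x'" x] by (intro exI[of _ "1 - x'"]) auto
qed

text \<open>An interval containing \<open>c\<close> is cut at once, but its two halves are one-sided
  neighbourhoods of \<open>c\<close> and, if short, stay uncut for the remaining time. An interval
  on one side of \<open>c\<close> is passed to the induction hypothesis after one step.\<close>

lemma short_cut_once:
  "\<exists>\<delta>>0. \<forall>l r. l < r \<and> r - l < \<delta> \<longrightarrow> uncut n l r \<or> (\<exists>z. l < z \<and> z < r \<and> uncut n l z \<and> uncut n z r)"
proof (induction n)
  case 0
  show ?case by (intro exI[of _ 1]) simp
next
  case (Suc n)
  then obtain \<delta> where \<delta>: "\<delta> > 0"
    "\<And>l r. l < r \<Longrightarrow> r - l < \<delta> \<Longrightarrow> uncut n l r \<or> (\<exists>z. l < z \<and> z < r \<and> uncut n l z \<and> uncut n z r)" by blast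
  obtain x where x: "x < c" "uncut (Suc n) x c" using uncut_left_nbhd by blast
  obtain y where y: "c < y" "uncut (Suc n) c y" using uncut_right_nbhd by blast
  \<comment> \<open>\<open>a + b\<close> bounds both slopes, so the image is shorter than \<delta>;
    the other two terms keep the halves of a cut interval inside \<open>(x, c)\<close> and
    \<open>(c, y)\<close>.\<close>
  define \<epsilon> where "\<epsilon> = min (\<delta> / (a + b)) (min (c - x) (y - c))"
  have "\<epsilon> > 0" using \<delta> x y a_pos b_pos by (simp add: \<epsilon>_def)
  moreover have "uncut (Suc n) l r \<or> (\<exists>z. l < z \<and> z < r \<and> uncut (Suc n) l z \<and> uncut (Suc n) z r)"
    if lr: "l < r" "r - l < \<epsilon>" for l r
  proof (cases "l < c \<and> c < r")
    case True
    then have "uncut (Suc n) l c" "uncut (Suc n) c r"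
      using lr uncut_sub[OF x(2), of l c] uncut_sub[OF y(2), of c r] by (auto simp: \<epsilon>_def)
    then show ?thesis using True by blast
  next
    case False
    then have side: "r \<le> c \<or> c \<le> l" by auto
    have len: "fL r - fR l = sl l * (r - l)"
      using uncut_length[of 1 l r] side lr by (simp add: uncut_def slope_def)
    have "sl l * (r - l) \<le> (a + b) * (r - l)"
      using lr a_pos b_pos by (intro mult_right_mono) (auto simp: sl_def)
    also have "\<dots> < \<delta>" using lr a_pos b_pos by (simp add: \<epsilon>_def field_simps)
    finally have "fL r - fR l < \<delta>" using len by simp
    moreover have "fR l < fL r" using uncut_less[of 1 l r] side lr by (simp add: uncut_def)
    ultimately consider "uncut n (fR l) (fL r)"
      | w where "fR l < w" "w < fL r" "uncut n (fR l) w" "uncut n w (fL r)" using \<delta>(2) by blast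
    then show ?thesis
    proof cases
      case 1
      then show ?thesis using side by (simp add: uncut_Suc_shift)
    next
      case 2
      define z where "z = l + (w - fR l) / sl l"
      have "0 < (w - fR l) / sl l" using 2 by simp
      moreover have "(w - fR l) / sl l < r - l"
      proof -
        have "w - fR l < sl l * (r - l)" using 2 len by linarith
        then show ?thesis using sl_pos[of l] by (simp add: pos_divide_less_eq mult.commute)
      qed
      ultimately have z: "l < z" "z < r" by (auto simp: z_def)
      have "fR z = w" using aff_Suc(1)[of r l z] side z less_imp_neq[OF sl_pos[of l]] by (simp add: z_def)
      moreover have "fL z = fR z" using side z by (intro fL_eq_fR) auto
      ultimately show ?thesis using z side 2 by (intro disjI2 exI[of _ z]) (auto simp: uncut_Suc_shift)
    qed
  qed
  ultimately show ?case by blast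
qed

text \<open>One block of \<open>q\<close> steps has slopes at least 3. A short interval breaks into
  at most two uncut pieces, of weight at most 2/3 together; on a long interval the crude bound
  \<open>K\<close> is at most a multiple of the length. \<open>weight_compose\<close> iterates this.
  The result has the shape of a Lasota-Yorke inequality.\<close>

lemma weight_decay:
  "\<exists>q C. C > 0 \<and> (\<forall>j l r. 0 \<le> l \<longrightarrow> l < r \<longrightarrow> r \<le> 1 \<longrightarrow> weight (j * q) l r \<le> (2 / 3) ^ j + C * (r - l))"
proof -
  obtain q where q: "\<forall>x y. uncut q x y \<longrightarrow> 0 \<le> x \<longrightarrow> x < y \<longrightarrow> y \<le> 1 \<longrightarrow> 3 \<le> slope q x"
    using large_slopes[of 3] by blast
  obtain \<delta> where \<delta>: "\<delta> > 0"
    "\<And>l r. l < r \<Longrightarrow> r - l < \<delta> \<Longrightarrow> uncut q l r \<or> (\<exists>z. l < z \<and> z < r \<and> uncut q l z \<and> uncut q z r)"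
    using short_cut_once[of q] by blast
  define K where "K = (1 / a + 1 / b) ^ q"
  define D where "D = K / \<delta>"
  have "K > 0" using a_pos b_pos by (simp add: K_def add_pos_pos)
  then have "D > 0" using \<delta> by (simp add: D_def)
  have third: "weight q l r \<le> 1 / 3" if "uncut q l r" "0 \<le> l" "l < r" "r \<le> 1" for l r
  proof -
    have "3 \<le> slope q l" using q that by blast
    then have "1 / slope q l \<le> 1 / 3" by (intro divide_left_mono) auto
    then show ?thesis using weight_uncut[OF that(1,3)] by simp
  qed
  have step: "weight q l r \<le> 2 / 3 + D * (r - l)" if lr: "0 \<le> l" "l < r" "r \<le> 1" for l r
  proof (cases "r - l < \<delta>")
    case True
    have "weight q l r \<le> 2 / 3"
      using \<delta>(2)[OF lr(2) True]
    proof
      assume "uncut q l r" then show ?thesis using third lr by fastforce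
    next
      assume "\<exists>z. l < z \<and> z < r \<and> uncut q l z \<and> uncut q z r"
      then obtain z where z: "l < z" "z < r" "uncut q l z" "uncut q z r" by blast
      then show ?thesis using weight_subadditive[OF z(1,2), of q] third[OF z(3)] third[OF z(4)] lr by auto
    qed
    then show ?thesis using \<open>D > 0\<close> lr by (smt (verit) mult_pos_pos)
  next
    case False
    have "K = D * \<delta>" using \<delta> by (simp add: D_def)
    also have "\<dots> \<le> D * (r - l)" using False \<open>D > 0\<close> by simp
    finally show ?thesis using weight_le_power[of q l r] by (simp add: K_def)
  qed
  \<comment> \<open>\<open>3 * (1 - (2 / 3) ^ j)\<close> is the geometric sum of
    \<open>(2 / 3) ^ i\<close> over \<open>i < j\<close>.\<close>
  have main: "weight (j * q) l r \<le> (2 / 3) ^ j + 3 * D * (1 - (2 / 3) ^ j) * (r - l)"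
    if "0 \<le> l" "l < r" "r \<le> 1" for j l r
    using that
  proof (induction j arbitrary: l r)
    case (Suc j)
    have "weight (q + j * q) l r \<le> (2 / 3) ^ j * weight q l r + 3 * D * (1 - (2 / 3) ^ j) * (r - l)"
      by (rule weight_compose[OF Suc.IH Suc.prems])
    also have "(2 / 3) ^ j * weight q l r \<le> (2 / 3) ^ j * (2 / 3 + D * (r - l))"
      using step[OF Suc.prems] by (intro mult_left_mono) auto
    finally show ?case by (simp add: algebra_simps)
  qed simp
  have "weight (j * q) l r \<le> (2 / 3) ^ j + 3 * D * (r - l)" if lr: "0 \<le> l" "l < r" "r \<le> 1"
    for j l r
  proof -
    have "3 * D * (1 - (2 / 3) ^ j) * (r - l) \<le> 3 * D * 1 * (r - l)"
      using \<open>D > 0\<close> lr by (intro mult_right_mono mult_left_mono) auto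
    then show ?thesis using main[OF lr, of j] by simp
  qed
  then show ?thesis using \<open>D > 0\<close> by (intro exI[of _ q] exI[of _ "3 * D"]) simp
qed

end

section \<open>Invariant sets of positive measure contain intervals\<close>

lemma fmeasurable_unit: "X \<in> sets borel \<Longrightarrow> X \<subseteq> {0..1} \<Longrightarrow> X \<in> fmeasurable lborel" for X :: "real set"
  by (rule fmeasurableI2[of "{0..1}"]) (auto intro: fmeasurableI)

lemma measure_unit_mono:
  "X \<subseteq> Y \<Longrightarrow> X \<in> sets borel \<Longrightarrow> Y \<in> sets borel \<Longrightarrow> Y \<subseteq> {0..1} \<Longrightarrow> measure lborel X \<le> measure lborel Y"
  for X :: "real set"
  by (intro measure_mono_fmeasurable fmeasurable_unit) auto

lemma measure_affine_vimage:
  fixes s t :: real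
  assumes "s > 0" "V \<in> sets borel"
  shows "measure lborel {x. t + s * x \<in> V} = measure lborel V / s"
proof -
  have "emeasure lborel V = ennreal s * emeasure lborel ((\<lambda>x. t + s * x) -` V)"
    using assms by (subst lborel_real_affine[of s t])
      (simp_all add: emeasure_density nn_integral_cmult emeasure_distr)
  then have "measure lborel V = s * measure lborel {x. t + s * x \<in> V}"
    using assms(1) by (simp add: measure_def vimage_def enn2real_mult)
  then show ?thesis using assms(1) by simp
qed

text \<open>A quantitative form of the Lebesgue density theorem. A compact part \<open>K\<close> of
  almost full measure is covered, up to finitely many points, by grid cells whose total length
  hardly exceeds that of \<open>K\<close>; yet in every cell the fraction \<epsilon> is
  missing.\<close>

lemma null_of_gaps_in_all_intervals:
  fixes S :: "real set"
  assumes S: "S \<in> sets borel" "S \<subseteq> {0..1}" and "\<epsilon> > 0"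
    and thin: "\<And>l r. 0 \<le> l \<Longrightarrow> l < r \<Longrightarrow> r \<le> 1 \<Longrightarrow> \<epsilon> * (r - l) \<le> measure lborel ({l<..<r} - S)"
  shows "measure lborel S = 0"
proof (rule ccontr)
  define s where "s = measure lborel S"
  assume "measure lborel S \<noteq> 0"
  then have "s > 0" by (simp add: s_def zero_less_measure_iff)
  have "\<epsilon> \<le> 1"
  proof -
    have "measure lborel ({0<..<1} - S) \<le> measure lborel {0<..<1::real}"
      using S by (intro measure_unit_mono) auto
    then show ?thesis using thin[of 0 1] by simp
  qed
  \<comment> \<open>The final estimate reads \<open>\<epsilon> * s \<le> e\<close>, so the error
    \<open>e\<close> has to be smaller than \<open>\<epsilon> * s\<close>.\<close>
  define e where "e = \<epsilon> * s / 4"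
  have "e > 0" using \<open>s > 0\<close> \<open>\<epsilon> > 0\<close> by (simp add: e_def)
  have "\<epsilon> * s \<le> 1 * s" using \<open>\<epsilon> \<le> 1\<close> \<open>s > 0\<close>
    by (intro mult_right_mono) auto
  then have "e \<le> s / 4" by (simp add: e_def)
  have "S \<in> sets lebesgue" using S(1) by simp
  then obtain K where K: "closed K" "K \<subseteq> S" "S - K \<in> lmeasurable" "emeasure lebesgue (S - K) < ennreal e"
    using sets_lebesgue_inner_closed \<open>e > 0\<close> by blast
  have Kb: "K \<in> sets borel" "K \<subseteq> {0..1}" using K S by auto
  have "bounded K" using Kb(2) bounded_subset[of "{0..1::real}"] by auto
  then have "compact K" using K(1) compact_eq_bounded_closed by blast
  have "K \<in> sets lebesgue" using Kb(1) by simp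
  then obtain U where U: "open U" "K \<subseteq> U" "U - K \<in> lmeasurable" "emeasure lebesgue (U - K) < ennreal e"
    using sets_lebesgue_outer_open \<open>e > 0\<close> by blast
  have Kf: "K \<in> fmeasurable lborel" using Kb fmeasurable_unit by auto
  have UKf: "U - K \<in> fmeasurable lborel"
    using U(1,4) Kb(1) by (intro fmeasurableI) (auto simp: less_top[symmetric] intro: order.strict_trans)
  have SKf: "S - K \<in> fmeasurable lborel" using Kb S by (intro fmeasurable_unit) auto
  have mUK: "measure lborel (U - K) < e" and mSK: "measure lborel (S - K) < e"
    using U(1,4) K(4) Kb(1) S(1) emeasure_eq_measure2[OF UKf] emeasure_eq_measure2[OF SKf]
    by (simp_all add: ennreal_less_iff)
  have UK: "U = K \<union> (U - K)" and SK: "S = K \<union> (S - K)" using U(2) K(2) by auto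
  have Uf: "U \<in> fmeasurable lborel" using fmeasurable.Un[OF Kf UKf] UK by simp
  have mU: "measure lborel U \<le> measure lborel K + e"
    using measure_Un_le[of K lborel "U - K"] UK mUK Kb U(1) by simp
  have mK: "s - e \<le> measure lborel K"
    using measure_Un_le[of K lborel "S - K"] SK mSK Kb S(1) by (simp add: s_def)
  obtain d where d: "d > 0" "(\<Union>x\<in>K. ball x d) \<subseteq> U"
    using compact_subset_open_imp_ball_epsilon_subset[OF \<open>compact K\<close> U(1,2)] .
  \<comment> \<open>The grid is finer than \<open>d\<close>, so every cell that meets
    \<open>K\<close> lies inside \<open>U\<close>.\<close>
  obtain N :: nat where N: "N > 0" "1 / real N < d"
    using reals_Archimedean[OF d(1)] by (metis inverse_eq_divide zero_less_Suc)
  define I where "I k = {real k / N<..<(real k + 1) / N}" for k :: nat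
  have mI: "measure lborel (I k) = 1 / N" for k using N
    by (simp add: I_def divide_simps diff_divide_distrib[symmetric])
  have I01: "I k \<subseteq> {0..1}" if "k < N" for k
  proof -
    have "(real k + 1) / N \<le> 1" using that N by simp
    moreover have "0 \<le> real k / N" by simp
    ultimately show ?thesis unfolding I_def greaterThanLessThan_def greaterThan_def lessThan_def
      by (intro subsetI) (metis (mono_tags, lifting) IntD1 IntD2 atLeastAtMost_iff less_imp_le mem_Collect_eq order_trans)
  qed
  have disj: "disjoint_family_on I A" for A
  proof -
    have "I i \<inter> I j = {}" if "i < j" for i j
    proof -
      have "(real i + 1) / N \<le> real j / N" using that by (intro divide_right_mono) auto
      then show ?thesis by (auto simp: I_def)
    qed
    then show ?thesis unfolding disjoint_family_on_def by (metis Int_commute linorder_neqE_nat)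
  qed
  define P where "P = (\<lambda>k. real k / N) ` {..N}"
  define G where "G = {k. k < N \<and> K \<inter> I k \<noteq> {}}"
  have finG: "finite G" by (simp add: G_def)
  have cover: "K \<subseteq> (\<Union>k\<in>G. K \<inter> I k) \<union> P"
  proof
    fix x assume "x \<in> K"
    then have x: "0 \<le> x" "x \<le> 1" using Kb by auto
    define k where "k = nat \<lfloor>x * N\<rfloor>"
    have k: "real k \<le> x * N" "x * N < real k + 1" using x by (simp_all add: k_def)
    have "x * real N \<le> 1 * real N" using x by (intro mult_right_mono) auto
    then have "k \<le> N" using k by linarith
    show "x \<in> (\<Union>k\<in>G. K \<inter> I k) \<union> P"
    proof (cases "x = real k / N")
      case True
      then show ?thesis using \<open>k \<le> N\<close> by (auto simp: P_def)
    next
      case False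
      then have "real k < x * N" using k N by (auto simp: field_simps)
      then have "x \<in> I k" using k N by (simp add: I_def field_simps)
      moreover have "k < N"
        using \<open>real k < x * N\<close> \<open>x * real N \<le> 1 * real N\<close> by linarith
      ultimately show ?thesis using \<open>x \<in> K\<close> by (auto simp: G_def)
    qed
  qed
  have Ib: "I k \<in> sets borel" for k by (simp add: I_def)
  have Pb: "P \<in> sets borel" "P \<subseteq> {0..1}"
    using N by (auto simp: P_def intro!: borel_closed finite_imp_closed)
  have "(\<Union>k\<in>G. K \<inter> I k) \<in> sets borel" using Kb Ib finG by (intro sets.finite_UN) auto
  then have "measure lborel K \<le> measure lborel ((\<Union>k\<in>G. K \<inter> I k) \<union> P)"
    using cover Kb Pb by (intro measure_unit_mono sets.Un) auto
  also have "\<dots> \<le> measure lborel (\<Union>k\<in>G. K \<inter> I k) + measure lborel P"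
    using Kb finG Ib Pb by (intro measure_Un_le) auto
  also have "measure lborel P = 0"
  proof -
    have "finite P" by (simp add: P_def)
    then show ?thesis by (simp add: measure_def emeasure_lborel_countable countable_finite)
  qed
  also have "measure lborel (\<Union>k\<in>G. K \<inter> I k) = (\<Sum>k\<in>G. measure lborel (K \<inter> I k))"
  proof (rule measure_finite_Union[OF finG])
    show "disjoint_family_on (\<lambda>k. K \<inter> I k) G" using disj unfolding disjoint_family_on_def
      by blast
    show "emeasure lborel (K \<inter> I k) \<noteq> \<infinity>" for k
    proof -
      have "K \<inter> I k \<in> fmeasurable lborel" using Kb Ib by (intro fmeasurable_unit) auto
      then show ?thesis by (auto simp: fmeasurable_def)
    qed
  qed (use Kb Ib in auto)
  also have "\<dots> \<le> (\<Sum>k\<in>G. (1 - \<epsilon>) * measure lborel (I k))"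
  proof (rule sum_mono)
    fix k assume "k \<in> G"
    then have "k < N" by (simp add: G_def)
    have "\<epsilon> * ((real k + 1) / N - real k / N) \<le> measure lborel (I k - S)"
      unfolding I_def using \<open>k < N\<close> N by (intro thin) (auto simp: divide_strict_right_mono)
    then have gap: "\<epsilon> * measure lborel (I k) \<le> measure lborel (I k - S)"
      using mI[of k] by (simp add: diff_divide_distrib[symmetric])
    have "measure lborel (K \<inter> I k) \<le> measure lborel (I k \<inter> S)"
      using K(2) Kb S Ib by (intro measure_unit_mono) auto
    moreover have "measure lborel (I k \<inter> S) + measure lborel (I k - S) = measure lborel (I k)"
    proof -
      have "I k \<inter> S \<in> fmeasurable lborel" "I k - S \<in> fmeasurable lborel"
        using S Ib I01[OF \<open>k < N\<close>] by (auto intro!: fmeasurable_unit)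
      then have "measure lborel ((I k \<inter> S) \<union> (I k - S)) = measure lborel (I k \<inter> S) + measure lborel (I k - S)"
        by (intro measure_Union) (auto simp: fmeasurable_def)
      moreover have "(I k \<inter> S) \<union> (I k - S) = I k" by auto
      ultimately show ?thesis by simp
    qed
    ultimately show "measure lborel (K \<inter> I k) \<le> (1 - \<epsilon>) * measure lborel (I k)"
      using gap by (simp add: algebra_simps)
  qed
  also have "\<dots> = (1 - \<epsilon>) * (\<Sum>k\<in>G. measure lborel (I k))"
    by (simp add: sum_distrib_left)
  also have "(\<Sum>k\<in>G. measure lborel (I k)) = measure lborel (\<Union>k\<in>G. I k)"
  proof (rule measure_finite_Union[symmetric, OF finG _ disj])
    show "emeasure lborel (I k) \<noteq> \<infinity>" if "k \<in> G" for k
      using fmeasurable_unit[OF Ib I01, of k] that by (auto simp: fmeasurable_def G_def)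
  qed (use Ib in auto)
  also have "(1 - \<epsilon>) * \<dots> \<le> (1 - \<epsilon>) * measure lborel U"
  proof (intro mult_left_mono measure_mono_fmeasurable Uf)
    show "(\<Union>k\<in>G. I k) \<subseteq> U"
    proof
      fix y assume "y \<in> (\<Union>k\<in>G. I k)"
      then obtain k x where kx: "y \<in> I k" "x \<in> I k" "x \<in> K" by (auto simp: G_def)
      have "\<bar>x - y\<bar> < (real k + 1) / N - real k / N" using kx by (auto simp: I_def)
      then have "dist x y < d" using N by (simp add: dist_real_def diff_divide_distrib[symmetric])
      then have "y \<in> (\<Union>x\<in>K. ball x d)" using kx(3) by (intro UN_I[of x]) simp_all
      then show "y \<in> U" by (rule subsetD[OF d(2)])
    qed
    show "(\<Union>k\<in>G. I k) \<in> sets lborel" using Ib finG by auto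
  qed (use \<open>\<epsilon> \<le> 1\<close> in simp)
  also have "\<dots> \<le> (1 - \<epsilon>) * (measure lborel K + e)"
    using mU \<open>\<epsilon> \<le> 1\<close> by (intro mult_left_mono) auto
  finally have "\<epsilon> * measure lborel K + \<epsilon> * e \<le> e" by (simp add: algebra_simps)
  moreover have "\<epsilon> * (s - e) \<le> \<epsilon> * measure lborel K"
    using mK \<open>\<epsilon> > 0\<close> by simp
  ultimately have "\<epsilon> * s \<le> e" by (simp add: algebra_simps)
  then show False using \<open>e > 0\<close> by (simp add: e_def)
qed

context lorenz_map
begin

section \<open>Lebesgue measure under iteration\<close>

lemma fR_measurable [measurable]: "fR \<in> borel_measurable borel"
  unfolding lorenz_def[abs_def] by measurable

lemma funpow_fR_measurable [measurable]: "(fR ^^ n) \<in> borel_measurable borel"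
proof (induction n)
  case (Suc n)
  then show ?case using measurable_comp[OF Suc fR_measurable] by simp
qed (simp add: id_def)

lemma AE_fR:
  assumes [measurable]: "Measurable.pred borel P" and "AE x in lborel. P x"
  shows "AE x in lborel. P (fR x)"
proof -
  have "AE x in lborel. P ((1 - a * c) + a * x)" "AE x in lborel. P (- b * c + b * x)"
    using a_pos b_pos AE_borel_affine[OF _ assms, of a "1 - a * c"] AE_borel_affine[OF _ assms, of b "- b * c"]
    by simp_all
  then show ?thesis
    by eventually_elim (auto simp: lorenz_def algebra_simps)
qed

text \<open>After \<open>n\<close> steps a piece of length at least \<eta> loses \<epsilon>, which
  is at least \<open>\<epsilon> * (length - \<eta>)\<close> because lengths are at most 1; for a
  shorter piece this bound is negative. Pulling back divides by the slope, and in the sum over the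
  pieces \<eta> gets multiplied by the weight.\<close>

lemma preimage_measure_lower:
  assumes S[measurable]: "S \<in> sets borel" and "\<epsilon> \<ge> 0" "\<eta> \<ge> 0"
    and long: "\<And>l r. 0 \<le> l \<Longrightarrow> l < r \<Longrightarrow> r \<le> 1 \<Longrightarrow> \<eta> \<le> r - l \<Longrightarrow> \<epsilon> \<le> measure lborel ({l<..<r} - S)"
    and "0 \<le> l" "l < r" "r \<le> 1"
  shows "\<epsilon> * ((r - l) - \<eta> * weight n l r) \<le> measure lborel {x \<in> {l<..<r}. (fR ^^ n) x \<notin> S}"
  using assms(5-)
proof (induction n arbitrary: l r)
  case 0
  have eq: "{x \<in> {l<..<r}. (fR ^^ 0) x \<notin> S} = {l<..<r} - S" by auto
  show ?case
  proof (cases "\<eta> \<le> r - l")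
    case True
    have "\<epsilon> * ((r - l) - \<eta>) \<le> \<epsilon> * 1"
      using 0 \<open>\<epsilon> \<ge> 0\<close> \<open>\<eta> \<ge> 0\<close> by (intro mult_left_mono) auto
    then show ?thesis using long[OF 0 True] unfolding eq by simp
  next
    case False
    then have "\<epsilon> * ((r - l) - \<eta>) \<le> 0" using \<open>\<epsilon> \<ge> 0\<close>
      by (simp add: mult_nonneg_nonpos)
    then show ?thesis unfolding eq by (simp add: order_trans[OF _ measure_nonneg])
  qed
next
  case (Suc n)
  let ?X = "\<lambda>n l r. {x \<in> {l<..<r}. (fR ^^ n) x \<notin> S}"
  have X[measurable]: "?X m l r \<in> sets borel" for m l r by measurable
  have scale: "measure lborel (?X (Suc n) l r) = measure lborel (?X n (fR l) (fL r)) / sl l"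
    if "0 \<le> l" "l < r" "r \<le> 1" "r \<le> c \<or> c \<le> l" for l r
  proof -
    define t where "t = fR l - sl l * l"
    have f: "fR x = t + sl l * x" if "l < x" "x < r" for x
      using aff_Suc(1)[of r l x] \<open>r \<le> c \<or> c \<le> l\<close> that
      by (simp add: t_def algebra_simps)
    have fr: "fL r = t + sl l * r"
      using aff_Suc(2)[of r l r] \<open>r \<le> c \<or> c \<le> l\<close> \<open>l < r\<close>
      by (simp add: t_def algebra_simps)
    have "x \<in> ?X (Suc n) l r \<longleftrightarrow> t + sl l * x \<in> ?X n (fR l) (fL r)" for x
    proof -
      have "fR l < t + sl l * x \<longleftrightarrow> l < x" by (simp add: t_def)
      moreover have "t + sl l * x < fL r \<longleftrightarrow> x < r" by (simp add: fr)
      moreover have "(fR ^^ Suc n) x = (fR ^^ n) (fR x)" unfolding funpow_Suc_right by simp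
      ultimately show ?thesis using f by auto
    qed
    then have "?X (Suc n) l r = {x. t + sl l * x \<in> ?X n (fR l) (fL r)}" by blast
    then show ?thesis using measure_affine_vimage[OF sl_pos X] by simp
  qed
  have part: "\<epsilon> * ((r - l) - \<eta> * (weight n (fR l) (fL r) / sl l)) \<le> measure lborel (?X (Suc n) l r)"
    if lr: "0 \<le> l" "l < r" "r \<le> 1" "r \<le> c \<or> c \<le> l" for l r
  proof -
    note im = unit_image[OF lr]
    have "\<epsilon> * ((fL r - fR l) - \<eta> * weight n (fR l) (fL r)) \<le> measure lborel (?X n (fR l) (fL r))"
      by (rule Suc.IH[OF im(1-3)])
    then have "\<epsilon> * (sl l * (r - l) - \<eta> * weight n (fR l) (fL r)) / sl l \<le> measure lborel (?X (Suc n) l r)"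
      unfolding scale[OF lr] im(4) by (intro divide_right_mono) (auto intro: less_imp_le)
    moreover have "\<epsilon> * (sl l * (r - l) - \<eta> * weight n (fR l) (fL r)) / sl l =
        \<epsilon> * ((r - l) - \<eta> * (weight n (fR l) (fL r) / sl l))"
      using less_imp_neq[OF sl_pos[of l]] by (simp add: field_simps)
    ultimately show ?thesis by simp
  qed
  consider "r \<le> c" | "c \<le> l" | "l < c" "c < r" by linarith
  then show ?case
  proof cases
    case 1
    then show ?thesis using part[OF Suc.prems] Suc.prems
      by (simp add: weight_Suc_left sl_def del: weight.simps funpow.simps)
  next
    case 2
    then show ?thesis using part[OF Suc.prems] Suc.prems
      by (simp add: weight_Suc_right sl_def del: weight.simps funpow.simps)
  next
    case 3
    have "measure lborel (?X (Suc n) l c \<union> ?X (Suc n) c r) \<le> measure lborel (?X (Suc n) l r)"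
      using Suc.prems 3 by (intro measure_unit_mono sets.Un X) auto
    moreover have "measure lborel (?X (Suc n) l c \<union> ?X (Suc n) c r) =
        measure lborel (?X (Suc n) l c) + measure lborel (?X (Suc n) c r)"
    proof (rule measure_Union)
      have "?X (Suc n) l c \<in> fmeasurable lborel" "?X (Suc n) c r \<in> fmeasurable lborel"
        using Suc.prems 3 c_less c_pos by (intro fmeasurable_unit X; auto)+
      then show "emeasure lborel (?X (Suc n) l c) \<noteq> \<infinity>" "emeasure lborel (?X (Suc n) c r) \<noteq> \<infinity>"
        by (auto simp: fmeasurable_def)
    qed (auto simp del: funpow.simps)
    moreover have "\<epsilon> * ((c - l) - \<eta> * (weight n (fR l) 1 / a)) \<le> measure lborel (?X (Suc n) l c)"
      using part[of l c] Suc.prems 3 c_less by (simp add: sl_def del: funpow.simps)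
    moreover have "\<epsilon> * ((r - c) - \<eta> * (weight n 0 (fL r) / b)) \<le> measure lborel (?X (Suc n) c r)"
      using part[of c r] Suc.prems 3 c_pos by (simp add: sl_def del: funpow.simps)
    moreover have "\<epsilon> * ((r - l) - \<eta> * weight (Suc n) l r) =
        \<epsilon> * ((c - l) - \<eta> * (weight n (fR l) 1 / a)) + \<epsilon> * ((r - c) - \<eta> * (weight n 0 (fL r) / b))"
      unfolding weight_Suc_cut[OF 3] by (simp add: algebra_simps)
    ultimately show ?thesis by linarith
  qed
qed

text \<open>If no interval were full, then by finiteness of a grid all intervals of length at least
  \<eta> would lose a common amount \<epsilon>. By invariance almost every point whose orbit is
  outside \<open>S\<close> at time \<open>n\<close> is itself outside \<open>S\<close>, so this loss
  on the large scale is pulled back to every interval, however short, as a fixed proportion. Then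
  \<open>S\<close> would be null.\<close>

lemma ex_full_interval:
  assumes S[measurable]: "S \<in> sets borel" and S01: "S \<subseteq> {0..1}" and "measure lborel S \<noteq> 0"
    and inv: "AE x in lborel. x \<in> S \<longrightarrow> fR x \<in> S"
  shows "\<exists>l r. 0 \<le> l \<and> l < r \<and> r \<le> 1 \<and> (AE x in lborel. l < x \<and> x < r \<longrightarrow> x \<in> S)"
proof (rule ccontr)
  assume none: "\<not> ?thesis"
  have pos: "measure lborel ({l<..<r} - S) > 0" if "0 \<le> l" "l < r" "r \<le> 1" for l r
  proof (rule ccontr)
    assume "\<not> measure lborel ({l<..<r} - S) > 0"
    then have "measure lborel ({l<..<r} - S) = 0" by (simp add: zero_less_measure_iff)
    moreover have f: "{l<..<r} - S \<in> fmeasurable lborel" using that by (intro fmeasurable_unit) auto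
    ultimately have "emeasure lborel ({l<..<r} - S) = 0"
      using emeasure_eq_measure2[OF f] by simp
    then have "AE x in lborel. x \<notin> {l<..<r} - S" by (intro AE_not_in) (auto intro: null_setsI)
    then have "AE x in lborel. l < x \<and> x < r \<longrightarrow> x \<in> S" by eventually_elim auto
    then show False using none that by blast
  qed
  obtain q C where C: "C > 0"
    "\<And>j l r. 0 \<le> l \<Longrightarrow> l < r \<Longrightarrow> r \<le> 1 \<Longrightarrow> weight (j * q) l r \<le> (2 / 3) ^ j + C * (r - l)"
    using weight_decay by blast
  \<comment> \<open>With this choice \<eta> times the limit \<open>C * (r - l)\<close> of the weight
    bound is half the length, so the other half survives.\<close>
  define \<eta> where "\<eta> = 1 / (2 * C)"
  have "\<eta> > 0" "\<eta> * C = 1 / 2" using C(1) by (simp_all add: \<eta>_def)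
  \<comment> \<open>An interval of length at least \<eta> > 2/N contains a whole grid cell.\<close>
  obtain N :: nat where N: "N > 0" "2 / N < \<eta>"
  proof -
    obtain N :: nat where N: "2 / \<eta> < N" using reals_Archimedean2 by blast
    moreover have "0 < 2 / \<eta>" using \<open>\<eta> > 0\<close> by simp
    ultimately have "0 < real N" by linarith
    then show thesis using N \<open>\<eta> > 0\<close> by (intro that[of N]) (auto simp: field_simps)
  qed
  define m where "m k = measure lborel ({real k / N<..<(real k + 1) / N} - S)" for k :: nat
  define \<epsilon> where "\<epsilon> = Min (m ` {..<N})"
  have ne: "m ` {..<N} \<noteq> {}" using N by auto
  have m_pos: "m k > 0" if "k < N" for k
    unfolding m_def using that N by (intro pos) (auto simp: divide_strict_right_mono)
  have "\<epsilon> > 0" unfolding \<epsilon>_def using ne m_pos by (subst Min_gr_iff) auto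
  have long: "\<epsilon> \<le> measure lborel ({l<..<r} - S)" if lr: "0 \<le> l" "l < r" "r \<le> 1" "\<eta> \<le> r - l" for l r
  proof -
    define k where "k = nat \<lceil>l * N\<rceil>"
    have k: "l * N \<le> real k" "real k < l * N + 1"
    proof -
      have "0 \<le> l * N" using lr by simp
      then show "l * N \<le> real k" "real k < l * N + 1" unfolding k_def by linarith+
    qed
    have "l \<le> real k / N" using k(1) N by (simp add: field_simps)
    moreover have kr: "(real k + 1) / N \<le> r"
    proof -
      have "(real k + 1) / N \<le> (l * N + 2) / N" using k(2) by (intro divide_right_mono) auto
      also have "\<dots> = l + 2 / N" using N by (simp add: field_simps)
      finally show ?thesis using N(2) lr(4) by simp
    qed
    ultimately have sub: "{real k / N<..<(real k + 1) / N} - S \<subseteq> {l<..<r} - S" by auto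
    have "(real k + 1) / N \<le> 1" using kr lr by simp
    then have "k < N" using N by (simp add: field_simps)
    then have "\<epsilon> \<le> m k" unfolding \<epsilon>_def by (intro Min_le) auto
    also have "\<dots> \<le> measure lborel ({l<..<r} - S)"
      unfolding m_def using sub lr by (intro measure_unit_mono) auto
    finally show ?thesis .
  qed
  have inv_n: "AE x in lborel. x \<in> S \<longrightarrow> (fR ^^ n) x \<in> S" for n
  proof (induction n)
    case (Suc n)
    have "AE x in lborel. fR x \<in> S \<longrightarrow> (fR ^^ n) (fR x) \<in> S"
      by (rule AE_fR[OF _ Suc]) measurable
    then show ?case using inv by eventually_elim (simp add: funpow_swap1)
  qed simp
  have "\<epsilon> / 2 * (r - l) \<le> measure lborel ({l<..<r} - S)" if lr: "0 \<le> l" "l < r" "r \<le> 1"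
    for l r
  proof -
    have bound: "\<epsilon> * ((r - l) - \<eta> * ((2 / 3) ^ j + C * (r - l))) \<le> measure lborel ({l<..<r} - S)" for j
    proof -
      let ?X = "{x \<in> {l<..<r}. (fR ^^ (j * q)) x \<notin> S}"
      have "\<epsilon> * ((r - l) - \<eta> * ((2 / 3) ^ j + C * (r - l))) \<le> \<epsilon> * ((r - l) - \<eta> * weight (j * q) l r)"
        using C(2)[OF lr, of j] \<open>\<eta> > 0\<close> \<open>\<epsilon> > 0\<close>
        by (intro mult_left_mono diff_left_mono) auto
      also have "\<dots> \<le> measure lborel ?X"
        using long \<open>\<eta> > 0\<close> \<open>\<epsilon> > 0\<close> lr
        by (intro preimage_measure_lower) auto
      also have "\<dots> \<le> measure lborel ({l<..<r} - S)"
      proof -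
        have "emeasure lborel ?X \<le> emeasure lborel ({l<..<r} - S)"
          using inv_n[of "j * q"] by (intro emeasure_mono_AE) (auto elim: eventually_mono)
        moreover have "{l<..<r} - S \<in> fmeasurable lborel" using lr by (intro fmeasurable_unit) auto
        ultimately show ?thesis unfolding measure_def by (intro enn2real_mono) (auto simp: fmeasurable_def)
      qed
      finally show ?thesis .
    qed
    have "(\<lambda>j. \<epsilon> * ((r - l) - \<eta> * ((2 / 3) ^ j + C * (r - l)))) \<longlonglongrightarrow> \<epsilon> * ((r - l) - \<eta> * (0 + C * (r - l)))"
      by (intro tendsto_intros LIMSEQ_power_zero) auto
    then have "\<epsilon> * ((r - l) - \<eta> * (0 + C * (r - l))) \<le> measure lborel ({l<..<r} - S)"
      by (rule LIMSEQ_le_const2) (use bound in blast)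
    moreover have "\<epsilon> * ((r - l) - \<eta> * (0 + C * (r - l))) = \<epsilon> / 2 * (r - l)"
    proof -
      have "\<eta> * (C * (r - l)) = (r - l) / 2" using \<open>\<eta> * C = 1 / 2\<close>
        by (metis mult.assoc mult.commute times_divide_eq_right mult_1_right)
      then have eq: "\<eta> * (0 + C * (r - l)) = (r - l) / 2" by (simp only: add_0)
      have "(r - l) - \<eta> * (0 + C * (r - l)) = (r - l) / 2" unfolding eq by (simp add: field_simps)
      then show ?thesis by (simp only: times_divide_eq_right times_divide_eq_left)
    qed
    ultimately show ?thesis by (simp only:)
  qed
  then have "measure lborel S = 0"
    using \<open>\<epsilon> > 0\<close>
    by (intro null_of_gaps_in_all_intervals[OF S S01, of "\<epsilon> / 2"]) auto
  then show False using assms(3) by simp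
qed

section \<open>Absolutely continuous invariant measures\<close>

lemma lorenz_full_AE:
  assumes S[measurable]: "S \<in> sets borel" and inv: "AE x in lborel. x \<in> S \<longrightarrow> fR x \<in> S"
  shows "lorenz_full a b c (\<lambda>l r. AE x in lborel. l < x \<and> x < r \<longrightarrow> x \<in> S)"
proof unfold_locales
  fix l r m :: real
  assume "AE x in lborel. l < x \<and> x < m \<longrightarrow> x \<in> S" "AE x in lborel. m < x \<and> x < r \<longrightarrow> x \<in> S"
  then show "AE x in lborel. l < x \<and> x < r \<longrightarrow> x \<in> S"
    using AE_lborel_singleton[of m] by eventually_elim force
next
  fix l r :: real
  assume *: "\<And>r'. r' < r \<Longrightarrow> AE x in lborel. l < x \<and> x < r' \<longrightarrow> x \<in> S"
  \<comment> \<open>The limit is taken along a sequence, since only countably many null sets may be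
    united.\<close>
  have "AE x in lborel. \<forall>n. l < x \<and> x < r - inverse (Suc n) \<longrightarrow> x \<in> S"
    unfolding AE_all_countable using * by simp
  then show "AE x in lborel. l < x \<and> x < r \<longrightarrow> x \<in> S"
  proof eventually_elim
    case (elim x)
    show ?case
    proof
      assume x: "l < x \<and> x < r"
      then obtain n where "inverse (Suc n) < r - x" using reals_Archimedean[of "r - x"] by auto
      then show "x \<in> S" using elim[rule_format, of n] x by simp
    qed
  qed
next
  fix l r :: real
  assume *: "\<And>l'. l < l' \<Longrightarrow> AE x in lborel. l' < x \<and> x < r \<longrightarrow> x \<in> S"
  have "AE x in lborel. \<forall>n. l + inverse (Suc n) < x \<and> x < r \<longrightarrow> x \<in> S"
    unfolding AE_all_countable using * by simp
  then show "AE x in lborel. l < x \<and> x < r \<longrightarrow> x \<in> S"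
  proof eventually_elim
    case (elim x)
    show ?case
    proof
      assume x: "l < x \<and> x < r"
      then obtain n where "inverse (Suc n) < x - l" using reals_Archimedean[of "x - l"] by auto
      then show "x \<in> S" using elim[rule_format, of n] x by simp
    qed
  qed
next
  fix l r :: real
  assume F: "AE x in lborel. l < x \<and> x < r \<longrightarrow> x \<in> S" and lr: "0 \<le> l" "l < r" "r \<le> 1" "r \<le> c \<or> c \<le> l"
  define s where "s = sl l"
  define t where "t = fR l - s * l"
  have s: "s > 0" by (simp add: s_def)
  have f: "fR x = t + s * x" if "l < x" "x < r" for x
    using aff_Suc(1)[of r l x] lr that by (simp add: t_def s_def algebra_simps)
  have fr: "fL r = t + s * r"
    using aff_Suc(2)[of r l r] lr by (simp add: t_def s_def algebra_simps)
  have "AE x in lborel. l < x \<and> x < r \<longrightarrow> fR x \<in> S" using F inv by eventually_elim auto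
  moreover have "Measurable.pred borel (\<lambda>x. l < x \<and> x < r \<longrightarrow> fR x \<in> S)" by measurable
  ultimately have "AE y in lborel. l < - t / s + 1 / s * y \<and> - t / s + 1 / s * y < r \<longrightarrow> fR (- t / s + 1 / s * y) \<in> S"
    using s
    by (intro AE_borel_affine[where P = "\<lambda>x. l < x \<and> x < r \<longrightarrow> fR x \<in> S"]) auto
  then show "AE y in lborel. fR l < y \<and> y < fL r \<longrightarrow> y \<in> S"
  proof eventually_elim
    case (elim y)
    show ?case
    proof
      assume y: "fR l < y \<and> y < fL r"
      define x where "x = - t / s + 1 / s * y"
      have yx: "y = t + s * x" using s by (simp add: x_def field_simps)
      have "fR l = t + s * l" by (simp add: t_def)
      then have "s * l < s * x" "s * x < s * r" using y yx fr by linarith+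
      then have "l < x" "x < r" using s by auto
      then show "y \<in> S" using elim f[of x] yx unfolding x_def by simp
    qed
  qed
qed (auto elim: eventually_mono)

text \<open>The extended naturals are well-ordered, so an infimum over a nonempty set is attained;
  over the empty set it would be infinite.\<close>

lemma min_period_enat:
  assumes "min_period a b c = enat k"
  shows "\<exists>x. has_period a b c k x" "\<And>n. n < k \<Longrightarrow> \<not> has_period a b c n x"
proof -
  let ?A = "enat ` {n. \<exists>x. has_period a b c n x}"
  have Inf: "Inf ?A = enat k" using assms by (simp add: min_period_def)
  have "?A \<noteq> {}"
  proof
    assume empty: "?A = {}"
    show False using Inf unfolding empty by (simp add: Inf_enat_def)
  qed
  then obtain z where "z \<in> ?A" by blast
  then have "(LEAST x. x \<in> ?A) \<in> ?A" by (rule LeastI)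
  then have "Inf ?A \<in> ?A" using \<open>?A \<noteq> {}\<close> unfolding Inf_enat_def
    by (simp only: if_False)
  then show "\<exists>x. has_period a b c k x" unfolding Inf by auto
  show "\<not> has_period a b c n x" if "n < k" for n x
  proof
    assume "has_period a b c n x"
    then have "Inf ?A \<le> enat n" by (intro Inf_lower) auto
    then show False using Inf that by simp
  qed
qed

lemma has_period_reflect: "has_period b a (1 - c) n (1 - x) \<longleftrightarrow> has_period a b c n x"
proof -
  interpret m: lorenz_map b a "1 - c" by (rule reflected)
  show ?thesis unfolding has_period_iff m.has_period_iff lorenz_funpow_reflect lorenzl_funpow_reflect by auto
qed

lemma AE_avoids_c: "AE x in lborel. \<forall>i. (fR ^^ i) x \<noteq> c"
  unfolding AE_all_countable
proof
  fix i
  show "AE x in lborel. (fR ^^ i) x \<noteq> c"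
  proof (induction i)
    case 0
    show ?case using AE_lborel_singleton[of c] by simp
  next
    case (Suc i)
    have "AE x in lborel. (fR ^^ i) (fR x) \<noteq> c" by (rule AE_fR[OF _ Suc]) measurable
    then show ?case by (simp add: funpow_swap1)
  qed
qed

end

lemma (in lorenz_full_orbit) F_unit_iff_cond:
  assumes "F d c" "F c e" "0 \<le> d" "d < c" "c < e" "e \<le> 1"
    and "A < PL \<or> PR < B \<or> A = PL \<and> B = PR"
  shows "F 0 1"
  using F_between[OF assms(7,1-6)] assms by (intro F_unit[of d]) auto

lemma (in lorenz_orbit) orb_of_period_2:
  assumes "\<kappa> = 2"
  shows "PR = a * PL + 1 - a * c" "PL = b * (PR - c)"
proof -
  have ne: "PL \<noteq> PR" using PL(2) PR(2) by simp
  have "orb = {PL, PR}"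
    using finite_orb card_orb PL(1) PR(1) ne assms by (intro card_seteq[symmetric]) auto
  moreover have "fL PL \<noteq> PL" "fL PR \<noteq> PR"
    using no_fixed_point_branches(1)[OF no_fixed, of PL] no_fixed_point_branches(2)[OF no_fixed, of PR]
      PL(2) PR(2) PL_pos PR_le by (auto simp: lorenzl_def)
  ultimately have "fL PL = PR" "fL PR = PL" using orb_fL[OF PL(1)] orb_fL[OF PR(1)] by auto
  then show "PR = a * PL + 1 - a * c" "PL = b * (PR - c)" using PL(2) PR(2) by (auto simp: lorenzl_def)
qed

section \<open>The acim, its support and the criterion\<close>

locale lorenz_acim = lorenz_map +
  fixes \<mu> :: "real measure"
  assumes acim: "acim a b c \<mu>"
begin

lemma prob: "prob_space \<mu>" and sets_\<mu>: "sets \<mu> = sets (restrict_space borel {0..1})"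
  and f_\<mu>: "fR \<in> measurable \<mu> \<mu>" and distr_\<mu>: "distr \<mu> \<mu> fR = \<mu>"
  and ac: "absolutely_continuous unit_lebesgue \<mu>"
  using acim by (auto simp: acim_def)

lemma space_\<mu>: "space \<mu> = {0..1}"
  using sets_eq_imp_space_eq[OF sets_\<mu>] by (simp add: space_restrict_space)

lemma in_sets_\<mu>: "E \<in> sets \<mu> \<longleftrightarrow> E \<in> sets borel \<and> E \<subseteq> {0..1}"
  unfolding sets_\<mu> by (subst sets_restrict_space_iff) auto

lemma sets_unit: "sets unit_lebesgue = sets \<mu>"
  unfolding sets_\<mu> unit_lebesgue_def by (intro sets_restrict_space_cong) simp

lemma emeasure_unit: "E \<in> sets \<mu> \<Longrightarrow> emeasure unit_lebesgue E = emeasure lborel E"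
  unfolding unit_lebesgue_def by (subst emeasure_restrict_space) (auto simp: in_sets_\<mu>)

lemma equivalent_iff:
  "equivalent_to_lebesgue \<mu> \<longleftrightarrow> (\<forall>E. E \<in> sets borel \<and> E \<subseteq> {0..1} \<longrightarrow> emeasure \<mu> E = 0 \<longrightarrow> emeasure lborel E = 0)"
proof -
  have "null_sets unit_lebesgue \<subseteq> null_sets \<mu>" using ac by (simp add: absolutely_continuous_def)
  then have "equivalent_to_lebesgue \<mu> \<longleftrightarrow> null_sets \<mu> \<subseteq> null_sets unit_lebesgue"
    unfolding equivalent_to_lebesgue_def by auto
  also have "\<dots> \<longleftrightarrow> (\<forall>E\<in>sets \<mu>. emeasure \<mu> E = 0 \<longrightarrow> emeasure lborel E = 0)"
    unfolding null_sets_def using sets_unit emeasure_unit by auto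
  finally show ?thesis by (auto simp: in_sets_\<mu>)
qed

lemma funpow_preserves:
  assumes "E \<in> sets \<mu>"
  shows "(fR ^^ n) -` E \<inter> space \<mu> \<in> sets \<mu>" "emeasure \<mu> ((fR ^^ n) -` E \<inter> space \<mu>) = emeasure \<mu> E"
proof -
  have "(fR ^^ n) -` E \<inter> space \<mu> \<in> sets \<mu> \<and> emeasure \<mu> ((fR ^^ n) -` E \<inter> space \<mu>) = emeasure \<mu> E"
  proof (induction n)
    case 0
    show ?case using sets.sets_into_space[OF assms] assms by (simp add: Int_absorb2)
  next
    case (Suc n)
    let ?X = "(fR ^^ n) -` E \<inter> space \<mu>"
    have eq: "(fR ^^ Suc n) -` E \<inter> space \<mu> = fR -` ?X \<inter> space \<mu>"
      using measurable_space[OF f_\<mu>] by (auto simp: funpow_swap1)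
    have "fR -` ?X \<inter> space \<mu> \<in> sets \<mu>"
      by (rule measurable_sets[OF f_\<mu> conjunct1[OF Suc]])
    moreover have "emeasure \<mu> (fR -` ?X \<inter> space \<mu>) = emeasure (distr \<mu> \<mu> fR) ?X"
      by (rule emeasure_distr[OF f_\<mu> conjunct1[OF Suc], symmetric])
    ultimately show ?case unfolding eq distr_\<mu> using Suc by simp
  qed
  then show "(fR ^^ n) -` E \<inter> space \<mu> \<in> sets \<mu>" "emeasure \<mu> ((fR ^^ n) -` E \<inter> space \<mu>) = emeasure \<mu> E"
    by auto
qed

text \<open>The preimages of \<open>E\<close> are pairwise disjoint and have equal measure, and the
  total measure is finite.\<close>

lemma wandering_null:
  assumes E: "E \<in> sets \<mu>" and wander: "\<And>x n. x \<in> E \<Longrightarrow> 0 < n \<Longrightarrow> (fR ^^ n) x \<notin> E"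
  shows "emeasure \<mu> E = 0"
proof -
  interpret prob_space \<mu> by (rule prob)
  define X where "X n = (fR ^^ n) -` E \<inter> space \<mu>" for n
  have "X i \<inter> X j = {}" if "i < j" for i j
  proof -
    have "(fR ^^ j) x = (fR ^^ (j - i)) ((fR ^^ i) x)" for x
      by (rule funpow_le_eq) (use that in simp)
    then show ?thesis using wander[of _ "j - i"] that by (auto simp: X_def)
  qed
  then have disj: "disjoint_family X"
    unfolding disjoint_family_on_def by (metis Int_commute linorder_neqE_nat)
  have X: "X n \<in> sets \<mu>" "measure \<mu> (X n) = measure \<mu> E" for n
    using funpow_preserves[OF E, of n] by (auto simp: X_def measure_def)
  then have "(\<lambda>n. measure \<mu> (X n)) sums measure \<mu> (\<Union>n. X n)"
    using disj by (intro finite_measure_UNION) auto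
  then have "summable (\<lambda>n::nat. measure \<mu> E)" using X(2) sums_summable by fastforce
  then have "measure \<mu> E = 0" by (simp add: summable_const_iff)
  then show ?thesis by (simp add: emeasure_eq_measure)
qed

text \<open>The wandering condition is required only for points that never meet \<open>c\<close>,
  which are almost all. This admits wandering intervals obtained by reflection, where
  \<open>fL\<close> stands in place of \<open>fR\<close>.\<close>

lemma not_equivalent_if_wandering:
  assumes lr: "0 \<le> l" "l < r" "r \<le> 1"
    and wander: "\<And>x n. l < x \<Longrightarrow> x < r \<Longrightarrow> \<forall>i. (fR ^^ i) x \<noteq> c \<Longrightarrow> 0 < n \<Longrightarrow> \<not> (l < (fR ^^ n) x \<and> (fR ^^ n) x < r)"
  shows "\<not> equivalent_to_lebesgue \<mu>"
proof
  assume equiv: "equivalent_to_lebesgue \<mu>"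
  define E where "E = {x \<in> {l<..<r}. \<forall>i. (fR ^^ i) x \<noteq> c}"
  have Eb: "E \<in> sets borel" unfolding E_def by measurable
  have E01: "E \<subseteq> {0..1}" using lr by (auto simp: E_def)
  have "emeasure \<mu> E = 0"
    by (rule wandering_null) (use Eb E01 wander in \<open>auto simp: in_sets_\<mu> E_def\<close>)
  then have "emeasure lborel E = 0" using equiv Eb E01 unfolding equivalent_iff by blast
  moreover have "emeasure lborel E = emeasure lborel {l<..<r}"
    using AE_avoids_c Eb by (intro emeasure_eq_AE) (auto simp: E_def elim: eventually_mono)
  ultimately show False using lr by simp
qed

text \<open>\<open>S\<close> is the set where the density does not vanish. Its complement is null
  for \<mu>, hence so is the preimage of the complement by invariance of \<mu>; this means that
  almost no point of \<open>S\<close> leaves \<open>S\<close>.\<close>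

lemma support:
  "\<exists>S. S \<in> sets borel \<and> S \<subseteq> {0..1} \<and> measure lborel S \<noteq> 0 \<and>
    (AE x in lborel. x \<in> S \<longrightarrow> fR x \<in> S) \<and>
    (\<forall>E. E \<in> sets borel \<longrightarrow> E \<subseteq> {0..1} \<longrightarrow> emeasure \<mu> E = 0 \<longleftrightarrow> (AE x in lborel. x \<in> E \<longrightarrow> x \<notin> S))"
proof -
  interpret prob_space \<mu> by (rule prob)
  have "finite_measure unit_lebesgue"
    unfolding unit_lebesgue_def
    by (intro finite_measureI) (simp add: space_restrict_space emeasure_restrict_space)
  then interpret U: finite_measure unit_lebesgue .
  obtain h where h[measurable]: "h \<in> borel_measurable unit_lebesgue" and \<mu>: "density unit_lebesgue h = \<mu>"
    using U.Radon_Nikodym[OF ac sets_unit[symmetric]] by blast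
  have space_U: "space unit_lebesgue = {0..1}"
    using sets_eq_imp_space_eq[OF sets_unit] space_\<mu> by simp
  define S where "S = {x \<in> space unit_lebesgue. h x \<noteq> 0}"
  have "S \<in> sets unit_lebesgue" unfolding S_def by measurable
  then have S: "S \<in> sets borel" "S \<subseteq> {0..1}" by (auto simp: sets_unit in_sets_\<mu>)
  have null: "emeasure \<mu> E = 0 \<longleftrightarrow> (AE x in lborel. x \<in> E \<longrightarrow> x \<notin> S)" if E: "E \<in> sets borel" "E \<subseteq> {0..1}" for E
  proof -
    have EU[measurable]: "E \<in> sets unit_lebesgue" using E by (simp add: sets_unit in_sets_\<mu>)
    have "emeasure \<mu> E = (\<integral>\<^sup>+ x. h x * indicator E x \<partial>unit_lebesgue)"
      unfolding \<mu>[symmetric] by (rule emeasure_density) measurable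
    then have "emeasure \<mu> E = 0 \<longleftrightarrow> (AE x in unit_lebesgue. h x * indicator E x = 0)"
      by (simp add: nn_integral_0_iff_AE)
    also have "\<dots> \<longleftrightarrow> (AE x in lborel. x \<in> {0..1} \<longrightarrow> h x * indicator E x = 0)"
      unfolding unit_lebesgue_def by (subst AE_restrict_space_iff) auto
    also have "\<dots> \<longleftrightarrow> (AE x in lborel. x \<in> E \<longrightarrow> x \<notin> S)"
      using E(2) by (intro AE_cong) (auto simp: S_def space_U indicator_def)
    finally show ?thesis .
  qed
  have pos: "measure lborel S \<noteq> 0"
  proof
    assume "measure lborel S = 0"
    moreover have "S \<in> fmeasurable lborel" using S by (rule fmeasurable_unit)
    ultimately have "emeasure lborel S = 0" by (simp add: emeasure_eq_measure2)
    then have "AE x in lborel. x \<notin> S" using S by (intro AE_not_in) (auto intro: null_setsI)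
    then have "emeasure \<mu> {0..1} = 0" by (subst null) (auto elim: eventually_mono)
    then show False using emeasure_space_1 space_\<mu> by simp
  qed
  have inv: "AE x in lborel. x \<in> S \<longrightarrow> fR x \<in> S"
  proof -
    let ?X = "fR -` ({0..1} - S) \<inter> {0..1}"
    have "{0..1} - S \<in> sets \<mu>" using S by (simp add: in_sets_\<mu>)
    from funpow_preserves[OF this, of 1] have X: "?X \<in> sets \<mu>" "emeasure \<mu> ?X = emeasure \<mu> ({0..1} - S)"
      by (simp_all add: space_\<mu>)
    have "emeasure \<mu> ({0..1} - S) = 0" by (subst null) (use S in auto)
    then have "AE x in lborel. x \<in> ?X \<longrightarrow> x \<notin> S" using null[of ?X] X
      by (simp add: in_sets_\<mu>)
    then show ?thesis
    proof eventually_elim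
      case (elim x)
      show ?case
      proof
        assume "x \<in> S"
        then have "x \<in> {0..1}" "x \<notin> ?X" using S elim by auto
        then show "fR x \<in> S" using fR_range_closed[of x] by auto
      qed
    qed
  qed
  show ?thesis using S pos inv null by (intro exI[of _ S]) simp
qed

text \<open>The full interval is moved forward until it contains \<open>c\<close> in its interior,
  since all arguments on growth start from the two sides of \<open>c\<close>.\<close>

lemma full_structure:
  obtains F d e where "lorenz_full a b c F" "F d c" "F c e" "0 \<le> d" "d < c" "c < e" "e \<le> 1"
    "F 0 1 \<Longrightarrow> equivalent_to_lebesgue \<mu>"
proof -
  obtain S where S: "S \<in> sets borel" "S \<subseteq> {0..1}" "measure lborel S \<noteq> 0"
    "AE x in lborel. x \<in> S \<longrightarrow> fR x \<in> S"
    "\<forall>E. E \<in> sets borel \<longrightarrow> E \<subseteq> {0..1} \<longrightarrow> emeasure \<mu> E = 0 \<longleftrightarrow> (AE x in lborel. x \<in> E \<longrightarrow> x \<notin> S)"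
    using support by (elim exE conjE)
  define F where "F l r \<longleftrightarrow> (AE x in lborel. l < x \<and> x < r \<longrightarrow> x \<in> S)" for l r
  have F: "lorenz_full a b c F" unfolding F_def[abs_def] by (rule lorenz_full_AE[OF S(1,4)])
  interpret L: lorenz_full a b c F by (rule F)
  obtain l r where lr: "0 \<le> l" "l < r" "r \<le> 1" "F l r"
    using ex_full_interval[OF S(1-4)] unfolding F_def by blast
  obtain n where n: "uncut n l r" "(fR ^^ n) l < c" "c < (fL ^^ n) r" using grows_over_c[OF lr(1-3)] .
  have Fn: "F ((fR ^^ n) l) ((fL ^^ n) r)" using L.F_uncut[OF n(1) lr(4,1-3)] .
  have "F 0 1 \<Longrightarrow> equivalent_to_lebesgue \<mu>"
  proof -
    assume "F 0 1"
    then have F01: "AE x in lborel. 0 < x \<and> x < 1 \<longrightarrow> x \<in> S" by (simp add: F_def)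
    show ?thesis unfolding equivalent_iff
    proof (intro allI impI, elim conjE)
      fix E :: "real set" assume E: "E \<in> sets borel" "E \<subseteq> {0..1}" and "emeasure \<mu> E = 0"
      then have "AE x in lborel. x \<in> E \<longrightarrow> x \<notin> S" using S(5) by blast
      then have "AE x in lborel. x \<notin> E"
        using F01 AE_lborel_singleton[of 0] AE_lborel_singleton[of 1] by eventually_elim (use E(2) in force)
      then show "emeasure lborel E = 0" using E(1) by (simp add: AE_iff_measurable[of E])
    qed
  qed
  moreover have "0 \<le> (fR ^^ n) l" "(fL ^^ n) r \<le> 1"
    using funpow_fR_range[of l n] funpow_fL_range[of r n] lr by auto
  ultimately show thesis
    using n L.F_sub[OF Fn, of "(fR ^^ n) l" c] L.F_sub[OF Fn, of c "(fL ^^ n) r"]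
    by (intro that[OF F, of "(fR ^^ n) l" "(fL ^^ n) r"]) auto
qed

lemma equivalent_if_period_1:
  assumes "min_period a b c = 1"
  shows "equivalent_to_lebesgue \<mu>"
proof -
  obtain F d e where *: "lorenz_full a b c F" "F d c" "F c e" "0 \<le> d" "d < c" "c < e" "e \<le> 1"
    "F 0 1 \<Longrightarrow> equivalent_to_lebesgue \<mu>" using full_structure by metis
  interpret L: lorenz_full a b c F by (rule *)
  obtain x where "has_period a b c 1 x" using min_period_enat(1)[of 1] assms by (auto simp: one_enat_def)
  then show ?thesis using *(8) L.F_unit_of_fixed_end[OF has_period_1_cases *(2-7)] by blast
qed

lemma equivalent_iff_orbit:
  assumes k: "2 \<le> k" "min_period a b c = enat k" and Q: "periodic_orbit a b c k Q"
  defines "p \<equiv> orbit_left Q" and "q \<equiv> orbit_right Q" and "u \<equiv> (fR ^^ k) c" and "v \<equiv> (fL ^^ k) c"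
  shows "equivalent_to_lebesgue \<mu> \<longleftrightarrow> u < p \<or> q < v \<or> u = p \<and> v = q"
    and "p \<le> c" "c \<le> q" "p < q" "u \<le> v"
    and "k = 2 \<Longrightarrow> q = a * p + 1 - a * c \<and> p = b * (q - c)"
proof -
  let ?thesis' = "(equivalent_to_lebesgue \<mu> \<longleftrightarrow> u < p \<or> q < v \<or> u = p \<and> v = q) \<and> p \<le> c \<and> c \<le> q \<and> p < q \<and> u \<le> v \<and>
    (k = 2 \<longrightarrow> q = a * p + 1 - a * c \<and> p = b * (q - c))"
  obtain F d e where *: "lorenz_full a b c F" "F d c" "F c e" "0 \<le> d" "d < c" "c < e" "e \<le> 1"
    "F 0 1 \<Longrightarrow> equivalent_to_lebesgue \<mu>" using full_structure by metis
  interpret L: lorenz_full a b c F by (rule *)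
  have short: "\<not> has_period a b c n x" if "n < k" for n x using min_period_enat(2)[OF k(2) that] .
  consider (left) x where "0 < x" "x \<le> 1" "(fL ^^ k) x = x"
      "Q = (\<lambda>i. let y = (fL ^^ i) x in if y \<le> c then Inl y else Inr y) ` {..<k}"
    | (right) x where "0 \<le> x" "x < 1" "(fR ^^ k) x = x"
      "Q = (\<lambda>i. let y = (fR ^^ i) x in if y < c then Inl y else Inr y) ` {..<k}"
    using Q unfolding periodic_orbit_def iter_left_eq iter_right_eq by auto
  then have ?thesis'
  proof cases
    case left
    interpret O: lorenz_full_orbit a b c F k x
      by unfold_locales (use k left short in auto)
    have "{y. Inl y \<in> Q} = {y \<in> O.orb. y \<le> c}" "{y. Inr y \<in> Q} = {y \<in> O.orb. c < y}"
      unfolding left(4) O.orb_def by (auto simp: Let_def image_iff split: if_splits)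
    then have pq: "p = O.PL" "q = O.PR"
      by (simp_all add: p_def q_def orbit_left_def orbit_right_def O.PL_def O.PR_def)
    have uv: "u = O.A" "v = O.B" by (simp_all add: u_def v_def O.A_def O.B_def)
    have uv': "u \<le> v" using O.A_less O.B_greater O.B_eq O.PL(2) unfolding uv by (cases "O.PL = c") auto
    have "equivalent_to_lebesgue \<mu> \<longleftrightarrow> u < p \<or> q < v \<or> u = p \<and> v = q"
    proof
      assume "u < p \<or> q < v \<or> u = p \<and> v = q"
      then show "equivalent_to_lebesgue \<mu>"
        using *(8) O.F_unit_iff_cond[OF *(2-7)] unfolding pq uv by blast
    next
      assume equiv: "equivalent_to_lebesgue \<mu>"
      show "u < p \<or> q < v \<or> u = p \<and> v = q"
      proof (rule ccontr)
        assume "\<not> ?thesis"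
        then have "O.PL \<le> O.A" "O.B \<le> O.PR" "\<not> (O.A = O.PL \<and> O.B = O.PR)" unfolding pq uv
          by auto
        then obtain l r where lr: "0 \<le> l" "l < r" "r \<le> 1"
          "\<forall>x\<in>{l<..<r}. \<forall>n>0. (fR ^^ n) x \<notin> {l<..<r}"
            using O.wandering_interval by metis
        then have "\<not> equivalent_to_lebesgue \<mu>" by (intro not_equivalent_if_wandering[of l r]) auto
        then show False using equiv by simp
      qed
    qed
    then show ?thesis
      using O.PL(2) O.PR(2) uv' O.orb_of_period_2 unfolding pq by auto
  next
    case right
    \<comment> \<open>An orbit followed from the right is reflected. It may contain
      \<open>c+\<close>, so here \<open>p < c \<le> q\<close>; \<open>p\<close>, \<open>q\<close>
      are the reflections of \<open>O.PR\<close>, \<open>O.PL\<close>, and \<open>u\<close>,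
      \<open>v\<close> those of \<open>O.B\<close>, \<open>O.A\<close>.\<close>
    interpret R: lorenz_full b a "1 - c" "\<lambda>l r. F (1 - r) (1 - l)" by (rule L.reflected_full)
    interpret O: lorenz_full_orbit b a "1 - c" "\<lambda>l r. F (1 - r) (1 - l)" k "1 - x"
    proof unfold_locales
      show "(R.fL ^^ k) (1 - x) = 1 - x" using right by (simp add: lorenzl_funpow_reflect)
      show "\<not> has_period b a (1 - c) n y" if "0 < n" "n < k" for n y
        using short[OF that(2), of "1 - y"] has_period_reflect[of n "1 - y"] by simp
    qed (use k right in auto)
    define orb where "orb = (\<lambda>i. (fR ^^ i) x) ` {..<k}"
    have fin: "finite orb" by (simp add: orb_def)
    have orb: "1 - y \<in> O.orb \<longleftrightarrow> y \<in> orb" for y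
      unfolding O.orb_def orb_def lorenzl_funpow_reflect by auto
    have orb': "y \<in> O.orb \<longleftrightarrow> 1 - y \<in> orb" for y using orb[of "1 - y"] by simp
    have Qs: "{y. Inl y \<in> Q} = {y \<in> orb. y < c}" "{y. Inr y \<in> Q} = {y \<in> orb. c \<le> y}"
      unfolding right(4) orb_def by (auto simp: Let_def image_iff split: if_splits)
    have "p = 1 - O.PR" unfolding p_def orbit_left_def Qs(1)
    proof (rule Max_eqI)
      show "y \<le> 1 - O.PR" if "y \<in> {y \<in> orb. y < c}" for y using O.PR(3)[of "1 - y"] that orb
        by auto
      show "1 - O.PR \<in> {y \<in> orb. y < c}" using O.PR(1,2) orb' by auto
    qed (use fin in auto)
    moreover have "q = 1 - O.PL" unfolding q_def orbit_right_def Qs(2)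
    proof (rule Min_eqI)
      show "1 - O.PL \<le> y" if "y \<in> {y \<in> orb. c \<le> y}" for y using O.PL(3)[of "1 - y"] that orb
        by auto
      show "1 - O.PL \<in> {y \<in> orb. c \<le> y}" using O.PL(1,2) orb' by auto
    qed (use fin in auto)
    ultimately have pq: "p = 1 - O.PR" "q = 1 - O.PL" .
    have uv: "u = 1 - O.B" "v = 1 - O.A"
      by (simp_all add: u_def v_def O.A_def O.B_def lorenz_funpow_reflect lorenzl_funpow_reflect)
    have uv': "u \<le> v" using O.A_less O.B_greater O.B_eq O.PL(2) unfolding uv
      by (cases "O.PL = 1 - c") auto
    have "equivalent_to_lebesgue \<mu> \<longleftrightarrow> u < p \<or> q < v \<or> u = p \<and> v = q"
    proof
      assume "u < p \<or> q < v \<or> u = p \<and> v = q"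
      then have "F (1 - 1) (1 - 0)"
        using * unfolding pq uv by (intro O.F_unit_iff_cond[of "1 - e" "1 - d"]) auto
      then show "equivalent_to_lebesgue \<mu>" using *(8) by simp
    next
      assume equiv: "equivalent_to_lebesgue \<mu>"
      show "u < p \<or> q < v \<or> u = p \<and> v = q"
      proof (rule ccontr)
        assume "\<not> ?thesis"
        then have "O.PL \<le> O.A" "O.B \<le> O.PR" "\<not> (O.A = O.PL \<and> O.B = O.PR)" unfolding pq uv
          by auto
        then obtain l r where lr: "0 \<le> l" "l < r" "r \<le> 1"
          "\<forall>x\<in>{l<..<r}. \<forall>n>0. (R.fR ^^ n) x \<notin> {l<..<r}"
            using O.wandering_interval by metis
        have "\<not> (1 - r < (fR ^^ n) x \<and> (fR ^^ n) x < 1 - l)"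
          if x: "1 - r < x" "x < 1 - l" "\<forall>i. (fR ^^ i) x \<noteq> c" "0 < n" for x n
        proof -
          have "(R.fR ^^ n) (1 - x) = 1 - (fR ^^ n) x"
            using funpow_fL_eq_fR'[of n x] x(3) by (simp add: lorenz_funpow_reflect)
          then show ?thesis using lr(4)[rule_format, of "1 - x" n] x by auto
        qed
        then have "\<not> equivalent_to_lebesgue \<mu>"
          using lr by (intro not_equivalent_if_wandering[of "1 - r" "1 - l"]) auto
        then show False using equiv by simp
      qed
    qed
    moreover have "q = a * p + 1 - a * c \<and> p = b * (q - c)" if "k = 2"
    proof -
      have "1 - O.PL = a * (1 - O.PR) + 1 - a * c"
        using O.orb_of_period_2(2)[OF that] by (simp add: algebra_simps)
      moreover have "1 - O.PR = b * (1 - O.PL - c)"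
        using O.orb_of_period_2(1)[OF that] by (simp add: algebra_simps)
      ultimately show ?thesis unfolding pq by simp
    qed
    ultimately show ?thesis
      using O.PL(2) O.PR(2) uv' unfolding pq by auto
  qed
  then show "equivalent_to_lebesgue \<mu> \<longleftrightarrow> u < p \<or> q < v \<or> u = p \<and> v = q" "p \<le> c" "c \<le> q" "p < q" "u \<le> v"
    "k = 2 \<Longrightarrow> q = a * p + 1 - a * c \<and> p = b * (q - c)" by blast+
qed

lemma ex_periodic_orbit:
  assumes "min_period a b c = enat k" "0 < k"
  shows "\<exists>Q. periodic_orbit a b c k Q"
proof -
  obtain x where "has_period a b c k x" using min_period_enat(1)[OF assms(1)] by blast
  then show ?thesis unfolding has_period_def periodic_orbit_def by blast
qed

end

text \<open>Here \<open>x\<close> and \<open>y\<close> are the distances of \<open>c\<close> from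
  the two points of the orbit and \<open>g = a * b - 1\<close>; the distances of \<open>c\<close>
  from \<open>A\<close> and \<open>B\<close> are then \<open>g * y\<close> and \<open>g * x\<close>.
  The factor \<open>g\<close> cancels in \<open>M\<close>, which is the ratio of the smaller to the
  larger of \<open>x\<close> and \<open>y\<close>. If they differ, the weaker of the two strict
  inequalities decides and the equalities cannot both hold.\<close>

lemma period_2_condition:
  fixes g x y :: real
  assumes "0 \<le> x" "0 \<le> y" "0 < x + y" "0 < g"
  defines "M \<equiv> min (ereal (g * y) / ereal (g * x)) (ereal (g * x) / ereal (g * y))"
  shows "(x < g * y \<or> y < g * x \<or> x = g * y \<and> y = g * x) \<longleftrightarrow>
    (M < 1 \<longrightarrow> ereal (1 + g) > 1 + M) \<and> (M = 1 \<longrightarrow> 1 + g \<ge> 2)"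
proof -
  consider "x = 0" | "y = 0" | "0 < x" "x < y" | "0 < y" "y < x" | "0 < x" "x = y" using assms by linarith
  then show ?thesis
  proof cases
    \<comment> \<open>One quotient is infinite and the other 0, so \<open>M = 0\<close> and the
      condition reduces to \<open>g > 0\<close>.\<close>
    case 1
    then have "0 < g * y" using assms by simp
    then have "M = 0" using 1 assms by (simp add: M_def min_def)
    then show ?thesis using 1 \<open>0 < g * y\<close> assms by (simp add: one_ereal_def)
  next
    case 2
    then have "0 < g * x" using assms by simp
    then have "M = 0" using 2 assms by (simp add: M_def min_def)
    then show ?thesis using 2 \<open>0 < g * x\<close> assms by (simp add: one_ereal_def)
  next
    case 3
    then have "x / y < 1" "1 < y / x" by simp_all
    moreover have "ereal (g * y) / ereal (g * x) = ereal (y / x)" "ereal (g * x) / ereal (g * y) = ereal (x / y)"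
      using 3 assms(4) by simp_all
    ultimately have M: "M = ereal (x / y)" by (simp add: M_def min_def)
    have "x / y < g \<longleftrightarrow> x < g * y" using 3 by (simp add: field_simps)
    moreover have "x < g * y" if "y < g * x"
    proof -
      have "g * x < g * y" using 3 assms by simp
      then show ?thesis using that 3 by linarith
    qed
    moreover have False if "x = g * y" "y = g * x"
    proof -
      have "g * x < g * y" using 3 assms by simp
      then show False using that 3 by linarith
    qed
    ultimately show ?thesis using \<open>x / y < 1\<close> unfolding M by (auto simp: one_ereal_def)
  next
    case 4
    then have "y / x < 1" "1 < x / y" by simp_all
    moreover have "ereal (g * y) / ereal (g * x) = ereal (y / x)" "ereal (g * x) / ereal (g * y) = ereal (x / y)"
      using 4 assms(4) by simp_all
    ultimately have M: "M = ereal (y / x)" by (simp add: M_def min_def)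
    have "y / x < g \<longleftrightarrow> y < g * x" using 4 by (simp add: field_simps)
    moreover have "y < g * x" if "x < g * y"
    proof -
      have "g * y < g * x" using 4 assms by simp
      then show ?thesis using that 4 by linarith
    qed
    moreover have False if "x = g * y" "y = g * x"
    proof -
      have "g * y < g * x" using 4 assms by simp
      then show False using that 4 by linarith
    qed
    ultimately show ?thesis using \<open>y / x < 1\<close> unfolding M by (auto simp: one_ereal_def)
  next
    case 5
    then have M: "M = 1" using assms by (simp add: M_def min_def one_ereal_def)
    have "x < g * x \<longleftrightarrow> 1 < g" "x = g * x \<longleftrightarrow> g = 1" using 5 by auto
    then show ?thesis using M 5 by auto
  qed
qed

theorem theoremB:
  fixes a b c :: real and \<mu> :: "real measure"
  assumes "a > 0" and "b > 0" and "0 < c" and "c < 1"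
    and "a * c \<le> 1" and "b * (1 - c) \<le> 1"
    and "a * c + b * (1 - c) > 1"
    and "acim a b c \<mu>"
  shows
    "(min_period a b c = 1 \<longrightarrow> equivalent_to_lebesgue \<mu>) \<and>
     (\<forall>(k::nat) Q. 2 \<le> k \<and> min_period a b c = enat k \<and> periodic_orbit a b c k Q \<longrightarrow>
        (let PL = orbit_left Q; PR = orbit_right Q;
             A = iter_right a b c k c; B = iter_left a b c k c
         in equivalent_to_lebesgue \<mu> \<longleftrightarrow>
              {A..B} - {PL..PR} \<noteq> {} \<or> {A..B} = {PL..PR})) \<and>
     (min_period a b c = 2 \<longrightarrow>
        (let A = iter_right a b c 2 c; B = iter_left a b c 2 c;
             M = min (ereal (c - A) / ereal (B - c)) (ereal (B - c) / ereal (c - A))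
         in equivalent_to_lebesgue \<mu> \<longleftrightarrow>
              (M < 1 \<longrightarrow> ereal (a * b) > 1 + M) \<and> (M = 1 \<longrightarrow> a * b \<ge> 2)))"
proof (intro conjI allI impI)
  interpret lorenz_acim a b c \<mu> using assms by unfold_locales
  show "equivalent_to_lebesgue \<mu>" if "min_period a b c = 1" using equivalent_if_period_1[OF that] .
  show "let PL = orbit_left Q; PR = orbit_right Q; A = iter_right a b c k c; B = iter_left a b c k c
      in equivalent_to_lebesgue \<mu> \<longleftrightarrow> {A..B} - {PL..PR} \<noteq> {} \<or> {A..B} = {PL..PR}"
    if "2 \<le> k \<and> min_period a b c = enat k \<and> periodic_orbit a b c k Q" for k Q
  proof -
    have k: "2 \<le> k" "min_period a b c = enat k" "periodic_orbit a b c k Q" using that by auto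
    \<comment> \<open>Both intervals are nonempty, so the conditions on sets become conditions on
      their ends.\<close>
    have sets: "{u..v} - {p..q} \<noteq> {} \<or> {u..v} = {p..q} \<longleftrightarrow> u < p \<or> q < v \<or> u = p \<and> v = q"
      if "u \<le> v" "p < q" for u v p q :: real
    proof -
      have "{u..v} - {p..q} = {} \<longleftrightarrow> p \<le> u \<and> v \<le> q" using that(1) by (simp add: Diff_eq_empty_iff)
      moreover have "{u..v} = {p..q} \<longleftrightarrow> u = p \<and> v = q" using that by (simp add: Icc_eq_Icc)
      ultimately show ?thesis by auto
    qed
    note iff = equivalent_iff_orbit[OF k]
    show ?thesis
      unfolding Let_def iter_left_eq iter_right_eq sets[OF iff(5,4)] by (rule iff(1))
  qed
  show "let A = iter_right a b c 2 c; B = iter_left a b c 2 c;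
       M = min (ereal (c - A) / ereal (B - c)) (ereal (B - c) / ereal (c - A))
     in equivalent_to_lebesgue \<mu> \<longleftrightarrow> (M < 1 \<longrightarrow> ereal (a * b) > 1 + M) \<and> (M = 1 \<longrightarrow> a * b \<ge> 2)"
    if "min_period a b c = 2"
  proof -
    have k: "min_period a b c = enat 2" using that by (simp add: numeral_eq_enat)
    obtain Q where Q: "periodic_orbit a b c 2 Q" using ex_periodic_orbit[OF k] by auto
    note iff = equivalent_iff_orbit[OF order_refl k Q]
    define p q where "p = orbit_left Q" and "q = orbit_right Q"
    define x y g where "x = c - p" and "y = q - c" and "g = a * b - 1"
    have "fR 0 = 1 - a * c" "fL 1 = b * (1 - c)" using c_pos c_less by (simp_all add: lorenz_def lorenzl_def)
    then have u: "(fR ^^ 2) c = 1 - a * c" and v: "(fL ^^ 2) c = b * (1 - c)"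
      by (simp_all only: numeral_2_eq_2 funpow.simps o_apply id_apply fR_c fL_c)
    have pq: "q = a * p + 1 - a * c" "p = b * (q - c)" using iff(6)[OF refl] unfolding p_def q_def by blast+
    have yx: "1 - c = y + a * x" using pq(1) by (simp add: x_def y_def algebra_simps)
    have xy: "b * y = c - x" using pq(2) by (simp add: x_def y_def)
    have B: "b * (1 - c) = c + g * x"
    proof -
      have "b * (1 - c) = b * y + a * b * x" unfolding yx by (simp add: algebra_simps)
      then show ?thesis unfolding xy by (simp add: g_def algebra_simps)
    qed
    have A: "1 - a * c = c - g * y"
    proof -
      have "c - g * y = c + y - a * (b * y)" by (simp add: g_def algebra_simps)
      also have "\<dots> = c + y + a * x - a * c" unfolding xy by (simp add: algebra_simps)
      finally show ?thesis using yx by linarith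
    qed
    have pos: "0 \<le> x" "0 \<le> y" "0 < x + y" using iff(2-4) by (auto simp: x_def y_def p_def q_def)
    \<comment> \<open>\<open>g * (x + y)\<close> is the distance from \<open>A = 1 - a * c\<close>
      to \<open>B = b * (1 - c)\<close>, which \<open>overlap\<close> makes positive.\<close>
    have "g * (x + y) > 0" using A B overlap by (simp add: distrib_left)
    then have g: "g > 0" using pos by (simp add: zero_less_mult_iff)
    have "c - g * y < p \<longleftrightarrow> x < g * y" "c - g * y = p \<longleftrightarrow> x = g * y" by (auto simp: x_def)
    moreover have "q < c + g * x \<longleftrightarrow> y < g * x" "c + g * x = q \<longleftrightarrow> y = g * x" by (auto simp: y_def)
    ultimately have eq: "equivalent_to_lebesgue \<mu> \<longleftrightarrow> x < g * y \<or> y < g * x \<or> x = g * y \<and> y = g * x"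
      using iff(1) unfolding u v A B p_def[symmetric] q_def[symmetric] by simp
    have diff: "c - (c - g * y) = g * y" "c + g * x - c = g * x" and ab: "a * b = 1 + g"
      by (simp_all add: g_def)
    show ?thesis
      unfolding Let_def iter_left_eq iter_right_eq u v A B diff ab eq
      by (rule period_2_condition[OF pos g])
  qed
qed

end
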